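(* Let $k\ge 0$ and $n\ge 1$ be integers with $n\ge k$, let $\mathsf{V}=\mathsf{V}(0)\oplus\mathsf{V}(1)$ be the $(n+1)$-dimensional $\mathsf{O}_n(\mathbb{C})$-module described in the context, and let $\pi_k:\mathsf{RB}_k(n+1)\to\operatorname{End}(\mathsf{V}^{\otimes k})$ be the representation of the rook-Brauer algebra on tensor space. Then $\pi_k$ gives an algebra isomorphism $$\mathsf{RB}_k(n+1)\;\cong\;\operatorname{End}_{\mathsf{O}_n(\mathbb{C})}(\mathsf{V}^{\otimes k}).$$ Thus $\mathsf{RB}_k(n+1)$ and $\mathsf{O}_n(\mathbb{C})$ centralize one another on $\mathsf{V}^{\otimes k}$: in addition, the subalgebra of $\operatorname{End}(\mathsf{V}^{\otimes k})$ generated by the image of $\mathsf{O}_n(\mathbb{C})$ equals $\operatorname{End}_{\mathsf{RB}_k(n+1)}(\mathsf{V}^{\otimes k})$.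
   Context: $\mathsf{O}_n(\mathbb{C})=\{g\in\mathsf{GL}_n(\mathbb{C}) : gg^t=I\}$. $\mathsf{V}(0)=\mathbb{C}v_0$ is the trivial module and $\mathsf{V}(1)=\mathbb{C}^n$, with basis $v_1,\dots,v_n$, is the defining module: for $g=(g_{ij})$, $g v_0=v_0$ and $g v_j=\sum_{i=1}^n g_{ij}v_i$ for $1\le j\le n$. The group acts diagonally on $\mathsf{V}^{\otimes k}$. $\mathsf{V}^{\otimes 0}$ is the trivial module. A rook-Brauer $k$-diagram is a graph on two rows of $k$ vertices each (a top row and a bottom row, each numbered $1,\dots,k$ from left to right) in which each vertex is joined by an edge to at most one other vertex. The set of these diagrams is $\mathcal{RB}_k$. For $x\in\mathbb{C}$, the rook-Brauer algebra $\mathsf{RB}_k(x)$ is the $\mathbb{C}$-vector space with basis $\mathcal{RB}_k$ (with $\mathsf{RB}_0(x)=\mathbb{C}1$) and bilinear multiplication determined as follows. For diagrams $d_1,d_2$, place $d_1$ above $d_2$ and identify the bottom vertices of $d_1$ with the corresponding top vertices of $d_2$. Then $d_1d_2=x^{\kappa(d_1,d_2)}d_3$, where $\kappa(d_1,d_2)$ is the number of closed loops formed entirely in the middle row, and $d_3$ is the rook-Brauer diagram on the top row of $d_1$ and the bottom row of $d_2$ in which two vertices are joined by an edge if and only if they lie in the same connected component of the stacked graph. (Components contained in the middle row that are not closed loops are discarded with factor $1$.) The representation $\pi_k$ is the linear map given on diagrams by $$\pi_k(d)(v_{i_1}\otimes\cdots\otimes v_{i_k})=\sum_{j_1,\dots,j_k\in\{0,\dots,n\}}(d)_{i_1,\dots,i_k}^{j_1,\dots,j_k}\;v_{j_1}\otimes\cdots\otimes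 v_{j_k}.$$ Here one labels the bottom vertices of $d$ from left to right by $i_1,\dots,i_k$ and the top vertices by $j_1,\dots,j_k$, and $(d)_{i_1,\dots,i_k}^{j_1,\dots,j_k}$ is the product over all connected components of $d$ of the following weights: an isolated vertex labeled $a$ has weight $\delta_{a,0}$, and an edge joining vertices labeled $a$ and $b$ has weight $\delta_{a,b}$. *)

theory Defs
  imports
    Complex_Main
    "HOL-Library.FuncSet"
    "HOL-Library.Multiset"
    "HOL-Algebra.QuotRing"
    "HOL-Algebra.Subrings"
    "Jordan_Normal_Form.Matrix"
begin

section \<open>Algebras over the complex numbers\<close>

text \<open>
  A complex algebra is stored in the library record \<^typ>\<open>(complex, 'a) module\<close>, which has
  the ring operations together with a scalar multiplication.
\<close>

definition algebra_iso ::
    "(complex, 'a) module \<Rightarrow> (complex, 'b) module \<Rightarrow> ('a \<Rightarrow> 'b) set" where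
  "algebra_iso A B = {h \<in> ring_iso A B.
     \<forall>c. \<forall>a \<in> carrier A. h (c \<odot>\<^bsub>A\<^esub> a) = c \<odot>\<^bsub>B\<^esub> h a}"

definition is_subalgebra :: "'a set \<Rightarrow> (complex, 'a) module \<Rightarrow> bool" where
  "is_subalgebra B A \<longleftrightarrow> subring B A \<and> (\<forall>c. \<forall>b \<in> B. c \<odot>\<^bsub>A\<^esub> b \<in> B)"

definition generated_subalgebra :: "(complex, 'a) module \<Rightarrow> 'a set \<Rightarrow> 'a set" where
  "generated_subalgebra A S = \<Inter> {B. is_subalgebra B A \<and> S \<subseteq> B}"

definition commutant :: "(complex, 'a) module \<Rightarrow> 'a set \<Rightarrow> (complex, 'a) module" where
  "commutant A S =
     A\<lparr>carrier := {F \<in> carrier A. \<forall>G \<in> S. F \<otimes>\<^bsub>A\<^esub> G = G \<otimes>\<^bsub>A\<^esub> F}\<rparr>"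


section \<open>Tensor space\<close>

text \<open>
  \<open>V\<close> is the space of complex column vectors of dimension \<open>n + 1\<close>, with
  basis \<open>v\<^sub>0, \<dots>, v\<^sub>n\<close> given by the unit vectors.  A tensor of degree \<open>k\<close> is
  given by its coordinates with respect to the basis
  \<open>v\<^bsub>i 1\<^esub> \<otimes> \<dots> \<otimes> v\<^bsub>i k\<^esub>\<close>, where \<open>i\<close> ranges over \<open>indices n k\<close>;
  coordinates at all other arguments are \<open>0\<close>.
\<close>

type_synonym index = "nat \<Rightarrow> nat"
type_synonym tensor = "index \<Rightarrow> complex"

definition indices :: "nat \<Rightarrow> nat \<Rightarrow> index set" where
  "indices n k = {1..k} \<rightarrow>\<^sub>E {0..n}"

definition tensor_space :: "nat \<Rightarrow> nat \<Rightarrow> tensor set" where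
  "tensor_space n k = {t. \<forall>i. i \<notin> indices n k \<longrightarrow> t i = 0}"

text \<open>The decomposable tensor \<open>u 1 \<otimes> \<dots> \<otimes> u k\<close>.\<close>

definition pure_tensor :: "nat \<Rightarrow> nat \<Rightarrow> (nat \<Rightarrow> complex vec) \<Rightarrow> tensor" where
  "pure_tensor n k u =
     (\<lambda>j. if j \<in> indices n k then \<Prod>p = 1..k. u p $ j p else 0)"

text \<open>The linear map sending the basis tensor with index \<open>i\<close> to \<open>B i\<close>.\<close>

definition linear_extension :: "nat \<Rightarrow> nat \<Rightarrow> (index \<Rightarrow> tensor) \<Rightarrow> tensor \<Rightarrow> tensor" where
  "linear_extension n k B =
     (\<lambda>t \<in> tensor_space n k. \<lambda>j. \<Sum>i \<in> indices n k. t i * B i j)"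

text \<open>Endomorphisms are extensional functions, so that equality of operators is equality in HOL.\<close>

definition End_tensor :: "nat \<Rightarrow> nat \<Rightarrow> (complex, tensor \<Rightarrow> tensor) module" where
  "End_tensor n k =
     \<lparr> carrier = {F \<in> tensor_space n k \<rightarrow>\<^sub>E tensor_space n k.
         (\<forall>s \<in> tensor_space n k. \<forall>t \<in> tensor_space n k.
            F (\<lambda>i. s i + t i) = (\<lambda>i. F s i + F t i)) \<and>
         (\<forall>c. \<forall>t \<in> tensor_space n k. F (\<lambda>i. c * t i) = (\<lambda>i. c * F t i))},
       monoid.mult = compose (tensor_space n k),
       one = (\<lambda>t \<in> tensor_space n k. t),
       zero = (\<lambda>t \<in> tensor_space n k. \<lambda>i. 0),
       add = (\<lambda>F G. \<lambda>t \<in> tensor_space n k. \<lambda>i. F t i + G t i),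
       smult = (\<lambda>c F. \<lambda>t \<in> tensor_space n k. \<lambda>i. c * F t i) \<rparr>"


section \<open>The orthogonal group and its action\<close>

definition orthogonal_group :: "nat \<Rightarrow> complex mat set" where
  "orthogonal_group n =
     {g \<in> carrier_mat n n. invertible_mat g \<and> g * transpose_mat g = 1\<^sub>m n}"

text \<open>
  The matrix of \<open>g\<close> on \<open>V(0) \<oplus> V(1)\<close>.  Its rows and columns are numbered \<open>0, \<dots>, n\<close> as the
  basis of \<open>V\<close> is; the entries of \<open>g\<close> itself are numbered from \<open>0\<close> to \<open>n - 1\<close>.
\<close>

definition module_mat :: "nat \<Rightarrow> complex mat \<Rightarrow> complex mat" where
  "module_mat n g = four_block_mat (1\<^sub>m 1) (0\<^sub>m 1 n) (0\<^sub>m n 1) g"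

definition group_action :: "nat \<Rightarrow> nat \<Rightarrow> complex mat \<Rightarrow> tensor \<Rightarrow> tensor" where
  "group_action n k g = linear_extension n k
     (\<lambda>i. pure_tensor n k (\<lambda>p. module_mat n g *\<^sub>v unit_vec (n + 1) (i p)))"


section \<open>Rook-Brauer diagrams\<close>

text \<open>
  A diagram is given by its set of edges.  The level \<open>Middle\<close> occurs only in the graph obtained
  by stacking two diagrams.
\<close>

datatype level = Top | Middle | Bottom

type_synonym vertex = "level \<times> nat"
type_synonym diagram = "vertex set set"

definition vertices :: "nat \<Rightarrow> vertex set" where
  "vertices k = {Top, Bottom} \<times> {1..k}"

definition rook_brauer_diagrams :: "nat \<Rightarrow> diagram set" where
  "rook_brauer_diagrams k =
     {d. (\<forall>e \<in> d. e \<subseteq> vertices k \<and> card e = 2) \<and>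
         (\<forall>v \<in> vertices k. \<exists>\<^sub>\<le>\<^sub>1 w. {v, w} \<in> d)}"

definition identity_diagram :: "nat \<Rightarrow> diagram" where
  "identity_diagram k = {{(Top, p), (Bottom, p)} | p. p \<in> {1..k}}"

fun upper :: "vertex \<Rightarrow> vertex" where
  "upper (l, p) = (if l = Bottom then Middle else l, p)"

fun lower :: "vertex \<Rightarrow> vertex" where
  "lower (l, p) = (if l = Top then Middle else l, p)"

text \<open>
  The stacked graph can have a double edge, namely if the bottom row of \<open>d1\<close> and the top row
  of \<open>d2\<close> contain the same edge; such a double edge is a closed loop.  Hence its
  edges form a multiset.
\<close>

definition stack :: "diagram \<Rightarrow> diagram \<Rightarrow> vertex set multiset" where
  "stack d1 d2 =
     image_mset ((`) upper) (mset_set d1) + image_mset ((`) lower) (mset_set d2)"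

definition vertex_degree :: "vertex set multiset \<Rightarrow> vertex \<Rightarrow> nat" where
  "vertex_degree E v = size {#e \<in># E. v \<in> e#}"

definition connected_rel :: "vertex set multiset \<Rightarrow> (vertex \<times> vertex) set" where
  "connected_rel E = {(u, v). {u, v} \<in># E}\<^sup>*"

definition components :: "nat \<Rightarrow> vertex set multiset \<Rightarrow> vertex set set" where
  "components k E = (UNIV \<times> {1..k}) // connected_rel E"

text \<open>A finite connected component is a closed loop iff all its vertices have degree \<open>2\<close>.\<close>

definition loops :: "nat \<Rightarrow> diagram \<Rightarrow> diagram \<Rightarrow> nat" where
  "loops k d1 d2 =
     card {C \<in> components k (stack d1 d2).
             C \<subseteq> {Middle} \<times> {1..k} \<and> (\<forall>v \<in> C. vertex_degree (stack d1 d2) v = 2)}"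

definition diagram_comp :: "nat \<Rightarrow> diagram \<Rightarrow> diagram \<Rightarrow> diagram" where
  "diagram_comp k d1 d2 =
     {{u, v} | u v. u \<in> vertices k \<and> v \<in> vertices k \<and> u \<noteq> v \<and>
                    (u, v) \<in> connected_rel (stack d1 d2)}"


section \<open>The rook-Brauer algebra and its representation\<close>

text \<open>
  The element \<open>a\<close> of the algebra is the linear combination of diagrams in which \<open>d\<close> has
  coefficient \<open>a d\<close>.
\<close>

definition rook_brauer_algebra ::
    "nat \<Rightarrow> complex \<Rightarrow> (complex, diagram \<Rightarrow> complex) module" where
  "rook_brauer_algebra k x =
     \<lparr> carrier = {a. \<forall>d. d \<notin> rook_brauer_diagrams k \<longrightarrow> a d = 0},
       monoid.mult = (\<lambda>a b. \<lambda>d. \<Sum>d1 \<in> rook_brauer_diagrams k. \<Sum>d2 \<in> rook_brauer_diagrams k.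
         a d1 * b d2 * (if d = diagram_comp k d1 d2 then x ^ loops k d1 d2 else 0)),
       one = (\<lambda>d. if d = identity_diagram k then 1 else 0),
       zero = (\<lambda>d. 0),
       add = (\<lambda>a b. \<lambda>d. a d + b d),
       smult = (\<lambda>c a. \<lambda>d. c * a d) \<rparr>"

fun vertex_label :: "index \<Rightarrow> index \<Rightarrow> vertex \<Rightarrow> nat" where
  "vertex_label i j (l, p) = (if l = Bottom then i p else j p)"

text \<open>
  The matrix coefficient of \<open>d\<close> in column \<open>i\<close> and row \<open>j\<close>.  The connected components of a
  diagram are its edges and its isolated vertices.
\<close>

definition diagram_weight :: "nat \<Rightarrow> diagram \<Rightarrow> index \<Rightarrow> index \<Rightarrow> complex" where
  "diagram_weight k d i j =
     (\<Prod>e \<in> d. if \<forall>u \<in> e. \<forall>v \<in> e. vertex_label i j u = vertex_label i j v then 1 else 0) *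
     (\<Prod>v \<in> vertices k - \<Union> d. if vertex_label i j v = 0 then 1 else 0)"

definition diagram_action :: "nat \<Rightarrow> nat \<Rightarrow> diagram \<Rightarrow> tensor \<Rightarrow> tensor" where
  "diagram_action n k d = linear_extension n k
     (\<lambda>i j. if j \<in> indices n k then diagram_weight k d i j else 0)"

definition rb_representation ::
    "nat \<Rightarrow> nat \<Rightarrow> (diagram \<Rightarrow> complex) \<Rightarrow> tensor \<Rightarrow> tensor" where
  "rb_representation n k a =
     (\<lambda>t \<in> tensor_space n k. \<lambda>j.
        \<Sum>d \<in> rook_brauer_diagrams k. a d * diagram_action n k d t j)"

end

theory Submission
  imports Defs "HOL-Combinatorics.Permutations" "Jordan_Normal_Form.Determinant"
begin

text \<open>
  Operators on tensor space are matrices indexed by pairs of multi-indices, and a matrix commutes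
  with the orthogonal group iff, as a tensor with \<open>2k\<close> slots, it is invariant.  The first fundamental
  theorem is replaced by a direct argument.  Invariance under signed permutation matrices and
  (infinitesimally) under rotations in coordinate planes determines an invariant tensor by its values
  at those labelings of the \<open>2k\<close> vertices in which every nonzero value occurs zero or two times; such
  labelings encode diagrams, and labels for all diagrams are available because \<open>k \<le> n\<close>.  The matrix of
  diagram weights at these labelings is the incidence matrix of \<open>\<subseteq>\<close> on diagrams, hence unitriangular,
  so the diagrams form a basis of the invariants.

  Multiplicativity is a count: for stacked diagrams, the middle labels compatible with given outer
  labels are free exactly on the closed loops.

  For the double centralizer property, the span of the group operators is closed under adjoints
  because the conjugate transpose of a complex orthogonal matrix is again orthogonal, so von Neumann's
  bicommutant argument applies.
\<close>

section \<open>The bicommutant theorem for matrices\<close>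

text \<open>Two features of the label \<open>0\<close> shape the argument. The trivial summand is
  fixed by the group, so \<open>0\<close> may occur any number of times in a labeling where an
  invariant tensor is nonzero, whereas sign changes force every nonzero value to occur an even
  number of times. And an edge accepts the labels \<open>0, 0\<close> just as two isolated vertices
  do; hence at a labeling made for \<open>d\<close> every diagram containing \<open>d\<close> has
  weight 1, which is why the inclusion order appears in place of an identity matrix.

  Differentiating at angle 0 keeps only the terms in which a single slot changes; the relation at a
  finite angle would mix all slots at once.

  The bound \<open>k \<le> n\<close> enters twice, each time as \<open>2 * k \<le> 2 * n\<close>:
  the edges of a diagram receive distinct nonzero values, and a value occurring four or more times
  can be spread to a value that is still free.

  A complex orthogonal matrix need not be unitary, so that group operators have group operators as
  adjoints is a fact with its own proof. The parameter \<open>n + 1\<close> is the number of labels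
  that a closed loop can carry.\<close>

definition inner_on :: "'a set \<Rightarrow> ('a \<Rightarrow> complex) \<Rightarrow> ('a \<Rightarrow> complex) \<Rightarrow> complex" where
  "inner_on J X Y = (\<Sum>x\<in>J. X x * cnj (Y x))"

lemma inner_on_self_eq_0:
  assumes "finite J" "inner_on J X X = 0" "x \<in> J"
  shows "X x = 0"
proof -
  have "inner_on J X X = complex_of_real (\<Sum>x\<in>J. (cmod (X x))\<^sup>2)"
    by (simp add: inner_on_def complex_norm_square[symmetric])
  then have "(\<Sum>x\<in>J. (cmod (X x))\<^sup>2) = 0"
    using assms(2) by (metis of_real_eq_0_iff)
  then show ?thesis
    using assms(1,3) by (simp add: sum_nonneg_eq_0_iff)
qed

lemma inner_on_add_right: "inner_on J Z (\<lambda>x. X x + Y x) = inner_on J Z X + inner_on J Z Y"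
  by (simp add: inner_on_def algebra_simps sum.distrib)

lemma inner_on_diff_left: "inner_on J (\<lambda>x. X x - Y x) Z = inner_on J X Z - inner_on J Y Z"
  by (simp add: inner_on_def algebra_simps sum_subtractf)

lemma inner_on_scale_left: "inner_on J (\<lambda>x. c * X x) Z = c * inner_on J X Z"
  by (simp add: inner_on_def sum_distrib_left mult.assoc)

lemma inner_on_scale_right: "inner_on J Z (\<lambda>x. c * X x) = cnj c * inner_on J Z X"
  by (simp add: inner_on_def sum_distrib_left mult_ac)

lemma inner_on_sum_left:
  "inner_on J (\<lambda>x. \<Sum>m\<in>K. X m x) Z = (\<Sum>m\<in>K. inner_on J (X m) Z)"
  unfolding inner_on_def by (simp add: sum_distrib_right) (rule sum.swap)

text \<open>The support \<open>J\<close> is kept apart from the index set of the inner product, so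
  that an induction can shrink \<open>J\<close> while the inner product stays fixed.\<close>

definition function_subspace :: "'a set \<Rightarrow> ('a \<Rightarrow> complex) set \<Rightarrow> bool" where
  "function_subspace J U \<longleftrightarrow> (\<lambda>x. 0) \<in> U \<and> (\<forall>u\<in>U. \<forall>v\<in>U. (\<lambda>x. u x + v x) \<in> U) \<and>
     (\<forall>c. \<forall>u\<in>U. (\<lambda>x. c * u x) \<in> U) \<and> (\<forall>u\<in>U. \<forall>x. x \<notin> J \<longrightarrow> u x = 0)"

text \<open>
  The induction removes a coordinate \<open>y\<close> of the support: the vectors of \<open>U\<close> vanishing at \<open>y\<close> form a
  subspace of codimension at most one, and one Gram-Schmidt step passes from it to \<open>U\<close>.
\<close>

lemma orthogonal_projection_exists:
  assumes "finite K" "finite J" "J \<subseteq> K" "function_subspace J U"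
  shows "\<exists>u\<in>U. \<forall>v\<in>U. inner_on K (\<lambda>x. X x - u x) v = 0"
  using assms(2,3,4)
proof (induction J arbitrary: U X rule: finite_induct)
  case empty
  then have "v = (\<lambda>x. 0)" if "v \<in> U" for v
    using that by (auto simp: function_subspace_def)
  then have "inner_on K (\<lambda>x. X x - 0) v = 0" if "v \<in> U" for v
    using that by (force simp: inner_on_def)
  moreover have "(\<lambda>x. 0) \<in> U"
    using empty by (simp add: function_subspace_def)
  ultimately show ?case
    by (intro bexI[of _ "\<lambda>x. 0"]) auto
next
  case (insert y J)
  have add: "\<And>u v. u \<in> U \<Longrightarrow> v \<in> U \<Longrightarrow> (\<lambda>x. u x + v x) \<in> U"
    and scale: "\<And>c u. u \<in> U \<Longrightarrow> (\<lambda>x. c * u x) \<in> U"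
    using insert.prems by (auto simp: function_subspace_def)
  define U0 where "U0 = {u \<in> U. u y = 0}"
  have U0: "function_subspace J U0"
    using insert.prems by (auto simp: function_subspace_def U0_def)
  show ?case
  proof (cases "\<exists>u1\<in>U. u1 y \<noteq> 0")
    case False
    then have "U0 = U" by (auto simp: U0_def)
    then show ?thesis
      using insert.IH[of U0 X] U0 insert.prems by auto
  next
    case True
    then obtain u1 where u1: "u1 \<in> U" "u1 y \<noteq> 0" by blast
    obtain p1 where p1: "p1 \<in> U0" "\<forall>v\<in>U0. inner_on K (\<lambda>x. u1 x - p1 x) v = 0"
      using insert.IH[of U0 u1] U0 insert.prems by auto
    obtain p0 where p0: "p0 \<in> U0" "\<forall>v\<in>U0. inner_on K (\<lambda>x. X x - p0 x) v = 0"
      using insert.IH[of U0 X] U0 insert.prems by auto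
    \<comment> \<open>\<open>w\<close> is \<open>u1\<close> made orthogonal to \<open>U0\<close>. It
      spans a complement of \<open>U0\<close> in \<open>U\<close>, because \<open>p1\<close>
      vanishes at \<open>y\<close> and \<open>u1\<close> does not.\<close>
    define w where "w = (\<lambda>x. u1 x - p1 x)"
    have w_y: "w y \<noteq> 0" using u1 p1 by (auto simp: w_def U0_def)
    have w_U: "w \<in> U"
      using add[OF u1(1) scale[of p1 "-1"]] p1(1) by (auto simp: w_def U0_def)
    have w_orth: "inner_on K w v = 0" if "v \<in> U0" for v
      using p1(2) that by (simp add: w_def)
    have y: "y \<in> K" using insert.prems by auto
    have ww: "inner_on K w w \<noteq> 0"
      using inner_on_self_eq_0[OF assms(1) _ y] w_y by blast
    define c where "c = inner_on K (\<lambda>x. X x - p0 x) w / inner_on K w w"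
    define u where "u = (\<lambda>x. p0 x + c * w x)"
    have u_U: "u \<in> U"
      unfolding u_def using add scale w_U p0(1) by (simp add: U0_def)
    have eq: "inner_on K (\<lambda>x. X x - u x) v = inner_on K (\<lambda>x. X x - p0 x) v - c * inner_on K w v" for v
      using inner_on_diff_left[of K "\<lambda>x. X x - p0 x" "\<lambda>x. c * w x" v]
      by (simp add: u_def inner_on_scale_left algebra_simps)
    have orth_w: "inner_on K (\<lambda>x. X x - u x) w = 0"
      using ww by (simp add: eq c_def)
    have orth_U0: "inner_on K (\<lambda>x. X x - u x) v = 0" if "v \<in> U0" for v
      using p0(2) w_orth that by (simp add: eq)
    have "inner_on K (\<lambda>x. X x - u x) v = 0" if "v \<in> U" for v
    proof -
      \<comment> \<open>Subtracting \<open>b * w\<close> kills the coordinate \<open>y\<close>, so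
        every \<open>v\<close> in \<open>U\<close> is an element of \<open>U0\<close> plus a
        multiple of \<open>w\<close>.\<close>
      define b where "b = v y / w y"
      define v0 where "v0 = (\<lambda>x. v x + (- b) * w x)"
      have "v0 \<in> U0"
        using add[OF that scale[OF w_U, of "- b"]] w_y by (simp add: U0_def v0_def b_def)
      moreover have "inner_on K Y v = inner_on K Y v0 + cnj b * inner_on K Y w" for Y
        using inner_on_add_right[of K Y v0 "\<lambda>x. b * w x"]
        by (simp add: inner_on_scale_right v0_def)
      ultimately show ?thesis
        using orth_U0 orth_w by simp
    qed
    then show ?thesis using u_U by blast
  qed
qed

section \<open>Matrices over an arbitrary index set, and linear spans\<close>

definition mat_prod ::
    "'i set \<Rightarrow> ('i \<times> 'i \<Rightarrow> complex) \<Rightarrow> ('i \<times> 'i \<Rightarrow> complex) \<Rightarrow> 'i \<times> 'i \<Rightarrow> complex" where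
  "mat_prod I M N = (\<lambda>(j, i). \<Sum>l\<in>I. M (j, l) * N (l, i))"

text \<open>The condition \<open>i \<in> I\<close> makes the unit vanish outside
  \<open>I \<times> I\<close>, so that equality of matrices can be equality of functions.\<close>

definition mat_one :: "'i set \<Rightarrow> 'i \<times> 'i \<Rightarrow> complex" where
  "mat_one I = (\<lambda>(j, i). if j = i \<and> i \<in> I then 1 else 0)"

definition mat_adjoint :: "('i \<times> 'i \<Rightarrow> complex) \<Rightarrow> 'i \<times> 'i \<Rightarrow> complex" where
  "mat_adjoint M = (\<lambda>(j, i). cnj (M (i, j)))"

definition supported_on :: "'a set \<Rightarrow> ('a \<Rightarrow> complex) \<Rightarrow> bool" where
  "supported_on J M \<longleftrightarrow> (\<forall>x. x \<notin> J \<longrightarrow> M x = 0)"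

lemma supported_onD: "supported_on J M \<Longrightarrow> x \<notin> J \<Longrightarrow> M x = 0"
  by (simp add: supported_on_def)

text \<open>The span is inductive because it is used through its induction rule: whatever contains
  \<open>G\<close> and respects the linear operations contains the span, including the operators of
  a subalgebra.\<close>

inductive_set lin_span :: "('a \<Rightarrow> complex) set \<Rightarrow> ('a \<Rightarrow> complex) set" for G where
  zero: "(\<lambda>x. 0) \<in> lin_span G"
| base: "a \<in> G \<Longrightarrow> a \<in> lin_span G"
| add: "u \<in> lin_span G \<Longrightarrow> v \<in> lin_span G \<Longrightarrow> (\<lambda>x. u x + v x) \<in> lin_span G"
| scale: "u \<in> lin_span G \<Longrightarrow> (\<lambda>x. c * u x) \<in> lin_span G"

lemma lin_span_sum:
  assumes "finite K" "\<And>m. m \<in> K \<Longrightarrow> u m \<in> lin_span G"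
  shows "(\<lambda>x. \<Sum>m\<in>K. u m x) \<in> lin_span G"
  using assms by (induction K rule: finite_induct) (auto intro: lin_span.zero lin_span.add)

lemma mat_prod_add_right:
  "mat_prod I a (\<lambda>x. u x + v x) = (\<lambda>x. mat_prod I a u x + mat_prod I a v x)"
  by (auto simp: mat_prod_def fun_eq_iff algebra_simps sum.distrib)

lemma mat_prod_diff_right:
  "mat_prod I a (\<lambda>x. u x - v x) = (\<lambda>x. mat_prod I a u x - mat_prod I a v x)"
  by (auto simp: mat_prod_def fun_eq_iff algebra_simps sum_subtractf)

lemma mat_prod_scale_right:
  "mat_prod I a (\<lambda>x. c * u x) = (\<lambda>x. c * mat_prod I a u x)"
  by (auto simp: mat_prod_def fun_eq_iff sum_distrib_left mult_ac)

lemma mat_prod_assoc: "mat_prod I (mat_prod I a b) c = mat_prod I a (mat_prod I b c)"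
proof -
  have "(\<Sum>l\<in>I. (\<Sum>m\<in>I. a (j, m) * b (m, l)) * c (l, i)) =
      (\<Sum>m\<in>I. a (j, m) * (\<Sum>l\<in>I. b (m, l) * c (l, i)))" for i j
    unfolding sum_distrib_left sum_distrib_right
    by (subst sum.swap) (simp add: mult.assoc)
  then show ?thesis by (simp add: mat_prod_def)
qed

lemma mat_prod_one_left:
  assumes "finite I" "supported_on (I \<times> I) M"
  shows "mat_prod I (mat_one I) M = M"
proof -
  have "(\<Sum>l\<in>I. (if j = l \<and> l \<in> I then 1 else 0) * M (l, i)) = M (j, i)" for j i
  proof -
    have "(\<Sum>l\<in>I. (if j = l \<and> l \<in> I then 1 else 0) * M (l, i)) = (\<Sum>l\<in>I. if j = l then M (l, i) else 0)"
      by (intro sum.cong) auto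
    then show ?thesis using assms by (auto simp: supported_on_def sum.delta)
  qed
  then show ?thesis by (auto simp: mat_prod_def mat_one_def)
qed

lemma mat_prod_one_right:
  assumes "finite I" "supported_on (I \<times> I) M"
  shows "mat_prod I M (mat_one I) = M"
proof -
  have "(\<Sum>l\<in>I. M (j, l) * (if l = i \<and> i \<in> I then 1 else 0)) = M (j, i)" for j i
  proof -
    have "(\<Sum>l\<in>I. M (j, l) * (if l = i \<and> i \<in> I then 1 else 0)) = (\<Sum>l\<in>I. if l = i then M (j, l) else 0)"
      by (intro sum.cong) auto
    then show ?thesis using assms by (auto simp: supported_on_def sum.delta)
  qed
  then show ?thesis by (auto simp: mat_prod_def mat_one_def)
qed

text \<open>Moving a factor across the Hilbert-Schmidt inner product turns it into its adjoint.
  Hence, for \<open>G\<close> closed under adjoints, the orthogonal complement of a space stable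
  under left multiplication by \<open>G\<close> is stable as well.\<close>

lemma inner_on_mat_prod_left:
  "inner_on (I \<times> I) (mat_prod I a X) Y = inner_on (I \<times> I) X (mat_prod I (mat_adjoint a) Y)"
proof -
  have "(\<Sum>j\<in>I. \<Sum>i\<in>I. \<Sum>l\<in>I. a (j, l) * X (l, i) * cnj (Y (j, i))) =
      (\<Sum>l\<in>I. \<Sum>i\<in>I. \<Sum>j\<in>I. a (j, l) * X (l, i) * cnj (Y (j, i)))"
    by (subst sum.swap, subst (2) sum.swap, subst sum.swap, rule refl)
  then show ?thesis
    by (simp add: inner_on_def mat_prod_def mat_adjoint_def sum.cartesian_product'
        sum_distrib_left sum_distrib_right mult_ac)
qed

text \<open>
  The projection of the matrix space onto the span of \<open>G\<close> commutes with left multiplication by \<open>G\<close>,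
  hence its blocks lie in the commutant of \<open>G\<close>.  So a matrix \<open>M\<close> commuting with the commutant
  satisfies \<open>M = M P(1) = P(M)\<close>.
\<close>

theorem bicommutant:
  fixes I :: "'i set"
  assumes fin: "finite I"
    and supp: "\<And>a. a \<in> G \<Longrightarrow> supported_on (I \<times> I) a"
    and one: "mat_one I \<in> G"
    and mult: "\<And>a b. a \<in> G \<Longrightarrow> b \<in> G \<Longrightarrow> mat_prod I a b \<in> G"
    and adj: "\<And>a. a \<in> G \<Longrightarrow> mat_adjoint a \<in> G"
    and M: "supported_on (I \<times> I) M"
    and comm: "\<And>N. supported_on (I \<times> I) N \<Longrightarrow> \<forall>a\<in>G. mat_prod I N a = mat_prod I a N \<Longrightarrow>
      mat_prod I N M = mat_prod I M N"
  shows "M \<in> lin_span G"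
proof -
  let ?J = "I \<times> I"
  define U where "U = lin_span G"
  have supp_U: "supported_on ?J u" if "u \<in> U" for u
    using that[unfolded U_def] by induction (auto simp: supported_on_def dest: supp)
  have sub: "function_subspace ?J U"
    using supp_U by (auto simp: function_subspace_def U_def supported_on_def intro: lin_span.intros)
  have left_U: "mat_prod I a u \<in> U" if "a \<in> G" "u \<in> U" for a u
    using that(2)[unfolded U_def]
  proof induction
    case zero
    have "mat_prod I a (\<lambda>x. 0) = (\<lambda>x. 0)" by (auto simp: mat_prod_def)
    then show ?case by (simp add: U_def lin_span.zero)
  qed (auto simp: U_def mat_prod_add_right mat_prod_scale_right intro: lin_span.intros mult that)
  have ex: "\<exists>u\<in>U. \<forall>v\<in>U. inner_on ?J (\<lambda>x. X x - u x) v = 0" for X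
    using orthogonal_projection_exists[OF _ _ subset_refl sub] fin by simp
  define P where "P X = (SOME u. u \<in> U \<and> (\<forall>v\<in>U. inner_on ?J (\<lambda>x. X x - u x) v = 0))" for X
  have P: "P X \<in> U" "\<And>v. v \<in> U \<Longrightarrow> inner_on ?J (\<lambda>x. X x - P X x) v = 0" for X
    using someI_ex[of "\<lambda>u. u \<in> U \<and> (\<forall>v\<in>U. inner_on ?J (\<lambda>x. X x - u x) v = 0)"] ex[of X]
    unfolding P_def by blast+
  \<comment> \<open>Uniqueness of the projection. Linearity of \<open>P\<close> and its commutation
    with \<open>G\<close> then follow by exhibiting the expected value.\<close>
  have P_eq: "P X = u" if "u \<in> U" and orth: "\<And>v. v \<in> U \<Longrightarrow> inner_on ?J (\<lambda>x. X x - u x) v = 0" for X u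
  proof -
    define d where "d = (\<lambda>x. P X x + (- 1) * u x)"
    have d: "d \<in> U"
      unfolding d_def U_def using P(1)[of X] that(1)
      by (intro lin_span.add lin_span.scale) (auto simp: U_def)
    have "inner_on ?J d d = inner_on ?J (\<lambda>x. X x - u x) d - inner_on ?J (\<lambda>x. X x - P X x) d"
      by (simp add: inner_on_diff_left[symmetric] d_def)
    then have "inner_on ?J d d = 0" using P(2) orth d by simp
    then have "d x = 0" for x
      using inner_on_self_eq_0[of ?J d x] fin supported_onD[OF supp_U[OF d]]
      by (cases "x \<in> ?J") blast+
    then have "P X x = u x" for x
      by (simp add: d_def)
    then show ?thesis by blast
  qed
  have P_id: "P u = u" if "u \<in> U" for u
    by (rule P_eq[OF that]) (simp add: inner_on_def)
  have P_sum: "P (\<lambda>x. \<Sum>m\<in>I. c m * Y m x) = (\<lambda>x. \<Sum>m\<in>I. c m * P (Y m) x)" for c Y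
  proof (rule P_eq)
    show "(\<lambda>x. \<Sum>m\<in>I. c m * P (Y m) x) \<in> U"
      unfolding U_def using P(1) by (intro lin_span_sum fin lin_span.scale) (auto simp: U_def)
    fix v assume "v \<in> U"
    have "(\<lambda>x. (\<Sum>m\<in>I. c m * Y m x) - (\<Sum>m\<in>I. c m * P (Y m) x)) =
        (\<lambda>x. \<Sum>m\<in>I. c m * (Y m x - P (Y m) x))"
      by (simp add: algebra_simps sum_subtractf)
    then show "inner_on ?J (\<lambda>x. (\<Sum>m\<in>I. c m * Y m x) - (\<Sum>m\<in>I. c m * P (Y m) x)) v = 0"
      using P(2)[OF \<open>v \<in> U\<close>] by (simp add: inner_on_sum_left inner_on_scale_left)
  qed
  have P_left: "P (mat_prod I a X) = mat_prod I a (P X)" if "a \<in> G" for a X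
  proof (rule P_eq)
    show "mat_prod I a (P X) \<in> U" using left_U[OF that P(1)] .
    fix v assume "v \<in> U"
    then have "mat_prod I (mat_adjoint a) v \<in> U" by (intro left_U adj that)
    then show "inner_on ?J (\<lambda>x. mat_prod I a X x - mat_prod I a (P X) x) v = 0"
      using P(2) by (simp add: mat_prod_diff_right[symmetric] inner_on_mat_prod_left)
  qed
  \<comment> \<open>Matrix units. Left multiplication acts on each column separately, so it sends
    \<open>E2 k l\<close> to a combination of the \<open>E2 m l\<close> with the same
    \<open>l\<close>.\<close>
  define E2 where "E2 (k::'i) (l::'i) = (\<lambda>(i, m). if i = k \<and> m = l then 1 else 0 :: complex)" for k l
  have expand: "mat_prod I a (E2 k l) = (\<lambda>x. \<Sum>m\<in>I. a (m, k) * E2 m l x)"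
    if "k \<in> I" "supported_on ?J a" for a k l
  proof (rule ext, clarify)
    fix j i
    have "mat_prod I a (E2 k l) (j, i) = (\<Sum>m\<in>I. if m = k then (if i = l then a (j, m) else 0) else 0)"
      unfolding mat_prod_def prod.case by (intro sum.cong) (auto simp: E2_def)
    also have "\<dots> = (if i = l then a (j, k) else 0)" using that fin by (simp add: sum.delta)
    also have "\<dots> = (\<Sum>m\<in>I. if m = j then (if i = l then a (m, k) else 0) else 0)"
      using that fin by (auto simp: sum.delta supported_on_def)
    also have "\<dots> = (\<Sum>m\<in>I. a (m, k) * E2 m l (j, i))" by (intro sum.cong) (auto simp: E2_def)
    finally show "mat_prod I a (E2 k l) (j, i) = (\<Sum>m\<in>I. a (m, k) * E2 m l (j, i))" .
  qed
  have block: "P (mat_prod I M (E2 k l)) (i, j) = mat_prod I M (P (E2 k l)) (i, j)"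
    if "i \<in> I" "j \<in> I" "k \<in> I" "l \<in> I" for i j k l
  proof -
    \<comment> \<open>For fixed \<open>l\<close> and \<open>j\<close> this is the block of
      \<open>P\<close> leading from column \<open>l\<close> to column \<open>j\<close>, written as a
      matrix in the row indices. Commutation of \<open>P\<close> with left multiplication by
      \<open>a\<close> becomes \<open>Q a = a Q\<close>.\<close>
    define Q where "Q = (\<lambda>(i, k). if i \<in> I \<and> k \<in> I then P (E2 k l) (i, j) else 0)"
    have Q: "mat_prod I Q a (i', k') = P (mat_prod I a (E2 k' l)) (i', j)"
      "mat_prod I a Q (i', k') = mat_prod I a (P (E2 k' l)) (i', j)"
      if "i' \<in> I" "k' \<in> I" "supported_on ?J a" for a i' k'
    proof -
      have "P (mat_prod I a (E2 k' l)) (i', j) = (\<Sum>m\<in>I. a (m, k') * P (E2 m l) (i', j))"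
        using that by (simp add: expand P_sum)
      then show "mat_prod I Q a (i', k') = P (mat_prod I a (E2 k' l)) (i', j)"
        using that by (simp add: mat_prod_def Q_def mult.commute)
      show "mat_prod I a Q (i', k') = mat_prod I a (P (E2 k' l)) (i', j)"
        using that by (simp add: mat_prod_def Q_def)
    qed
    have Q0: "mat_prod I Q a x = 0" "mat_prod I a Q x = 0"
      if "x \<notin> ?J" "supported_on ?J a" for a x
      using that by (cases x; auto simp: mat_prod_def Q_def supported_on_def)+
    have "mat_prod I Q a x = mat_prod I a Q x" if "a \<in> G" for a x
      using Q[of _ _ a] Q0[of _ a] P_left[OF that] supp[OF that]
      by (cases "x \<in> ?J") auto
    then have "mat_prod I Q M = mat_prod I M Q"
      by (intro comm) (auto simp: supported_on_def Q_def fun_eq_iff)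
    then show ?thesis using Q[OF that(1,3) M] by simp
  qed
  \<comment> \<open>The factor \<open>1\<close> gives the sum the shape to which
    \<open>P_sum\<close> applies.\<close>
  have one_sum: "mat_one I = (\<lambda>x. \<Sum>k\<in>I. 1 * E2 k k x)"
  proof (rule ext, clarify)
    fix i j
    have "(\<Sum>k\<in>I. 1 * E2 k k (i, j)) = (\<Sum>k\<in>I. if k = i then (if i = j then 1 else 0) else 0)"
      by (intro sum.cong) (auto simp: E2_def)
    then show "mat_one I (i, j) = (\<Sum>k\<in>I. 1 * E2 k k (i, j))"
      using fin by (auto simp: mat_one_def sum.delta)
  qed
  have prod_sum: "mat_prod I M (\<lambda>x. \<Sum>k\<in>I. 1 * Z k x) = (\<lambda>x. \<Sum>k\<in>I. 1 * mat_prod I M (Z k) x)" for Z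
    by (auto simp: mat_prod_def sum_distrib_left intro: sum.swap)
  have P1: "(\<lambda>x. \<Sum>k\<in>I. 1 * P (E2 k k) x) = mat_one I"
    using P_sum[of "\<lambda>_. 1" "\<lambda>k. E2 k k"] one_sum P_id[of "mat_one I"] one
    by (simp add: U_def lin_span.base)
  have "P M x = M x" for x
  proof (cases "x \<in> ?J")
    case True
    have "P M x = P (mat_prod I M (mat_one I)) x" using mat_prod_one_right[OF fin M] by simp
    also have "\<dots> = (\<Sum>k\<in>I. P (mat_prod I M (E2 k k)) x)"
      unfolding one_sum prod_sum P_sum by simp
    also have "\<dots> = (\<Sum>k\<in>I. mat_prod I M (P (E2 k k)) x)"
      using True by (intro sum.cong) (auto simp: block)
    also have "\<dots> = mat_prod I M (\<lambda>x. \<Sum>k\<in>I. 1 * P (E2 k k) x) x"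
      unfolding prod_sum by simp
    also have "\<dots> = M x" unfolding P1 using mat_prod_one_right[OF fin M] by simp
    finally show ?thesis .
  next
    case False
    then show ?thesis using supported_onD[OF M] supported_onD[OF supp_U[OF P(1)]] by metis
  qed
  then have "P M = M" by auto
  then show ?thesis using P(1)[of M] by (simp add: U_def)
qed

section \<open>Invariant tensors and matchings\<close>

lemma prod_of_bool: "finite A \<Longrightarrow> (\<Prod>x\<in>A. of_bool (P x)) = (of_bool (\<forall>x\<in>A. P x) :: complex)"
  by (induction A rule: finite_induct) auto

text \<open>\<open>h\<close> is the matrix of \<open>1 \<oplus> g\<close> with \<open>g\<close> orthogonal; its values outside \<open>{0..n}\<close> are arbitrary.\<close>

definition orth_fun :: "nat \<Rightarrow> (nat \<Rightarrow> nat \<Rightarrow> complex) \<Rightarrow> bool" where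
  "orth_fun n h \<longleftrightarrow> (\<forall>a\<in>{0..n}. h a 0 = of_bool (a = 0) \<and> h 0 a = of_bool (a = 0)) \<and>
     (\<forall>a\<in>{0..n}. \<forall>b\<in>{0..n}. (\<Sum>c\<in>{0..n}. h a c * h b c) = of_bool (a = b) \<and>
        (\<Sum>c\<in>{0..n}. h c a * h c b) = of_bool (a = b))"

abbreviation labelings :: "nat \<Rightarrow> 'v set \<Rightarrow> ('v \<Rightarrow> nat) set" where
  "labelings n X \<equiv> X \<rightarrow>\<^sub>E {0..n}"

text \<open>All slots transform by \<open>h\<close>. A dual slot would transform by the inverse
  transpose of \<open>h\<close>, which is \<open>h\<close> again; this is what allows operators to
  be treated as tensors.\<close>

definition invariant_tensor :: "nat \<Rightarrow> 'v set \<Rightarrow> (('v \<Rightarrow> nat) \<Rightarrow> complex) \<Rightarrow> bool" where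
  "invariant_tensor n X T \<longleftrightarrow> (\<forall>h. orth_fun n h \<longrightarrow> (\<forall>l\<in>labelings n X.
     (\<Sum>l'\<in>labelings n X. (\<Prod>x\<in>X. h (l x) (l' x)) * T l') = T l))"

text \<open>Disjointness of the edges replaces uniqueness of the neighbour, because products over
  the vertices are to be split into products over the edges.\<close>

definition matchings :: "'v set \<Rightarrow> 'v set set set" where
  "matchings X = {d. (\<forall>e\<in>d. e \<subseteq> X \<and> card e = 2) \<and> (\<forall>e\<in>d. \<forall>e'\<in>d. e \<inter> e' \<noteq> {} \<longrightarrow> e = e')}"

definition matching_weight :: "'v set \<Rightarrow> 'v set set \<Rightarrow> ('v \<Rightarrow> nat) \<Rightarrow> complex" where
  "matching_weight X d l =
     (\<Prod>e\<in>d. of_bool (\<forall>u\<in>e. \<forall>v\<in>e. l u = l v)) * (\<Prod>v\<in>X - \<Union> d. of_bool (l v = 0))"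

lemma finite_matchings: "finite X \<Longrightarrow> finite (matchings X)"
  by (rule finite_subset[of _ "Pow (Pow X)"]) (auto simp: matchings_def)

lemma finite_matching: "finite X \<Longrightarrow> d \<in> matchings X \<Longrightarrow> finite d"
  by (rule finite_subset[of _ "Pow X"]) (auto simp: matchings_def)

lemma matchingD:
  assumes "d \<in> matchings X"
  shows "e \<in> d \<Longrightarrow> e \<subseteq> X" "e \<in> d \<Longrightarrow> card e = 2"
    "e \<in> d \<Longrightarrow> e' \<in> d \<Longrightarrow> x \<in> e \<Longrightarrow> x \<in> e' \<Longrightarrow> e = e'"
  using assms unfolding matchings_def by blast+

lemma matching_weight_eq:
  assumes "finite X" "d \<in> matchings X"
  shows "matching_weight X d l =
    of_bool ((\<forall>e\<in>d. \<forall>u\<in>e. \<forall>v\<in>e. l u = l v) \<and> (\<forall>v\<in>X - \<Union> d. l v = 0))"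
  by (simp only: matching_weight_def prod_of_bool[OF finite_matching[OF assms]]
      prod_of_bool[OF finite_Diff[OF assms(1)]] of_bool_conj)

lemma prod_matching:
  fixes g :: "'v \<Rightarrow> complex"
  assumes "finite X" "d \<in> matchings X"
  shows "(\<Prod>x\<in>X. g x) = (\<Prod>e\<in>d. \<Prod>x\<in>e. g x) * (\<Prod>x\<in>X - \<Union> d. g x)"
proof -
  have sub: "\<Union> d \<subseteq> X" using matchingD(1)[OF assms(2)] by blast
  have "(\<Prod>x\<in>X. g x) = (\<Prod>x\<in>\<Union> d. g x) * (\<Prod>x\<in>X - \<Union> d. g x)"
    using prod.subset_diff[OF sub assms(1)] by (simp add: mult.commute)
  also have "(\<Prod>x\<in>\<Union> d. g x) = (\<Prod>e\<in>d. \<Prod>x\<in>e. g x)"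
  proof (subst prod.Union_disjoint)
    show "\<forall>A\<in>d. finite A" using sub assms(1) by (meson Union_upper finite_subset)
    show "\<forall>A\<in>d. \<forall>B\<in>d. A \<noteq> B \<longrightarrow> A \<inter> B = {}" using matchingD(3)[OF assms(2)] by blast
  qed simp
  finally show ?thesis .
qed

definition edge_of :: "'v set set \<Rightarrow> 'v \<Rightarrow> 'v set" where
  "edge_of d x = (THE e. e \<in> d \<and> x \<in> e)"

lemma edge_of_eq: "d \<in> matchings X \<Longrightarrow> e \<in> d \<Longrightarrow> x \<in> e \<Longrightarrow> edge_of d x = e"
  unfolding edge_of_def by (rule the_equality, blast) (metis matchingD(3))

text \<open>
  The labelings of nonzero weight are constant on edges and zero elsewhere, so they correspond to
  labelings of the edges.  Summing over the label of an edge \<open>{u, v}\<close> gives an entry of \<open>h h\<^sup>t\<close>.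
\<close>

lemma matching_weight_invariant:
  assumes fin: "finite X" and d: "d \<in> matchings X"
  shows "invariant_tensor n X (matching_weight X d)"
  unfolding invariant_tensor_def
proof (intro allI impI ballI)
  fix h l assume h: "orth_fun n h" and l: "l \<in> labelings n X"
  let ?S = "{0..n}"
  have fd: "finite d" using finite_matching[OF fin d] .
  have l_in: "l x \<in> ?S" if "x \<in> X" for x using PiE_mem[OF l that] .
  define \<phi> where "\<phi> c = (\<lambda>x\<in>X. if x \<in> \<Union> d then c (edge_of d x) else (0::nat))" for c
  define supp where "supp = {l' \<in> labelings n X.
     (\<forall>e\<in>d. \<forall>u\<in>e. \<forall>v\<in>e. l' u = l' v) \<and> (\<forall>v\<in>X - \<Union> d. l' v = 0)}"
  define \<psi> where "\<psi> l' = (\<lambda>e\<in>d. l' (SOME x. x \<in> e) :: nat)" for l'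
  have some_in: "(SOME x. x \<in> e) \<in> e" if "e \<in> d" for e
  proof -
    have "e \<noteq> {}" using matchingD(2)[OF d that] by auto
    then show ?thesis by (simp add: some_in_eq)
  qed
  have \<phi>_e: "\<phi> c x = c e" if "e \<in> d" "x \<in> e" for c e x
  proof -
    have "x \<in> X" "x \<in> \<Union> d" using that matchingD(1)[OF d that(1)] by blast+
    then show ?thesis by (simp only: \<phi>_def restrict_apply if_True edge_of_eq[OF d that])
  qed
  have bij: "bij_betw \<phi> (labelings n d) supp"
  proof (rule bij_betw_byWitness[where f' = \<psi>])
    show "\<forall>c\<in>labelings n d. \<psi> (\<phi> c) = c"
    proof
      fix c assume c: "c \<in> labelings n d"
      have "\<psi> (\<phi> c) e = c e" if "e \<in> d" for e
        using \<phi>_e[OF that some_in[OF that]] that by (simp add: \<psi>_def)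
      moreover have "\<psi> (\<phi> c) e = c e" if "e \<notin> d" for e
        using c that by (auto simp: \<psi>_def PiE_def extensional_def)
      ultimately show "\<psi> (\<phi> c) = c" by blast
    qed
    show "\<forall>l'\<in>supp. \<phi> (\<psi> l') = l'"
    proof
      fix l' assume l': "l' \<in> supp"
      have const: "l' u = l' v" if "e \<in> d" "u \<in> e" "v \<in> e" for e u v
        using l' that unfolding supp_def by blast
      have iso: "l' x = 0" if "x \<in> X" "x \<notin> \<Union> d" for x
        using l' that unfolding supp_def by blast
      have out: "l' x = undefined" if "x \<notin> X" for x
        using l' that unfolding supp_def PiE_def extensional_def by blast
      show "\<phi> (\<psi> l') = l'"
      proof
        fix x
        show "\<phi> (\<psi> l') x = l' x"
        proof (cases "x \<in> \<Union> d")
          case True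
          then obtain e where e: "e \<in> d" "x \<in> e" by blast
          have "\<phi> (\<psi> l') x = l' (SOME x. x \<in> e)" using \<phi>_e[OF e] e by (simp add: \<psi>_def)
          also have "\<dots> = l' x" by (rule const[OF e(1) some_in[OF e(1)] e(2)])
          finally show ?thesis .
        next
          case False
          then show ?thesis using iso[of x] out[of x] by (simp add: \<phi>_def)
        qed
      qed
    qed
    show "\<phi> ` labelings n d \<subseteq> supp"
    proof
      fix l' assume "l' \<in> \<phi> ` labelings n d"
      then obtain c where c: "c \<in> labelings n d" "l' = \<phi> c" by blast
      have "\<phi> c x \<in> ?S" if "x \<in> X" for x
      proof (cases "x \<in> \<Union> d")
        case True
        then obtain e where "e \<in> d" "x \<in> e" by blast
        then show ?thesis using \<phi>_e[of e x c] c(1) by auto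
      qed (use that in \<open>auto simp: \<phi>_def\<close>)
      moreover have "\<phi> c x = undefined" if "x \<notin> X" for x
        using that by (simp add: \<phi>_def)
      ultimately have "\<phi> c \<in> labelings n X" by (intro PiE_I) auto
      moreover have "\<phi> c v = 0" if "v \<in> X - \<Union> d" for v using that by (auto simp: \<phi>_def)
      moreover have "\<phi> c u = \<phi> c v" if "e \<in> d" "u \<in> e" "v \<in> e" for e u v
        using \<phi>_e[OF that(1,2)] \<phi>_e[OF that(1,3)] by simp
      ultimately show "l' \<in> supp" unfolding c(2) supp_def by blast
    qed
    show "\<psi> ` supp \<subseteq> labelings n d"
    proof
      fix c assume "c \<in> \<psi> ` supp"
      then obtain l' where l': "l' \<in> supp" "c = \<psi> l'" by blast
      have "l' (SOME x. x \<in> e) \<in> ?S" if "e \<in> d" for e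
      proof -
        have "l' \<in> labelings n X" using l'(1) by (simp add: supp_def)
        moreover have "(SOME x. x \<in> e) \<in> X" using some_in[OF that] matchingD(1)[OF d that] by blast
        ultimately show ?thesis by (rule PiE_mem)
      qed
      then show "c \<in> labelings n d" using l'(2) by (auto simp: \<psi>_def)
    qed
  qed
  have edge: "(\<Sum>c\<in>?S. \<Prod>x\<in>e. h (l x) c) = of_bool (\<forall>u\<in>e. \<forall>v\<in>e. l u = l v)" if "e \<in> d" for e
  proof -
    have "card e = 2" using matchingD(2)[OF d that] .
    then obtain u v where e: "e = {u, v}" "u \<noteq> v" by (auto simp: card_2_iff)
    then have "l u \<in> ?S" "l v \<in> ?S" using l_in matchingD(1)[OF d that] by auto
    then have "(\<Sum>c\<in>?S. h (l u) c * h (l v) c) = of_bool (l u = l v)"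
      using h by (auto simp: orth_fun_def)
    moreover have "(\<forall>u\<in>e. \<forall>v\<in>e. l u = l v) \<longleftrightarrow> l u = l v"
      unfolding e(1) by auto
    moreover have "(\<Prod>x\<in>e. h (l x) c) = h (l u) c * h (l v) c" for c
      unfolding e(1) using e(2) by simp
    ultimately show ?thesis by (simp only:)
  qed
  have finL: "finite (labelings n X)" using fin by (simp add: finite_PiE)
  have "(\<Sum>l'\<in>labelings n X. (\<Prod>x\<in>X. h (l x) (l' x)) * matching_weight X d l') =
      (\<Sum>l'\<in>supp. \<Prod>x\<in>X. h (l x) (l' x))"
  proof (rule sum.mono_neutral_cong_right[OF finL])
    show "supp \<subseteq> labelings n X" by (auto simp: supp_def)
    have w: "matching_weight X d l' = of_bool (l' \<in> supp)" if "l' \<in> labelings n X" for l'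
      unfolding matching_weight_eq[OF fin d] supp_def using that by simp
    then show "\<forall>l'\<in>labelings n X - supp. (\<Prod>x\<in>X. h (l x) (l' x)) * matching_weight X d l' = 0"
      by simp
    show "(\<Prod>x\<in>X. h (l x) (l' x)) * matching_weight X d l' = (\<Prod>x\<in>X. h (l x) (l' x))"
      if "l' \<in> supp" for l'
    proof -
      have "l' \<in> labelings n X" using that by (simp add: supp_def)
      then show ?thesis using w that by simp
    qed
  qed
  also have "\<dots> = (\<Sum>c\<in>labelings n d. \<Prod>x\<in>X. h (l x) (\<phi> c x))"
    by (rule sum.reindex_bij_betw[OF bij, symmetric])
  also have "\<dots> = (\<Sum>c\<in>labelings n d. (\<Prod>e\<in>d. \<Prod>x\<in>e. h (l x) (c e)) * (\<Prod>x\<in>X - \<Union> d. h (l x) 0))"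
  proof (intro sum.cong refl)
    fix c
    have "(\<Prod>e\<in>d. \<Prod>x\<in>e. h (l x) (\<phi> c x)) = (\<Prod>e\<in>d. \<Prod>x\<in>e. h (l x) (c e))"
      by (intro prod.cong refl) (simp add: \<phi>_e)
    moreover have "(\<Prod>x\<in>X - \<Union> d. h (l x) (\<phi> c x)) = (\<Prod>x\<in>X - \<Union> d. h (l x) 0)"
      by (intro prod.cong refl) (auto simp: \<phi>_def)
    ultimately show "(\<Prod>x\<in>X. h (l x) (\<phi> c x)) =
        (\<Prod>e\<in>d. \<Prod>x\<in>e. h (l x) (c e)) * (\<Prod>x\<in>X - \<Union> d. h (l x) 0)"
      by (simp add: prod_matching[OF fin d])
  qed
  also have "\<dots> = (\<Prod>e\<in>d. \<Sum>c\<in>?S. \<Prod>x\<in>e. h (l x) c) * (\<Prod>x\<in>X - \<Union> d. h (l x) 0)"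
    using prod_sum_PiE[OF fd, of "\<lambda>_. ?S" "\<lambda>e c. \<Prod>x\<in>e. h (l x) c"]
    by (simp add: sum_distrib_right)
  also have "(\<Prod>e\<in>d. \<Sum>c\<in>?S. \<Prod>x\<in>e. h (l x) c) = (\<Prod>e\<in>d. of_bool (\<forall>u\<in>e. \<forall>v\<in>e. l u = l v))"
    using edge by (intro prod.cong refl)
  \<comment> \<open>An isolated vertex contributes an entry of column \<open>0\<close> of
    \<open>h\<close>, which is a unit vector because the trivial summand is fixed.\<close>
  also have "(\<Prod>x\<in>X - \<Union> d. h (l x) 0) = (\<Prod>x\<in>X - \<Union> d. of_bool (l x = 0))"
    using h l_in by (intro prod.cong refl) (auto simp: orth_fun_def)
  finally show "(\<Sum>l'\<in>labelings n X. (\<Prod>x\<in>X. h (l x) (l' x)) * matching_weight X d l') =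
      matching_weight X d l"
    by (simp add: matching_weight_def)
qed

section \<open>Relations between the values of an invariant tensor\<close>

lemma invariant_tensor_monomial:
  assumes fin: "finite X" and T: "invariant_tensor n X T" and l: "l \<in> labelings n X"
    and \<sigma>: "\<sigma> permutes {1..n}" and s: "s 0 = 1" "\<And>a. s a * s a = 1"
  shows "T l = (\<Prod>x\<in>X. s (l x)) * T (\<lambda>x\<in>X. \<sigma> (l x))"
proof -
  \<comment> \<open>The signed permutation matrix with entry \<open>s a\<close> in position
    \<open>(a, \<sigma> a)\<close>. Each row has one nonzero entry, so the invariance sum collapses
    to a single term; \<open>s 0 = 1\<close> and \<open>\<sigma> 0 = 0\<close> keep the trivial
    summand fixed.\<close>
  define h where "h = (\<lambda>a b. if b = \<sigma> a then s a else 0)"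
  have \<sigma>0: "\<sigma> 0 = 0" using \<sigma> by (simp add: permutes_def)
  have inj: "\<sigma> a = \<sigma> b \<longleftrightarrow> a = b" for a b using permutes_inj[OF \<sigma>] by (auto simp: inj_def)
  have \<sigma>_in: "\<sigma> a \<in> {0..n}" if "a \<in> {0..n}" for a
    using permutes_in_image[OF \<sigma>, of a] that \<sigma>0 by (cases "a = 0") auto
  have \<sigma>_surj: "\<exists>c\<in>{0..n}. \<sigma> c = a" if "a \<in> {0..n}" for a
  proof (cases "a = 0")
    case False
    then have "a \<in> {1..n}" using that by auto
    moreover obtain c where c: "\<sigma> c = a" using permutes_surj[OF \<sigma>] by (metis surjD)
    ultimately have "c \<in> {1..n}" using permutes_in_image[OF \<sigma>, of c] by simp
    then show ?thesis using c by auto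
  qed (use \<sigma>0 in auto)
  have h0: "h a 0 = of_bool (a = 0)" "h 0 a = of_bool (a = 0)" for a
    using inj[of a 0] \<sigma>0 s(1) by (auto simp: h_def)
  have "orth_fun n h"
    unfolding orth_fun_def
  proof (intro conjI ballI)
    fix a b assume a: "a \<in> {0..n}" and b: "b \<in> {0..n}"
    have "(\<Sum>c\<in>{0..n}. h a c * h b c) = (\<Sum>c\<in>{0..n}. if c = \<sigma> a then h b (\<sigma> a) * s a else 0)"
      by (intro sum.cong refl) (auto simp: h_def)
    also have "\<dots> = h b (\<sigma> a) * s a" using \<sigma>_in[OF a] by (simp add: sum.delta)
    also have "\<dots> = of_bool (a = b)" using s(2) by (auto simp: h_def inj)
    finally show "(\<Sum>c\<in>{0..n}. h a c * h b c) = of_bool (a = b)" .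
    obtain a' where a': "a' \<in> {0..n}" "a = \<sigma> a'" using \<sigma>_surj[OF a] by auto
    have "(\<Sum>c\<in>{0..n}. h c a * h c b) = (\<Sum>c\<in>{0..n}. if c = a' then s a' * h a' b else 0)"
      by (intro sum.cong refl) (auto simp: h_def a' inj)
    also have "\<dots> = s a' * h a' b" using a'(1) by (simp add: sum.delta)
    also have "\<dots> = of_bool (a = b)" using s(2) a' by (auto simp: h_def)
    finally show "(\<Sum>c\<in>{0..n}. h c a * h c b) = of_bool (a = b)" .
  qed (simp_all add: h0)
  then have "T l = (\<Sum>l'\<in>labelings n X. (\<Prod>x\<in>X. h (l x) (l' x)) * T l')"
    using T l by (simp add: invariant_tensor_def)
  also have "\<dots> = (\<Sum>l'\<in>labelings n X. if l' = (\<lambda>x\<in>X. \<sigma> (l x)) then (\<Prod>x\<in>X. s (l x)) * T l' else 0)"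
  proof (intro sum.cong refl)
    fix l' assume l': "l' \<in> labelings n X"
    show "(\<Prod>x\<in>X. h (l x) (l' x)) * T l' =
        (if l' = (\<lambda>x\<in>X. \<sigma> (l x)) then (\<Prod>x\<in>X. s (l x)) * T l' else 0)"
    proof (cases "l' = (\<lambda>x\<in>X. \<sigma> (l x))")
      case True
      then have "(\<Prod>x\<in>X. h (l x) (l' x)) = (\<Prod>x\<in>X. s (l x))"
        by (intro prod.cong refl) (auto simp: h_def)
      then show ?thesis using True by simp
    next
      case False
      then obtain x where "x \<in> X" "l' x \<noteq> \<sigma> (l x)"
        using l' by (auto simp: fun_eq_iff PiE_def extensional_def restrict_def split: if_splits)
      then have "(\<Prod>x\<in>X. h (l x) (l' x)) = 0" using fin by (auto simp: h_def intro!: prod_zero)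
      then show ?thesis using False by simp
    qed
  qed
  also have "\<dots> = (\<Prod>x\<in>X. s (l x)) * T (\<lambda>x\<in>X. \<sigma> (l x))"
  proof -
    have "(\<lambda>x\<in>X. \<sigma> (l x)) \<in> labelings n X"
      using \<sigma>_in PiE_mem[OF l] by (intro restrict_PiE_iff[THEN iffD2] ballI) blast
    then show ?thesis using fin by (simp add: sum.delta finite_PiE)
  qed
  finally show ?thesis .
qed

lemma invariant_tensor_permute:
  assumes "finite X" "invariant_tensor n X T" "l \<in> labelings n X" "\<sigma> permutes {1..n}"
  shows "T (\<lambda>x\<in>X. \<sigma> (l x)) = T l"
  using invariant_tensor_monomial[OF assms, of "\<lambda>_. 1"] by simp

text \<open>Changing the sign of the basis vector \<open>a\<close> multiplies \<open>T l\<close> by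
  -1 once for each occurrence of \<open>a\<close>, so \<open>T l = - T l\<close>.\<close>

lemma invariant_tensor_odd:
  assumes fin: "finite X" and "invariant_tensor n X T" "l \<in> labelings n X"
    and a: "a \<in> {1..n}" and odd: "odd (card {x \<in> X. l x = a})"
  shows "T l = 0"
proof -
  define s where "s b = (if b = a then - 1 else 1 :: complex)" for b
  have "T l = (\<Prod>x\<in>X. s (l x)) * T (\<lambda>x\<in>X. id (l x))"
    using a by (intro invariant_tensor_monomial[OF fin assms(2,3) permutes_id]) (auto simp: s_def)
  moreover have "(\<lambda>x\<in>X. id (l x)) = l"
    using assms(3) by (auto simp: fun_eq_iff PiE_def extensional_def)
  moreover have "(\<Prod>x\<in>X. s (l x)) = (- 1) ^ card {x \<in> X. l x = a}"
    unfolding s_def using fin by (simp add: prod.If_cases Int_def conj_commute)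
  ultimately have "T l = - T l" using odd by simp
  then show ?thesis by simp
qed

text \<open>The angle is complex: the sum of the squares of \<open>cos\<close> and
  \<open>sin\<close> is still 1, and the derivative at 0 is taken in the coefficient field.\<close>

definition plane_rotation :: "nat \<Rightarrow> nat \<Rightarrow> complex \<Rightarrow> nat \<Rightarrow> nat \<Rightarrow> complex" where
  "plane_rotation a b \<theta> p q =
     (if p = a then cos \<theta> * of_bool (q = a) - sin \<theta> * of_bool (q = b)
      else if p = b then sin \<theta> * of_bool (q = a) + cos \<theta> * of_bool (q = b)
      else of_bool (p = q))"

lemma plane_rotation_orth:
  assumes "a \<in> {1..n}" "b \<in> {1..n}" "a \<noteq> b"
  shows "orth_fun n (plane_rotation a b \<theta>)"
proof -
  have row: "(\<Sum>c\<in>{0..n}. plane_rotation a b \<theta> p c * plane_rotation a b \<theta> q c) = of_bool (p = q)"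
    if "p \<in> {0..n}" "q \<in> {0..n}" for p q \<theta>
  proof -
    have sum_of_bool: "(\<Sum>c\<in>{0..n}. of_bool (c = r) * f c) = (f r :: complex)" if "r \<in> {0..n}" for r f
    proof -
      have "(\<Sum>c\<in>{0..n}. of_bool (c = r) * f c) = (\<Sum>c\<in>{0..n}. if c = r then f c else 0)"
        by (intro sum.cong) auto
      then show ?thesis using that by (simp add: sum.delta)
    qed
    let ?R = "plane_rotation a b \<theta>"
    have cs: "cos \<theta> * cos \<theta> + sin \<theta> * sin \<theta> = 1"
      using sin_cos_squared_add2[of \<theta>] by (simp add: power2_eq_square)
    have R_a: "?R a = (\<lambda>c. cos \<theta> * of_bool (c = a) - sin \<theta> * of_bool (c = b))"
      and R_b: "?R b = (\<lambda>c. sin \<theta> * of_bool (c = a) + cos \<theta> * of_bool (c = b))"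
      using assms(3) by (auto simp: plane_rotation_def)
    have R_other: "?R p = (\<lambda>c. of_bool (c = p))" if "p \<noteq> a" "p \<noteq> b" for p
      using that by (auto simp: plane_rotation_def)
    have exp: "(\<Sum>c\<in>{0..n}. ?R p c * ?R q c) =
       (if p = a then cos \<theta> * ?R q a - sin \<theta> * ?R q b
        else if p = b then sin \<theta> * ?R q a + cos \<theta> * ?R q b else ?R q p)"
    proof -
      have "(\<Sum>c\<in>{0..n}. ?R a c * ?R q c) = cos \<theta> * ?R q a - sin \<theta> * ?R q b"
        unfolding R_a using sum_of_bool[of a "?R q"] sum_of_bool[of b "?R q"] assms
        by (simp add: left_diff_distrib mult.assoc sum_subtractf sum_distrib_left[symmetric])
      moreover have "(\<Sum>c\<in>{0..n}. ?R b c * ?R q c) = sin \<theta> * ?R q a + cos \<theta> * ?R q b"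
        unfolding R_b using sum_of_bool[of a "?R q"] sum_of_bool[of b "?R q"] assms
        by (simp add: distrib_right mult.assoc sum.distrib sum_distrib_left[symmetric])
      moreover have "(\<Sum>c\<in>{0..n}. ?R p c * ?R q c) = ?R q p" if "p \<noteq> a" "p \<noteq> b"
        unfolding R_other[OF that] using sum_of_bool[OF \<open>p \<in> {0..n}\<close>] .
      ultimately show ?thesis by simp
    qed
    show ?thesis
      unfolding exp using assms(3) cs by (auto simp: plane_rotation_def algebra_simps)
  qed
  \<comment> \<open>Transposing a rotation reverses its angle, so the column relations are row
    relations at \<open>- \<theta>\<close>.\<close>
  have transp: "plane_rotation a b \<theta> c p = plane_rotation a b (- \<theta>) p c" for c p
    using assms(3) by (auto simp: plane_rotation_def)
  have col: "(\<Sum>c\<in>{0..n}. plane_rotation a b \<theta> c p * plane_rotation a b \<theta> c q) = of_bool (p = q)"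
    if "p \<in> {0..n}" "q \<in> {0..n}" for p q
    using row[OF that, of "- \<theta>"] by (simp add: transp)
  show ?thesis
    using assms row col by (auto simp: orth_fun_def plane_rotation_def)
qed

text \<open>Differentiate the invariance under rotations in the \<open>a\<close>-\<open>b\<close>-plane at angle \<open>0\<close>.\<close>

lemma invariant_tensor_rotation:
  assumes fin: "finite X" and T: "invariant_tensor n X T" and l: "l \<in> labelings n X"
    and ab: "a \<in> {1..n}" "b \<in> {1..n}" "a \<noteq> b"
  shows "(\<Sum>x\<in>{x\<in>X. l x = a}. T (l(x := b))) = (\<Sum>x\<in>{x\<in>X. l x = b}. T (l(x := a)))"
proof -
  let ?L = "labelings n X" and ?R = "plane_rotation a b"
  have finL: "finite ?L" using fin by (simp add: finite_PiE)
  define D where "D p q = (if p = a then - of_bool (q = b) else if p = b then of_bool (q = a) else (0::complex))"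
    for p q :: nat
  have D: "((\<lambda>\<theta>. ?R \<theta> p q) has_field_derivative D p q) (at 0)" for p q
    using ab(3) by (auto simp: plane_rotation_def D_def intro!: derivative_eq_intros)
  have R0: "?R 0 p q = of_bool (p = q)" for p q
    using ab(3) by (auto simp: plane_rotation_def)
  have "((\<lambda>\<theta>. \<Sum>l'\<in>?L. (\<Prod>x\<in>X. ?R \<theta> (l x) (l' x)) * T l') has_field_derivative
      (\<Sum>l'\<in>?L. (\<Sum>x\<in>X. D (l x) (l' x) * (\<Prod>y\<in>X-{x}. ?R 0 (l y) (l' y))) * T l')) (at 0)"
    by (intro DERIV_sum DERIV_cmult_right has_field_derivative_prod D)
  moreover have "(\<lambda>\<theta>. \<Sum>l'\<in>?L. (\<Prod>x\<in>X. ?R \<theta> (l x) (l' x)) * T l') = (\<lambda>_. T l)"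
    using T l plane_rotation_orth[OF ab] by (auto simp: invariant_tensor_def)
  ultimately have "((\<lambda>_. T l) has_field_derivative
      (\<Sum>l'\<in>?L. (\<Sum>x\<in>X. D (l x) (l' x) * (\<Prod>y\<in>X-{x}. ?R 0 (l y) (l' y))) * T l')) (at 0)"
    by (simp only:)
  then have "(\<Sum>l'\<in>?L. (\<Sum>x\<in>X. D (l x) (l' x) * (\<Prod>y\<in>X-{x}. ?R 0 (l y) (l' y))) * T l') = 0"
    using DERIV_const DERIV_unique by blast
  then have zero: "(\<Sum>x\<in>X. \<Sum>l'\<in>?L. D (l x) (l' x) * (\<Prod>y\<in>X-{x}. of_bool (l y = l' y)) * T l') = 0"
    unfolding R0 sum_distrib_right by (subst sum.swap)
  \<comment> \<open>\<open>D p q\<close> is nonzero only if \<open>p\<close> and \<open>q\<close>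
    are \<open>a\<close> and \<open>b\<close> in some order. So in slot \<open>x\<close> only the
    labeling with \<open>a\<close> and \<open>b\<close> exchanged at \<open>x\<close> can
    contribute, and none if \<open>l x\<close> is another value.\<close>
  define t where "t x = (if l x = a then b else if l x = b then a else l x)" for x
  have inner: "(\<Sum>l'\<in>?L. D (l x) (l' x) * (\<Prod>y\<in>X-{x}. of_bool (l y = l' y)) * T l') =
      D (l x) (t x) * T (l(x := t x))" if x: "x \<in> X" for x
  proof -
    have "(\<Sum>l'\<in>?L. D (l x) (l' x) * (\<Prod>y\<in>X-{x}. of_bool (l y = l' y)) * T l') =
        (\<Sum>l'\<in>?L. if l' = l(x := t x) then D (l x) (t x) * T l' else 0)"
    proof (intro sum.cong refl)
      fix l' assume l': "l' \<in> ?L"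
      have prod: "(\<Prod>y\<in>X-{x}. of_bool (l y = l' y)) = (of_bool (\<forall>y\<in>X-{x}. l y = l' y) :: complex)"
        using fin by (simp add: prod_of_bool)
      have agree: "l' = l(x := l' x)" if "\<forall>y\<in>X-{x}. l y = l' y"
      proof
        fix y show "l' y = (l(x := l' x)) y"
          using that l' l x by (cases "y \<in> X") (auto simp: PiE_def extensional_def)
      qed
      show "D (l x) (l' x) * (\<Prod>y\<in>X-{x}. of_bool (l y = l' y)) * T l' =
          (if l' = l(x := t x) then D (l x) (t x) * T l' else 0)"
      proof (cases "l' = l(x := t x)")
        case True
        then have "\<forall>y\<in>X-{x}. l y = l' y" "l' x = t x" by auto
        then show ?thesis using True prod by simp
      next
        case False
        show ?thesis
        proof (cases "\<forall>y\<in>X-{x}. l y = l' y")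
          case True
          then have "l' x \<noteq> t x" using agree False by metis
          then have "D (l x) (l' x) = 0" using ab(3) by (auto simp: D_def t_def)
          then show ?thesis using False by simp
        qed (use False prod in auto)
      qed
    qed
    also have "\<dots> = D (l x) (t x) * T (l(x := t x))"
    proof -
      have "t x \<in> {0..n}" using l x ab by (auto simp: t_def)
      then have "l(x := t x) \<in> ?L"
        using PiE_fun_upd[of "t x" "\<lambda>_. {0..n}" x l X] l x by (simp add: insert_absorb)
      then show ?thesis using finL by (simp add: sum.delta)
    qed
    finally show ?thesis .
  qed
  have "0 = (\<Sum>x\<in>X. D (l x) (t x) * T (l(x := t x)))"
    using zero inner by simp
  also have "\<dots> =
      (\<Sum>x\<in>X. (if l x = b then T (l(x := a)) else 0) - (if l x = a then T (l(x := b)) else 0))"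
    using ab(3) by (intro sum.cong refl) (auto simp: D_def t_def)
  also have "\<dots> = (\<Sum>x\<in>{x\<in>X. l x = b}. T (l(x := a))) - (\<Sum>x\<in>{x\<in>X. l x = a}. T (l(x := b)))"
    using fin by (simp add: sum_subtractf sum.inter_filter)
  finally have "(\<Sum>x\<in>{x\<in>X. l x = b}. T (l(x := a))) - (\<Sum>x\<in>{x\<in>X. l x = a}. T (l(x := b))) = 0"
    by (rule sym)
  then show ?thesis by (simp only: right_minus_eq)
qed

section \<open>Labelings that detect a matching\<close>

text \<open>The case \<open>x = y\<close> is intended: it makes the label nonzero exactly on the
  vertices covered by \<open>d\<close>. The other cases give each edge a value of its own.\<close>

definition adapted :: "nat \<Rightarrow> 'v set \<Rightarrow> 'v set set \<Rightarrow> ('v \<Rightarrow> nat) \<Rightarrow> bool" where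
  "adapted n X d l \<longleftrightarrow> l \<in> labelings n X \<and>
     (\<forall>x\<in>X. \<forall>y\<in>X. l x = l y \<and> l x \<noteq> 0 \<longleftrightarrow> (\<exists>e\<in>d. x \<in> e \<and> y \<in> e))"

lemma adaptedD:
  assumes "adapted n X d l" "x \<in> X" "y \<in> X"
  shows "l x = l y \<Longrightarrow> l x \<noteq> 0 \<Longrightarrow> \<exists>e\<in>d. x \<in> e \<and> y \<in> e"
    "e \<in> d \<Longrightarrow> x \<in> e \<Longrightarrow> y \<in> e \<Longrightarrow> l x = l y"
    "e \<in> d \<Longrightarrow> x \<in> e \<Longrightarrow> l x \<noteq> 0"
  using assms unfolding adapted_def by blast+

text \<open>An edge of \<open>d\<close> carries a nonzero value found nowhere else, so a matching of
  nonzero weight must contain that very edge. All other vertices carry \<open>0\<close>, which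
  further edges and isolated vertices both accept.\<close>

lemma matching_weight_adapted:
  assumes fin: "finite X" and d: "d \<in> matchings X" and d': "d' \<in> matchings X" and l: "adapted n X d l"
  shows "matching_weight X d' l = of_bool (d \<subseteq> d')"
proof -
  have "((\<forall>e\<in>d'. \<forall>u\<in>e. \<forall>v\<in>e. l u = l v) \<and> (\<forall>v\<in>X - \<Union> d'. l v = 0)) \<longleftrightarrow> d \<subseteq> d'"
    (is "?const \<and> ?iso \<longleftrightarrow> _")
  proof
    assume A: "?const \<and> ?iso"
    show "d \<subseteq> d'"
    proof
      fix e assume e: "e \<in> d"
      then obtain x y where xy: "e = {x, y}" "x \<noteq> y"
        using matchingD(2)[OF d e] by (auto simp: card_2_iff)
      have xX: "x \<in> X" "y \<in> X" using matchingD(1)[OF d e] xy by auto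
      have lx: "l x \<noteq> 0" using adaptedD(3)[OF l xX e] xy by simp
      then have "x \<in> \<Union> d'" using bspec[OF conjunct2[OF A], of x] xX(1) by (metis DiffI)
      then obtain e' where e': "e' \<in> d'" "x \<in> e'" by blast
      then obtain z where z: "e' = {x, z}" "x \<noteq> z"
        using matchingD(2)[OF d' e'(1)] by (auto simp: card_2_iff)
      have "z \<in> X" using matchingD(1)[OF d' e'(1)] z by auto
      moreover have "l x = l z" using A e'(1) z by blast
      ultimately obtain e1 where e1: "e1 \<in> d" "x \<in> e1" "z \<in> e1"
        using adaptedD(1)[OF l xX(1) _ _ lx] by blast
      then have "e1 = e" using matchingD(3)[OF d e1(1) e e1(2)] xy by simp
      then have "z = y" using e1(3) xy z by auto
      then show "e \<in> d'" using xy z e' by simp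
    qed
  next
    assume sub: "d \<subseteq> d'"
    have key: "l u = l v" if "e \<in> d'" "u \<in> e" "v \<in> e" "l u \<noteq> 0" for e u v
    proof -
      have uv: "u \<in> X" "v \<in> X" using matchingD(1)[OF d' that(1)] that by auto
      have "\<exists>e1\<in>d. u \<in> e1 \<and> u \<in> e1" using adaptedD(1)[OF l uv(1) uv(1) refl that(4)] .
      moreover have "e1 = e" if "e1 \<in> d" "u \<in> e1" for e1
        using matchingD(3)[OF d' _ \<open>e \<in> d'\<close> that(2) \<open>u \<in> e\<close>] sub that(1) by blast
      ultimately have "e \<in> d" by blast
      then show ?thesis using adaptedD(2)[OF l uv] that(2,3) by blast
    qed
    have ?const
    proof (intro ballI)
      fix e u v assume e: "e \<in> d'" "u \<in> e" "v \<in> e"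
      show "l u = l v"
      proof (cases "l u = 0")
        case True
        then show ?thesis using key[OF e(1,3,2)] by metis
      qed (rule key[OF e])
    qed
    moreover have ?iso
    proof
      fix v assume v: "v \<in> X - \<Union> d'"
      then have "v \<in> X" by blast
      then show "l v = 0"
        using adaptedD(1)[OF l \<open>v \<in> X\<close> \<open>v \<in> X\<close> refl] sub v by blast
    qed
    ultimately show "?const \<and> ?iso" by blast
  qed
  then show ?thesis unfolding matching_weight_eq[OF fin d'] by (rule arg_cong)
qed

text \<open>A matching on at most \<open>2 * n\<close> vertices has at most \<open>n\<close> edges,
  so its edges can be numbered injectively by \<open>{1..n}\<close>.\<close>

lemma adapted_exists:
  assumes fin: "finite X" and card: "card X \<le> 2 * n" and d: "d \<in> matchings X"
  shows "\<exists>l. adapted n X d l"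
proof -
  have fd: "finite d" using finite_matching[OF fin d] .
  have sub: "\<Union> d \<subseteq> X" using matchingD(1)[OF d] by blast
  have "2 * card d = card (\<Union> d)"
    by (rule card_partition)
      (use fd finite_subset[OF sub fin] matchingD(2)[OF d] matchingD(3)[OF d] in blast)+
  also have "\<dots> \<le> card X" using card_mono[OF fin sub] .
  finally have "card d \<le> card {1..n}" using card by simp
  then obtain f where f: "f ` d \<subseteq> {1..n}" "inj_on f d"
    using card_le_inj[OF fd, of "{1..n}"] by auto
  define l where "l = (\<lambda>x\<in>X. if x \<in> \<Union> d then f (edge_of d x) else 0)"
  have l_e: "l x = f e" if "e \<in> d" "x \<in> e" for x e
  proof -
    have "x \<in> X" "x \<in> \<Union> d" using that matchingD(1)[OF d that(1)] by blast+
    then show ?thesis by (simp only: l_def restrict_apply if_True edge_of_eq[OF d that])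
  qed
  have f_in: "f e \<in> {1..n}" if "e \<in> d" for e using f(1) that by blast
  have "l \<in> labelings n X"
  proof (rule PiE_I)
    fix x assume x: "x \<in> X"
    show "l x \<in> {0..n}"
    proof (cases "x \<in> \<Union> d")
      case True
      then obtain e where e: "e \<in> d" "x \<in> e" by blast
      show ?thesis using f_in[OF e(1)] by (simp add: l_e[OF e])
    qed (simp add: l_def x)
  qed (simp add: l_def)
  moreover have "l x = l y \<and> l x \<noteq> 0 \<longleftrightarrow> (\<exists>e\<in>d. x \<in> e \<and> y \<in> e)" if xy: "x \<in> X" "y \<in> X" for x y
  proof
    assume a: "l x = l y \<and> l x \<noteq> 0"
    have in_d: "z \<in> \<Union> d" if "z \<in> X" "l z \<noteq> 0" for z
      using that by (auto simp: l_def split: if_splits)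
    obtain e where e: "e \<in> d" "x \<in> e" using in_d[OF xy(1)] a by blast
    obtain e' where e': "e' \<in> d" "y \<in> e'" using in_d[OF xy(2)] a by auto
    have "f e = f e'" using a l_e[OF e] l_e[OF e'] by simp
    then have "e = e'" using f(2) e(1) e'(1) by (simp add: inj_on_def)
    then show "\<exists>e\<in>d. x \<in> e \<and> y \<in> e" using e e' by blast
  next
    assume "\<exists>e\<in>d. x \<in> e \<and> y \<in> e"
    then obtain e where e: "e \<in> d" "x \<in> e" "y \<in> e" by blast
    show "l x = l y \<and> l x \<noteq> 0"
      using l_e[OF e(1,2)] l_e[OF e(1,3)] f_in[OF e(1)] by auto
  qed
  ultimately show ?thesis unfolding adapted_def by blast
qed

text \<open>The complements of \<open>A\<close> and of its image have equal size, so any bijection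
  between them completes \<open>f\<close>. This turns a renaming of the used labels into a
  permutation matrix.\<close>

lemma inj_on_extends_permutes:
  fixes f :: "'a \<Rightarrow> 'a"
  assumes fin: "finite S" and A: "A \<subseteq> S" and f: "f ` A \<subseteq> S" "inj_on f A"
  shows "\<exists>p. p permutes S \<and> (\<forall>x\<in>A. p x = f x)"
proof -
  have fA: "finite A" and ffA: "finite (f ` A)"
    using finite_subset[OF A fin] finite_subset[OF f(1) fin] .
  have "card (S - A) = card (S - f ` A)"
    using card_image[OF f(2)] A f(1) fin by (simp add: card_Diff_subset fA ffA)
  then obtain g where g: "bij_betw g (S - A) (S - f ` A)"
    using finite_same_card_bij[OF finite_Diff[OF fin] finite_Diff[OF fin]] by blast
  define p where "p x = (if x \<in> A then f x else if x \<in> S then g x else x)" for x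
  have "bij_betw p A (f ` A)"
    by (rule bij_betw_cong[THEN iffD1, OF _ inj_on_imp_bij_betw[OF f(2)]]) (simp add: p_def)
  moreover have "bij_betw p (S - A) (S - f ` A)"
    by (rule bij_betw_cong[THEN iffD1, OF _ g]) (simp add: p_def)
  ultimately have "bij_betw p (A \<union> (S - A)) (f ` A \<union> (S - f ` A))"
    by (rule bij_betw_combine) blast
  then have "bij_betw p S S" using A f(1) by (simp add: Un_absorb1)
  then have "p permutes S" using A by (intro bij_imp_permutes) (auto simp: p_def)
  moreover have "\<forall>x\<in>A. p x = f x" by (simp add: p_def)
  ultimately show ?thesis by blast
qed

text \<open>Two labelings adapted to the same matching differ by an injective renaming of nonzero
  values, which extends to a permutation of \<open>{1..n}\<close>. One sample labeling per matching
  therefore suffices.\<close>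

lemma invariant_tensor_adapted:
  assumes fin: "finite X" and T: "invariant_tensor n X T"
    and d: "d \<in> matchings X" and l: "adapted n X d l" and l': "adapted n X d l'"
  shows "T l' = T l"
proof -
  have lab: "l \<in> labelings n X" "l' \<in> labelings n X" using l l' by (auto simp: adapted_def)
  \<comment> \<open>The renaming, read off at an arbitrary vertex with label \<open>c\<close>;
    \<open>eq_iff\<close> shows that the choice does not matter for the labels of edges.\<close>
  define f where "f c = l' (SOME x. x \<in> X \<and> l x = c)" for c
  define A where "A = l ` \<Union> d"
  have dX: "x \<in> X" if "x \<in> \<Union> d" for x using that matchingD(1)[OF d] by blast
  have eq_iff: "l x = l y \<longleftrightarrow> l' x = l' y" if x: "x \<in> \<Union> d" and y: "y \<in> \<Union> d" for x y
  proof -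
    have nz: "l x \<noteq> 0" "l' x \<noteq> 0"
      using adaptedD(3)[OF l dX[OF x] dX[OF x]] adaptedD(3)[OF l' dX[OF x] dX[OF x]] x by blast+
    then show ?thesis
      using l[unfolded adapted_def, THEN conjunct2, THEN bspec, OF dX[OF x], THEN bspec, OF dX[OF y]]
        l'[unfolded adapted_def, THEN conjunct2, THEN bspec, OF dX[OF x], THEN bspec, OF dX[OF y]]
      by simp
  qed
  have nz: "l x \<noteq> 0" "l' x \<noteq> 0" if x: "x \<in> \<Union> d" for x
    using adaptedD(3)[OF l dX[OF x] dX[OF x]] adaptedD(3)[OF l' dX[OF x] dX[OF x]] x by blast+
  have zero: "l x = 0" "l' x = 0" if x: "x \<in> X" "x \<notin> \<Union> d" for x
    using adaptedD(1)[OF l x(1) x(1) refl] adaptedD(1)[OF l' x(1) x(1) refl] x(2) by blast+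
  have f: "f (l x) = l' x" if x: "x \<in> \<Union> d" for x
  proof -
    have "\<exists>y. y \<in> X \<and> l y = l x" using dX[OF x] by blast
    from someI_ex[OF this]
    have y: "(SOME y. y \<in> X \<and> l y = l x) \<in> X" "l (SOME y. y \<in> X \<and> l y = l x) = l x"
      by (rule conjunct1, rule conjunct2)
    have "(SOME y. y \<in> X \<and> l y = l x) \<in> \<Union> d"
      using zero(1)[OF y(1)] y(2) nz(1)[OF x] by metis
    then show ?thesis unfolding f_def using eq_iff[OF _ x, THEN iffD1] y(2) by blast
  qed
  have range: "l x \<in> {1..n}" "l' x \<in> {1..n}" if "x \<in> \<Union> d" for x
  proof -
    have "l x \<in> {0..n}" "l' x \<in> {0..n}" using lab dX[OF that] by (auto intro: PiE_mem)
    then show "l x \<in> {1..n}" "l' x \<in> {1..n}" using nz[OF that] by auto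
  qed
  have "inj_on f A"
  proof (rule inj_onI)
    fix a b assume "a \<in> A" "b \<in> A" and fab: "f a = f b"
    then obtain x y where xy: "x \<in> \<Union> d" "a = l x" "y \<in> \<Union> d" "b = l y" unfolding A_def by blast
    then show "a = b" using fab f[OF xy(1)] f[OF xy(3)] eq_iff[OF xy(1,3)] by simp
  qed
  moreover have "f ` A \<subseteq> {1..n}" using range(2) f unfolding A_def by fastforce
  moreover have "A \<subseteq> {1..n}" using range(1) unfolding A_def by blast
  ultimately obtain p where p: "p permutes {1..n}" "\<forall>c\<in>A. p c = f c"
    using inj_on_extends_permutes[of "{1..n}" A f] by blast
  have p0: "p 0 = 0" using p(1) by (simp add: permutes_def)
  have "(\<lambda>x\<in>X. p (l x)) = l'"
  proof
    fix x
    consider "x \<in> \<Union> d" | "x \<in> X" "x \<notin> \<Union> d" | "x \<notin> X" by blast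
    then show "(\<lambda>x\<in>X. p (l x)) x = l' x"
    proof cases
      case 1
      then have "l x \<in> A" unfolding A_def by blast
      then have "p (l x) = l' x" using p(2) f[OF 1] by simp
      then show ?thesis using dX[OF 1] by simp
    next
      case 2
      then show ?thesis using zero[OF 2] p0 by simp
    next
      case 3
      then show ?thesis using lab(2) by (auto simp: PiE_def extensional_def)
    qed
  qed
  then show ?thesis using invariant_tensor_permute[OF fin T lab(1) p(1)] by simp
qed

text \<open>The edges are the two-element fibres of \<open>l\<close> over nonzero values.\<close>

lemma adapted_of_pairs:
  assumes l: "l \<in> labelings n X" and two: "\<And>c. c \<in> {1..n} \<Longrightarrow> card {x \<in> X. l x = c} \<in> {0, 2}"
    and fin: "finite X"
  shows "\<exists>d\<in>matchings X. adapted n X d l"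
proof -
  define fib where "fib c = {x \<in> X. l x = c}" for c
  define d where "d = fib ` {c \<in> {1..n}. card (fib c) = 2}"
  have "d \<in> matchings X"
    unfolding matchings_def d_def by (auto simp: fib_def)
  moreover have "l x = l y \<and> l x \<noteq> 0 \<longleftrightarrow> (\<exists>e\<in>d. x \<in> e \<and> y \<in> e)" if xy: "x \<in> X" "y \<in> X" for x y
  proof
    assume a: "l x = l y \<and> l x \<noteq> 0"
    have "l x \<in> {0..n}" using PiE_mem[OF l xy(1)] .
    then have c: "l x \<in> {1..n}" using a by auto
    have "x \<in> fib (l x)" "y \<in> fib (l x)" using xy a by (auto simp: fib_def)
    moreover have "finite (fib (l x))" using fin by (simp add: fib_def)
    ultimately have "card (fib (l x)) \<noteq> 0" by auto
    then have "fib (l x) \<in> d" using two[OF c] c unfolding d_def fib_def by auto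
    then show "\<exists>e\<in>d. x \<in> e \<and> y \<in> e" using \<open>x \<in> fib (l x)\<close> \<open>y \<in> fib (l x)\<close> by blast
  next
    assume "\<exists>e\<in>d. x \<in> e \<and> y \<in> e"
    then obtain c where "c \<in> {1..n}" "x \<in> fib c" "y \<in> fib c" unfolding d_def by blast
    then show "l x = l y \<and> l x \<noteq> 0" by (auto simp: fib_def)
  qed
  ultimately show ?thesis using l unfolding adapted_def by blast
qed

text \<open>
  If some nonzero value occurs at least four times then, as \<open>card X \<le> 2 * n\<close>, some value \<open>b\<close> does not
  occur, and the rotation relation expresses \<open>T l\<close> by values at labelings that use \<open>b\<close> as well.
\<close>

lemma invariant_tensor_eq_0:
  assumes fin: "finite X" and card: "card X \<le> 2 * n" and T: "invariant_tensor n X T"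
    and zero: "\<And>d l. d \<in> matchings X \<Longrightarrow> adapted n X d l \<Longrightarrow> T l = 0"
    and l: "l \<in> labelings n X"
  shows "T l = 0"
  using l
proof (induction "n - card (l ` X \<inter> {1..n})" arbitrary: l rule: less_induct)
  case less
  note l = less.prems
  define occ where "occ c = card {x \<in> X. l x = c}" for c
  define used where "used = l ` X \<inter> {1..n}"
  show ?case
  proof (cases "\<exists>c\<in>{1..n}. odd (occ c)")
    case True
    then show ?thesis using invariant_tensor_odd[OF fin T l] unfolding occ_def by blast
  next
    case no_odd: False
    show ?thesis
    proof (cases "\<forall>c\<in>{1..n}. occ c \<in> {0, 2}")
      case True
      then obtain d where "d \<in> matchings X" "adapted n X d l"
        using adapted_of_pairs[OF l _ fin] unfolding occ_def by blast
      then show ?thesis by (rule zero)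
    next
      case False
      then obtain a where a: "a \<in> {1..n}" "occ a \<noteq> 0" "occ a \<noteq> 2" by blast
      have ev: "even (occ c)" if "c \<in> {1..n}" for c using no_odd that by blast
      have a4: "occ a \<ge> 4"
        using a(2,3) ev[OF a(1)] by presburger
      have used2: "occ c \<ge> 2" if "c \<in> used" for c
      proof -
        have "{x \<in> X. l x = c} \<noteq> {}" using that unfolding used_def by auto
        then have "occ c \<noteq> 0" using fin by (simp add: occ_def)
        moreover have "even (occ c)" using ev that by (simp add: used_def)
        ultimately show ?thesis by presburger
      qed
      have finu: "finite used" by (simp add: used_def)
      have a_used: "a \<in> used"
      proof -
        have "{x \<in> X. l x = a} \<noteq> {}" using a(2) unfolding occ_def by (metis card.empty)
        then show ?thesis using a(1) unfolding used_def by blast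
      qed
      have "(\<Sum>c\<in>used. occ c) = card (\<Union>c\<in>used. {x \<in> X. l x = c})"
        unfolding occ_def using fin finu by (intro card_UN_disjoint[symmetric]) auto
      also have "\<dots> \<le> card X" using fin by (intro card_mono) auto
      finally have "(\<Sum>c\<in>used. occ c) \<le> 2 * n" using card by linarith
      moreover have "(\<Sum>c\<in>used. occ c) = occ a + (\<Sum>c\<in>used - {a}. occ c)"
        using finu a_used by (rule sum.remove)
      moreover have "(\<Sum>c\<in>used - {a}. occ c) \<ge> card (used - {a}) * 2"
        using used2 sum_bounded_below[of "used - {a}" 2 occ] by simp
      moreover have "card used = Suc (card (used - {a}))"
        using finu a_used by (metis card_Suc_Diff1)
      \<comment> \<open>The value \<open>a\<close> occurs at least four times and every other used
        value at least twice, so \<open>2 * card used + 2 \<le> card X \<le> 2 * n\<close>.\<close>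
      ultimately have "card used < n" using a4 by linarith
      then have "used \<noteq> {1..n}" by auto
      then obtain b where b: "b \<in> {1..n}" "b \<notin> used" unfolding used_def by blast
      have ab: "a \<noteq> b" using a_used b(2) by blast
      have b_unused: "l y \<noteq> b" if "y \<in> X" for y using b that unfolding used_def by blast
      obtain x where x: "x \<in> X" "l x = a" using a_used unfolding used_def by blast
      define l1 where "l1 = l(x := b)"
      have upd: "m(y := c) \<in> labelings n X" if "m \<in> labelings n X" "y \<in> X" "c \<in> {1..n}" for m y c
      proof -
        have "c \<in> {0..n}" using that(3) by simp
        then show ?thesis using PiE_fun_upd[of c "\<lambda>_. {0..n}" y m X] that by (simp add: insert_absorb)
      qed
      have l1: "l1 \<in> labelings n X" unfolding l1_def using upd[OF l x(1) b(1)] .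
      have "{y \<in> X. l1 y = b} = {x}" using b_unused x(1) by (auto simp: l1_def)
      moreover have "l1(x := a) = l" using x(2) by (auto simp: l1_def)
      ultimately have "T l = (\<Sum>y\<in>{y \<in> X. l1 y = a}. T (l1(y := b)))"
        using invariant_tensor_rotation[OF fin T l1 a(1) b(1) ab] by simp
      also have "\<dots> = (\<Sum>y\<in>{y \<in> X. l1 y = a}. 0)"
      proof (rule sum.cong[OF refl])
        fix y assume y: "y \<in> {y \<in> X. l1 y = a}"
        have yx: "y \<noteq> x" using y ab by (auto simp: l1_def)
        let ?m = "l1(y := b)"
        have m: "?m \<in> labelings n X" using upd[OF l1 _ b(1)] y by blast
        have "\<not> {z \<in> X. l z = a} \<subseteq> {x, y}"
        proof
          assume "{z \<in> X. l z = a} \<subseteq> {x, y}"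
          then have "occ a \<le> card {x, y}" unfolding occ_def by (intro card_mono) auto
          also have "\<dots> \<le> 2" by (simp add: card_insert_if)
          finally show False using a4 by simp
        qed
        then obtain z where z: "z \<in> X" "l z = a" "z \<noteq> x" "z \<noteq> y" by blast
        have "insert b used \<subseteq> ?m ` X \<inter> {1..n}"
        proof
          fix c assume c: "c \<in> insert b used"
          show "c \<in> ?m ` X \<inter> {1..n}"
          proof (cases "c = b")
            case True
            then show ?thesis using b(1) x(1) yx by (auto simp: l1_def image_iff)
          next
            case False
            then have cu: "c \<in> used" using c by blast
            then obtain w where w: "w \<in> X" "l w = c" "c \<in> {1..n}" unfolding used_def by blast
            show ?thesis
            proof (cases "c = a")
              case True
              then have "?m z = c" using z by (simp add: l1_def)
              then show ?thesis using z(1) w(3) by blast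
            next
              case False
              then have "w \<noteq> x" "w \<noteq> y" using w(2) x(2) y yx by (auto simp: l1_def)
              then have "?m w = c" using w by (simp add: l1_def)
              then show ?thesis using w(1,3) by blast
            qed
          qed
        qed
        then have "card (insert b used) \<le> card (?m ` X \<inter> {1..n})" by (intro card_mono) auto
        then have "card used < card (?m ` X \<inter> {1..n})" using b(2) finu by simp
        then have "n - card (?m ` X \<inter> {1..n}) < n - card (l ` X \<inter> {1..n})"
          using \<open>card used < n\<close> unfolding used_def by linarith
        then show "T ?m = 0" using m by (rule less.hyps)
      qed
      finally show ?thesis by simp
    qed
  qed
qed

section \<open>The unitriangular system and the basis of the invariants\<close>

text \<open>Back substitution along inclusion: for a minimal \<open>m\<close>, the unknown
  \<open>a m\<close> occurs in no other equation, and in its own with coefficient 1. The equations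
  without \<open>m\<close> are solved first, and \<open>a m\<close> is then adjusted.\<close>

lemma superset_sum_solvable:
  fixes f :: "'a set \<Rightarrow> complex"
  assumes "finite D"
  shows "\<exists>a. \<forall>d\<in>D. (\<Sum>d'\<in>D. a d' * of_bool (d \<subseteq> d')) = f d"
  using assms
proof (induction D rule: finite_psubset_induct)
  case (psubset D)
  show ?case
  proof (cases "D = {}")
    case False
    then obtain m where m: "m \<in> D" "\<forall>b\<in>D. b \<subseteq> m \<longrightarrow> m = b"
      using finite_has_minimal[OF psubset.hyps] by blast
    then have "D - {m} \<subset> D" by blast
    from psubset.IH[OF this]
    obtain a where a: "\<forall>d\<in>D - {m}. (\<Sum>d'\<in>D - {m}. a d' * of_bool (d \<subseteq> d')) = f d" ..
    define a' where "a' = a(m := f m - (\<Sum>d'\<in>D - {m}. a d' * of_bool (m \<subseteq> d')))"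
    have split: "(\<Sum>d'\<in>D. a' d' * of_bool (d \<subseteq> d')) =
        a' m * of_bool (d \<subseteq> m) + (\<Sum>d'\<in>D - {m}. a d' * of_bool (d \<subseteq> d'))" for d
    proof -
      have "(\<Sum>d'\<in>D - {m}. a' d' * of_bool (d \<subseteq> d')) = (\<Sum>d'\<in>D - {m}. a d' * of_bool (d \<subseteq> d'))"
        by (rule sum.cong) (auto simp: a'_def)
      then show ?thesis
        using sum.remove[OF psubset.hyps m(1), of "\<lambda>d'. a' d' * of_bool (d \<subseteq> d')"] by simp
    qed
    have "(\<Sum>d'\<in>D. a' d' * of_bool (d \<subseteq> d')) = f d" if "d \<in> D" for d
    proof (cases "d = m")
      case True
      show ?thesis unfolding True split by (simp add: a'_def)
    next
      case False
      then have "\<not> d \<subseteq> m" using m(2) that by blast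
      moreover have "(\<Sum>d'\<in>D - {m}. a d' * of_bool (d \<subseteq> d')) = f d"
        using a that False by blast
      ultimately show ?thesis unfolding split by simp
    qed
    then show ?thesis by blast
  qed simp
qed

text \<open>At a maximal element of the support of \<open>a\<close> the sum reduces to one
  term.\<close>

lemma superset_sum_eq_0:
  fixes a :: "'a set \<Rightarrow> complex"
  assumes fin: "finite D" and zero: "\<And>d. d \<in> D \<Longrightarrow> (\<Sum>d'\<in>D. a d' * of_bool (d \<subseteq> d')) = 0"
    and d: "d \<in> D"
  shows "a d = 0"
proof (rule ccontr)
  assume "a d \<noteq> 0"
  then have "{d \<in> D. a d \<noteq> 0} \<noteq> {}" using d by blast
  then obtain m where m: "m \<in> D" "a m \<noteq> 0" "\<forall>b\<in>D. a b \<noteq> 0 \<longrightarrow> m \<subseteq> b \<longrightarrow> m = b"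
    using finite_has_maximal[of "{d \<in> D. a d \<noteq> 0}"] fin by auto
  have "(\<Sum>d'\<in>D. a d' * of_bool (m \<subseteq> d')) = (\<Sum>d'\<in>D. if d' = m then a m else 0)"
    using m(3) by (intro sum.cong) auto
  also have "\<dots> = a m" using fin m(1) by (simp add: sum.delta)
  finally show False using zero[OF m(1)] m(2) by simp
qed

lemma invariant_tensor_diff_sum:
  assumes "invariant_tensor n X T" "\<And>d. d \<in> D \<Longrightarrow> invariant_tensor n X (W d)"
  shows "invariant_tensor n X (\<lambda>l. T l - (\<Sum>d\<in>D. a d * W d l))"
  unfolding invariant_tensor_def
proof (intro allI impI ballI)
  fix h l assume h: "orth_fun n h" and l: "l \<in> labelings n X"
  let ?L = "labelings n X" and ?P = "\<lambda>l'. \<Prod>x\<in>X. h (l x) (l' x)"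
  have "(\<Sum>l'\<in>?L. ?P l' * (T l' - (\<Sum>d\<in>D. a d * W d l'))) =
      (\<Sum>l'\<in>?L. ?P l' * T l') - (\<Sum>l'\<in>?L. \<Sum>d\<in>D. a d * (?P l' * W d l'))"
    by (simp add: right_diff_distrib sum_subtractf sum_distrib_left mult.left_commute)
  also have "(\<Sum>l'\<in>?L. \<Sum>d\<in>D. a d * (?P l' * W d l')) = (\<Sum>d\<in>D. a d * (\<Sum>l'\<in>?L. ?P l' * W d l'))"
    unfolding sum_distrib_left by (rule sum.swap)
  also have "\<dots> = (\<Sum>d\<in>D. a d * W d l)"
    using assms(2) h l by (intro sum.cong refl) (simp add: invariant_tensor_def)
  finally show "(\<Sum>l'\<in>?L. ?P l' * (T l' - (\<Sum>d\<in>D. a d * W d l'))) = T l - (\<Sum>d\<in>D. a d * W d l)"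
    using assms(1) h l by (simp add: invariant_tensor_def)
qed

text \<open>Solving the triangular system makes the difference \<open>T'\<close> vanish at one
  adapted labeling per matching. Renaming extends this to all adapted labelings, and these determine
  an invariant tensor.\<close>

theorem invariant_tensor_spanned:
  assumes fin: "finite X" and card: "card X \<le> 2 * n" and T: "invariant_tensor n X T"
  shows "\<exists>a. \<forall>l\<in>labelings n X. T l = (\<Sum>d\<in>matchings X. a d * matching_weight X d l)"
proof -
  let ?D = "matchings X"
  have finD: "finite ?D" using finite_matchings[OF fin] .
  define lab where "lab d = (SOME l. adapted n X d l)" for d
  have lab: "adapted n X d (lab d)" if "d \<in> ?D" for d
    unfolding lab_def using adapted_exists[OF fin card that] by (rule someI_ex)
  obtain a where a: "\<forall>d\<in>?D. (\<Sum>d'\<in>?D. a d' * of_bool (d \<subseteq> d')) = T (lab d)"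
    using superset_sum_solvable[OF finD, of "\<lambda>d. T (lab d)"] by blast
  define T' where "T' l = T l - (\<Sum>d\<in>?D. a d * matching_weight X d l)" for l
  have T': "invariant_tensor n X T'"
    unfolding T'_def by (intro invariant_tensor_diff_sum T matching_weight_invariant fin)
  have "T' l = 0" if d: "d \<in> ?D" and l: "adapted n X d l" for d l
  proof -
    have "T' l = T' (lab d)"
      by (rule invariant_tensor_adapted[OF fin T' d lab[OF d] l])
    also have "\<dots> = T (lab d) - (\<Sum>d'\<in>?D. a d' * of_bool (d \<subseteq> d'))"
      unfolding T'_def using matching_weight_adapted[OF fin d _ lab[OF d]] by simp
    also have "\<dots> = 0" using a d by simp
    finally show ?thesis .
  qed
  then have "T' l = 0" if "l \<in> labelings n X" for l
    using invariant_tensor_eq_0[OF fin card T' _ that] by blast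
  then show ?thesis unfolding T'_def by auto
qed

theorem matching_weights_independent:
  assumes fin: "finite X" and card: "card X \<le> 2 * n"
    and zero: "\<And>l. l \<in> labelings n X \<Longrightarrow> (\<Sum>d\<in>matchings X. a d * matching_weight X d l) = 0"
    and d: "d \<in> matchings X"
  shows "a d = 0"
proof (rule superset_sum_eq_0[OF finite_matchings[OF fin] _ d])
  fix d assume d: "d \<in> matchings X"
  obtain l where l: "adapted n X d l" using adapted_exists[OF fin card d] by blast
  have "(\<Sum>d'\<in>matchings X. a d' * of_bool (d \<subseteq> d')) =
      (\<Sum>d'\<in>matchings X. a d' * matching_weight X d' l)"
    using matching_weight_adapted[OF fin d _ l] by (intro sum.cong refl) simp
  also have "\<dots> = 0" using zero l by (simp add: adapted_def)
  finally show "(\<Sum>d'\<in>matchings X. a d' * of_bool (d \<subseteq> d')) = 0" .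
qed

section \<open>Stacked diagrams\<close>

lemma rook_brauer_diagrams_eq: "rook_brauer_diagrams k = matchings (vertices k)"
proof (rule Set.set_eqI)
  fix d :: diagram
  show "d \<in> rook_brauer_diagrams k \<longleftrightarrow> d \<in> matchings (vertices k)"
  proof
    assume "d \<in> rook_brauer_diagrams k"
    then have e: "\<And>e. e \<in> d \<Longrightarrow> e \<subseteq> vertices k \<and> card e = 2"
      and uniq: "\<And>v. v \<in> vertices k \<Longrightarrow> \<exists>\<^sub>\<le>\<^sub>1 w. {v, w} \<in> d"
      by (auto simp: rook_brauer_diagrams_def)
    have "e1 = e2" if e1: "e1 \<in> d" and e2: "e2 \<in> d" and x: "x \<in> e1" "x \<in> e2" for e1 e2 x
    proof -
      have other: "\<exists>y. e = {x, y}" if "e \<in> d" "x \<in> e" for e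
      proof -
        have "card e = 2" using e[OF that(1)] by simp
        then show ?thesis using that(2) by (auto simp: card_2_iff)
      qed
      obtain y where y: "e1 = {x, y}" using other[OF e1 x(1)] by blast
      obtain z where z: "e2 = {x, z}" using other[OF e2 x(2)] by blast
      have "x \<in> vertices k" using e[OF e1] x(1) by blast
      from uniq[OF this] have "y = z" using e1 e2 unfolding y z by (rule Uniq_D)
      then show ?thesis by (simp add: y z)
    qed
    then show "d \<in> matchings (vertices k)" using e unfolding matchings_def by blast
  next
    assume d: "d \<in> matchings (vertices k)"
    have "\<exists>\<^sub>\<le>\<^sub>1 w. {v, w} \<in> d" for v
    proof (rule Uniq_I)
      fix w w' assume w: "{v, w} \<in> d" and w': "{v, w'} \<in> d"
      have "{v, w} = {v, w'}" using matchingD(3)[OF d w w', of v] by simp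
      then show "w = w'" by (auto simp: doubleton_eq_iff)
    qed
    then show "d \<in> rook_brauer_diagrams k"
      using matchingD(1,2)[OF d] unfolding rook_brauer_diagrams_def by blast
  qed
qed

lemma diagram_weight_eq: "diagram_weight k d i j = matching_weight (vertices k) d (vertex_label i j)"
  by (simp only: diagram_weight_def matching_weight_def of_bool_def)

lemma finite_vertices: "finite (vertices k)"
  by (simp add: vertices_def)

lemma card_matching_star:
  assumes "d \<in> matchings X"
  shows "card {e \<in> d. x \<in> e} = of_bool (x \<in> \<Union> d)"
proof (cases "x \<in> \<Union> d")
  case True
  then obtain e where e: "e \<in> d" "x \<in> e" by blast
  have "e' = e" if "e' \<in> d" "x \<in> e'" for e' using matchingD(3)[OF assms that(1) e(1) that(2) e(2)] .
  then have "{e \<in> d. x \<in> e} = {e}" using e by blast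
  then show ?thesis using True by simp
next
  case False
  then have "{e \<in> d. x \<in> e} = {}" by blast
  then show ?thesis by (simp only: card.empty False of_bool_eq(1))
qed

section \<open>Edge counts in connected multigraphs\<close>

lemma size_filter_mset_mono:
  assumes "\<And>x. P x \<Longrightarrow> Q x"
  shows "size (filter_mset P E) \<le> size (filter_mset Q E)"
  by (induction E) (auto dest: assms)

lemma size_filter_mset_less:
  assumes PQ: "\<And>x. P x \<Longrightarrow> Q x" and x: "x \<in># E" "Q x" "\<not> P x"
  shows "size (filter_mset P E) < size (filter_mset Q E)"
proof -
  obtain E' where "E = add_mset x E'" using multi_member_split[OF x(1)] by blast
  then show ?thesis using x size_filter_mset_mono[of P Q E', OF PQ] by simp
qed

lemma rtrancl_crosses:
  assumes "(u, v) \<in> r\<^sup>*" "u \<in> S" "v \<notin> S"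
  shows "\<exists>a b. a \<in> S \<and> b \<notin> S \<and> (a, b) \<in> r \<and> (u, a) \<in> r\<^sup>*"
  using assms(1,3)
proof (induction rule: rtrancl_induct)
  case base
  then show ?case using assms(2) by blast
next
  case (step y z)
  then show ?case by (cases "y \<in> S") blast+
qed

text \<open>The spanning tree bound. A set grown from \<open>u\<close> one neighbour at a time
  gains, with each vertex, an edge that was not inside it before.\<close>

lemma connected_card_le_edges:
  assumes fin: "finite C" and C: "C = connected_rel E `` {u}"
  shows "card C \<le> size {#e \<in># E. e \<subseteq> C#} + 1"
proof -
  have uC: "u \<in> C" unfolding C connected_rel_def by blast
  have "\<exists>S\<subseteq>C. u \<in> S \<and> card S = Suc s \<and> s \<le> size {#e \<in># E. e \<subseteq> S#}" if "Suc s \<le> card C" for s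
    using that
  proof (induction s)
    case 0
    show ?case by (rule exI[of _ "{u}"]) (use uC in simp)
  next
    case (Suc s)
    then obtain S where S: "S \<subseteq> C" "u \<in> S" "card S = Suc s" "s \<le> size {#e \<in># E. e \<subseteq> S#}"
      by force
    have finS: "finite S" using finite_subset[OF S(1) fin] .
    have "S \<noteq> C" using S(3) Suc.prems by auto
    then obtain v where v: "v \<in> C" "v \<notin> S" using S(1) by blast
    have "(u, v) \<in> {(u, v). {u, v} \<in># E}\<^sup>*" using v(1) unfolding C connected_rel_def by blast
    from rtrancl_crosses[OF this S(2) v(2)] obtain a b where
      ab: "a \<in> S" "b \<notin> S" "{a, b} \<in># E" "(u, a) \<in> {(u, v). {u, v} \<in># E}\<^sup>*" by blast
    have "(u, b) \<in> connected_rel E"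
      unfolding connected_rel_def using ab(4) by (rule rtrancl_into_rtrancl) (simp add: ab(3))
    then have bC: "b \<in> C" unfolding C by blast
    have "size {#e \<in># E. e \<subseteq> S#} < size {#e \<in># E. e \<subseteq> insert b S#}"
      by (rule size_filter_mset_less[of _ _ "{a, b}"]) (use ab in auto)
    then show ?case
      using S bC ab(2) finS by (intro exI[of _ "insert b S"]) auto
  qed
  moreover have "card C \<noteq> 0" using fin uC by auto
  ultimately obtain S where S: "S \<subseteq> C" "card S = card C" "card C - 1 \<le> size {#e \<in># E. e \<subseteq> S#}"
    by (metis Suc_pred' le_refl neq0_conv)
  then have "S = C" using card_subset_eq[OF fin] by blast
  then show ?thesis using S(3) by simp
qed

text \<open>Each edge has both ends in \<open>C\<close> or none, so it adds 2 or 0 to the sum. Edges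
  count with multiplicity, which is what makes a double edge a cycle in the degree count.\<close>

lemma handshake:
  assumes fin: "finite C" and E: "\<And>e. e \<in># E \<Longrightarrow> card e = 2 \<and> (e \<subseteq> C \<or> e \<inter> C = {})"
  shows "(\<Sum>v\<in>C. vertex_degree E v) = 2 * size {#e \<in># E. e \<subseteq> C#}"
  using E
proof (induction E)
  case empty
  then show ?case by (simp add: vertex_degree_def)
next
  case (add e E)
  have e: "card e = 2" "e \<subseteq> C \<or> e \<inter> C = {}" using add.prems[of e] by auto
  have "vertex_degree (add_mset e E) v = vertex_degree E v + of_bool (v \<in> e)" for v
    by (simp add: vertex_degree_def)
  then have "(\<Sum>v\<in>C. vertex_degree (add_mset e E) v) =
      (\<Sum>v\<in>C. vertex_degree E v) + (\<Sum>v\<in>C. of_bool (v \<in> e))"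
    by (simp only: sum.distrib)
  also have "(\<Sum>v\<in>C. vertex_degree E v) = 2 * size {#e \<in># E. e \<subseteq> C#}"
    using add.prems by (intro add.IH) auto
  also have "(\<Sum>v\<in>C. of_bool (v \<in> e)) = card (C \<inter> e)"
    using fin by (simp add: of_bool_def sum.If_cases)
  also have "card (C \<inter> e) = (if e \<subseteq> C then 2 else 0)"
  proof (cases "e \<subseteq> C")
    case True
    then have "C \<inter> e = e" by blast
    then show ?thesis using True e(1) by simp
  next
    case False
    then have "C \<inter> e = {}" using e(2) by blast
    then show ?thesis using False by simp
  qed
  finally show ?case by simp
qed

section \<open>Components of the stacked graph\<close>

locale stacked_diagrams =
  fixes k :: nat and d1 d2 :: diagram
  assumes d1: "d1 \<in> matchings (vertices k)" and d2: "d2 \<in> matchings (vertices k)"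
begin

definition E :: "vertex set multiset" where "E = stack d1 d2"
definition R :: "(vertex \<times> vertex) set" where "R = connected_rel E"
definition V :: "vertex set" where "V = (UNIV :: level set) \<times> {1..k}"
definition vdeg :: "vertex \<Rightarrow> nat" where "vdeg = vertex_degree E"
text \<open>The vertices forced to carry the label \<open>0\<close>. A middle vertex is dead as soon
  as one of the two diagrams leaves it isolated, even if the other joins it to something.\<close>

definition dead :: "vertex set" where "dead = upper ` (vertices k - \<Union> d1) \<union> lower ` (vertices k - \<Union> d2)"

lemma finite_V: "finite V"
proof -
  have "(UNIV :: level set) \<subseteq> {Top, Middle, Bottom}" using level.exhaust by blast
  then show ?thesis by (simp add: V_def finite_subset)
qed

lemma finite_d: "finite d1" "finite d2"
  using finite_matching[OF finite_vertices] d1 d2 by auto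

lemma vertices_subset_V: "vertices k \<subseteq> V"
  by (auto simp: vertices_def V_def)

lemma V_cases: "v \<in> V \<Longrightarrow> v \<in> vertices k \<or> v \<in> {Middle} \<times> {1..k}"
  by (cases v; cases "fst v") (auto simp: V_def vertices_def)

lemma mem_E: "e \<in># E \<longleftrightarrow> (\<exists>e'\<in>d1. e = upper ` e') \<or> (\<exists>e'\<in>d2. e = lower ` e')"
  by (auto simp: E_def stack_def finite_d)

lemma inj_upper: "inj_on upper (vertices k)"
  by (auto simp: inj_on_def vertices_def)

lemma inj_lower: "inj_on lower (vertices k)"
  by (auto simp: inj_on_def vertices_def)

lemma edge_E:
  assumes "e \<in># E"
  shows "e \<subseteq> V" "card e = 2"
proof -
  have "e \<subseteq> V \<and> card e = 2"
    using assms unfolding mem_E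
  proof (elim disjE bexE)
    fix e' assume e': "e' \<in> d1" "e = upper ` e'"
    have sub: "e' \<subseteq> vertices k" using matchingD(1)[OF d1 e'(1)] .
    have "card e = card e'" unfolding e'(2) using inj_on_subset[OF inj_upper sub] by (rule card_image)
    have "upper ` e' \<subseteq> upper ` vertices k" using sub by blast
    moreover have "upper ` vertices k \<subseteq> V" by (auto simp: vertices_def V_def)
    ultimately have "e \<subseteq> V" unfolding e'(2) by (rule subset_trans)
    moreover have "card e = 2" using \<open>card e = card e'\<close> matchingD(2)[OF d1 e'(1)] by (rule trans)
    ultimately show ?thesis ..
  next
    fix e' assume e': "e' \<in> d2" "e = lower ` e'"
    have sub: "e' \<subseteq> vertices k" using matchingD(1)[OF d2 e'(1)] .
    have "card e = card e'" unfolding e'(2) using inj_on_subset[OF inj_lower sub] by (rule card_image)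
    have "lower ` e' \<subseteq> lower ` vertices k" using sub by blast
    moreover have "lower ` vertices k \<subseteq> V" by (auto simp: vertices_def V_def)
    ultimately have "e \<subseteq> V" unfolding e'(2) by (rule subset_trans)
    moreover have "card e = 2" using \<open>card e = card e'\<close> matchingD(2)[OF d2 e'(1)] by (rule trans)
    ultimately show ?thesis ..
  qed
  then show "e \<subseteq> V" "card e = 2" by auto
qed

lemma R_refl: "(v, v) \<in> R"
  by (simp add: R_def connected_rel_def)

lemma R_edge: "{u, v} \<in># E \<Longrightarrow> (u, v) \<in> R"
  by (auto simp: R_def connected_rel_def)

lemma R_sym: "(u, v) \<in> R \<Longrightarrow> (v, u) \<in> R"
proof -
  have "sym {(u, v). {u, v} \<in># E}" by (auto simp: sym_def insert_commute)
  then show "(u, v) \<in> R \<Longrightarrow> (v, u) \<in> R"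
    unfolding R_def connected_rel_def using sym_rtrancl by (metis symD)
qed

lemma R_trans: "(u, v) \<in> R \<Longrightarrow> (v, w) \<in> R \<Longrightarrow> (u, w) \<in> R"
  unfolding R_def connected_rel_def by (rule rtrancl_trans)

lemma R_class_eq: "(u, v) \<in> R \<Longrightarrow> R `` {u} = R `` {v}"
  using R_sym R_trans by blast

lemma R_edge_mem: "e \<in># E \<Longrightarrow> u \<in> e \<Longrightarrow> v \<in> e \<Longrightarrow> (u, v) \<in> R"
proof -
  assume e: "e \<in># E" "u \<in> e" "v \<in> e"
  show "(u, v) \<in> R"
  proof (cases "u = v")
    case False
    have "card e = 2" using edge_E(2)[OF e(1)] .
    then have "e = {u, v}" using e False by (auto simp: card_2_iff)
    then show ?thesis using R_edge e(1) by simp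
  qed (simp add: R_refl)
qed

lemma R_induct:
  assumes "(u, v) \<in> R" and "P u" and "\<And>x y e. e \<in># E \<Longrightarrow> x \<in> e \<Longrightarrow> y \<in> e \<Longrightarrow> P x \<Longrightarrow> P y"
  shows "P v"
  using assms(1)[unfolded R_def connected_rel_def]
proof (induction rule: rtrancl_induct)
  case base
  show ?case by (rule assms(2))
next
  case (step y z)
  then show ?case using assms(3)[of "{y, z}" y z] by auto
qed

lemma R_V: "(u, v) \<in> R \<Longrightarrow> u \<in> V \<Longrightarrow> v \<in> V"
  by (erule R_induct[where P = "\<lambda>v. v \<in> V"]) (use edge_E(1) in blast)+

lemma upper_image:
  assumes "S \<subseteq> vertices k"
  shows "(Top, p) \<in> upper ` S \<longleftrightarrow> (Top, p) \<in> S"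
    "(Middle, p) \<in> upper ` S \<longleftrightarrow> (Bottom, p) \<in> S"
    "(Bottom, p) \<notin> upper ` S"
  using assms by (force simp: vertices_def image_iff split: if_splits)+

lemma lower_image:
  assumes "S \<subseteq> vertices k"
  shows "(Top, p) \<notin> lower ` S"
    "(Middle, p) \<in> lower ` S \<longleftrightarrow> (Top, p) \<in> S"
    "(Bottom, p) \<in> lower ` S \<longleftrightarrow> (Bottom, p) \<in> S"
  using assms by (force simp: vertices_def image_iff split: if_splits)+

lemma vdeg_eq: "vdeg v = card {e \<in> d1. v \<in> upper ` e} + card {e \<in> d2. v \<in> lower ` e}"
  unfolding vdeg_def vertex_degree_def E_def stack_def filter_union_mset size_union
    filter_mset_image_mset size_image_mset
  by (simp only: filter_mset_mset_set finite_d size_mset_set)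

lemma vdeg_Top: "vdeg (Top, p) = of_bool ((Top, p) \<in> \<Union> d1)"
proof -
  have "{e \<in> d1. (Top, p) \<in> upper ` e} = {e \<in> d1. (Top, p) \<in> e}"
    using upper_image(1)[OF matchingD(1)[OF d1]] by blast
  moreover have "{e \<in> d2. (Top, p) \<in> lower ` e} = {}"
    using lower_image(1)[OF matchingD(1)[OF d2]] by blast
  ultimately show ?thesis
    unfolding vdeg_eq by (simp only: card_matching_star[OF d1] card.empty add_0_right)
qed

lemma vdeg_Bottom: "vdeg (Bottom, p) = of_bool ((Bottom, p) \<in> \<Union> d2)"
proof -
  have "{e \<in> d2. (Bottom, p) \<in> lower ` e} = {e \<in> d2. (Bottom, p) \<in> e}"
    using lower_image(3)[OF matchingD(1)[OF d2]] by blast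
  moreover have "{e \<in> d1. (Bottom, p) \<in> upper ` e} = {}"
    using upper_image(3)[OF matchingD(1)[OF d1]] by blast
  ultimately show ?thesis
    unfolding vdeg_eq by (simp only: card_matching_star[OF d2] card.empty add_0)
qed

lemma vdeg_Middle:
  "vdeg (Middle, p) = of_bool ((Bottom, p) \<in> \<Union> d1) + of_bool ((Top, p) \<in> \<Union> d2)"
proof -
  have "{e \<in> d1. (Middle, p) \<in> upper ` e} = {e \<in> d1. (Bottom, p) \<in> e}"
    using upper_image(2)[OF matchingD(1)[OF d1]] by blast
  moreover have "{e \<in> d2. (Middle, p) \<in> lower ` e} = {e \<in> d2. (Top, p) \<in> e}"
    using lower_image(2)[OF matchingD(1)[OF d2]] by blast
  ultimately show ?thesis
    unfolding vdeg_eq by (simp only: card_matching_star[OF d1] card_matching_star[OF d2])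
qed

lemma dead_iff:
  "(Top, p) \<in> dead \<longleftrightarrow> p \<in> {1..k} \<and> (Top, p) \<notin> \<Union> d1"
  "(Bottom, p) \<in> dead \<longleftrightarrow> p \<in> {1..k} \<and> (Bottom, p) \<notin> \<Union> d2"
  "(Middle, p) \<in> dead \<longleftrightarrow> p \<in> {1..k} \<and> ((Bottom, p) \<notin> \<Union> d1 \<or> (Top, p) \<notin> \<Union> d2)"
  unfolding dead_def Un_iff upper_image[OF Diff_subset] lower_image[OF Diff_subset]
  by (auto simp: vertices_def upper_image(3)[OF Diff_subset, unfolded vertices_def]
      lower_image(1)[OF Diff_subset, unfolded vertices_def])

lemma vdeg_le_2: "vdeg v \<le> 2"
  by (cases v; cases "fst v") (auto simp: vdeg_Top vdeg_Middle vdeg_Bottom)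

lemma vdeg_outer: "v \<in> vertices k \<Longrightarrow> vdeg v \<le> 1"
  by (auto simp: vertices_def vdeg_Top vdeg_Bottom)

lemma dead_outer: "v \<in> vertices k \<Longrightarrow> v \<in> dead \<longleftrightarrow> vdeg v = 0"
  by (auto simp: vertices_def vdeg_Top vdeg_Bottom dead_iff)

lemma dead_middle: "v \<in> {Middle} \<times> {1..k} \<Longrightarrow> v \<in> dead \<longleftrightarrow> vdeg v \<noteq> 2"
proof -
  assume "v \<in> {Middle} \<times> {1..k}"
  then obtain p where p: "v = (Middle, p)" "p \<in> {1..k}" by blast
  have two: "of_bool P + of_bool Q \<noteq> (2 :: nat) \<longleftrightarrow> \<not> P \<or> \<not> Q" for P Q
    by (cases P; cases Q) auto
  show ?thesis unfolding p(1) vdeg_Middle dead_iff two using p(2) by blast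
qed

text \<open>A component is a path or a cycle: it has two free ends or none.\<close>

lemma component_ends:
  assumes u: "u \<in> V"
  shows "even (\<Sum>v\<in>R `` {u}. 2 - vdeg v)" "(\<Sum>v\<in>R `` {u}. 2 - vdeg v) \<le> 2"
proof -
  let ?C = "R `` {u}"
  have "?C \<subseteq> V" using R_V u by blast
  then have fin: "finite ?C" using finite_V finite_subset by blast
  have "card e = 2 \<and> (e \<subseteq> ?C \<or> e \<inter> ?C = {})" if "e \<in># E" for e
    using edge_E(2)[OF that] R_edge_mem[OF that] R_trans by blast
  then have hs: "(\<Sum>v\<in>?C. vdeg v) = 2 * size {#e \<in># E. e \<subseteq> ?C#}"
    unfolding vdeg_def by (rule handshake[OF fin])
  have "(\<Sum>v\<in>?C. 2 - vdeg v) + (\<Sum>v\<in>?C. vdeg v) = (\<Sum>v\<in>?C. 2)"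
    unfolding sum.distrib[symmetric] using vdeg_le_2 by (intro sum.cong) auto
  \<comment> \<open>\<open>2 - vdeg v\<close> is the number of free ends at \<open>v\<close>. The
    total is twice the vertices minus twice the edges: it is even, and at most 2 by the spanning
    tree bound.\<close>
  then have eq: "(\<Sum>v\<in>?C. 2 - vdeg v) + 2 * size {#e \<in># E. e \<subseteq> ?C#} = 2 * card ?C"
    using hs by simp
  then show "even (\<Sum>v\<in>?C. 2 - vdeg v)"
    by (metis dvd_add_left_iff dvd_triv_left)
  have "card ?C \<le> size {#e \<in># E. e \<subseteq> ?C#} + 1"
    by (rule connected_card_le_edges[OF fin]) (simp add: R_def)
  then show "(\<Sum>v\<in>?C. 2 - vdeg v) \<le> 2" using eq by linarith
qed

lemma component_ends_subset:
  assumes u: "u \<in> V" and S: "S \<subseteq> R `` {u}"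
  shows "(\<Sum>v\<in>S. 2 - vdeg v) \<le> 2"
proof -
  have "finite (R `` {u})" using R_V u finite_subset[OF _ finite_V] by blast
  then have "(\<Sum>v\<in>S. 2 - vdeg v) \<le> (\<Sum>v\<in>R `` {u}. 2 - vdeg v)"
    by (rule sum_mono2[OF _ S]) simp
  then show ?thesis using component_ends(2)[OF u] by linarith
qed

text \<open>Outer vertices have degree at most 1, so two of them use up both free ends of the path.
  Every other vertex of the component has degree 2, hence is a middle vertex and not dead.\<close>

lemma two_outer:
  assumes u: "u \<in> vertices k" and w: "w \<in> vertices k" "w \<noteq> u" "(u, w) \<in> R" and v: "(u, v) \<in> R"
  shows "v \<notin> dead" "v \<in> vertices k \<Longrightarrow> v = u \<or> v = w"
proof -
  have uV: "u \<in> V" using u vertices_subset_V by blast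
  have d: "vdeg u \<le> 1" "vdeg w \<le> 1" using vdeg_outer u w(1) by auto
  have "(\<Sum>x\<in>{u, w}. 2 - vdeg x) \<le> 2"
    using component_ends_subset[OF uV, of "{u, w}"] R_refl w(3) by blast
  then have "vdeg u = 1 \<and> vdeg w = 1" using d w(2) by auto
  then have dd: "vdeg u = 1" "vdeg w = 1" by auto
  have v2: "vdeg v = 2" if "v \<noteq> u" "v \<noteq> w"
  proof -
    have "(\<Sum>x\<in>{u, w, v}. 2 - vdeg x) \<le> 2"
      using component_ends_subset[OF uV, of "{u, w, v}"] R_refl w(3) v by blast
    then show ?thesis using d w(2) that vdeg_le_2[of v] by auto
  qed
  show outer: "v = u \<or> v = w" if "v \<in> vertices k"
    using v2 vdeg_outer[OF that] by force
  show "v \<notin> dead"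
  proof (cases "v = u \<or> v = w")
    case True
    then show ?thesis using dead_outer[OF u] dead_outer[OF w(1)] dd by (elim disjE) simp_all
  next
    case False
    then have "v \<in> {Middle} \<times> {1..k}" using outer V_cases[OF R_V[OF v uV]] by blast
    then show ?thesis using dead_middle v2 False by blast
  qed
qed

text \<open>Parity: unless \<open>u\<close> itself is dead it supplies exactly one free end, and the
  number of free ends is even. The other one must sit at a middle vertex of degree below 2, which is
  dead.\<close>

lemma one_outer:
  assumes u: "u \<in> vertices k" and only: "\<And>w. w \<in> vertices k \<Longrightarrow> (u, w) \<in> R \<Longrightarrow> w = u"
  shows "\<exists>v\<in>dead. (u, v) \<in> R"
proof (rule ccontr)
  assume no: "\<not> (\<exists>v\<in>dead. (u, v) \<in> R)"
  have uV: "u \<in> V" using u vertices_subset_V by blast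
  have fin: "finite (R `` {u})" using R_V uV finite_subset[OF _ finite_V] by blast
  have "2 - vdeg v = (if v = u then 1 else 0)" if v: "v \<in> R `` {u}" for v
  proof (cases "v = u")
    case True
    then have "vdeg v \<noteq> 0" using no dead_outer[OF u] R_refl by blast
    then show ?thesis using True vdeg_outer[OF u] by simp
  next
    case False
    have vR: "(u, v) \<in> R" using v by blast
    then have "v \<in> {Middle} \<times> {1..k}" using False only V_cases[OF R_V[OF vR uV]] by blast
    then have "vdeg v = 2" using dead_middle no vR by blast
    then show ?thesis using False by simp
  qed
  then have "(\<Sum>v\<in>R `` {u}. 2 - vdeg v) = (\<Sum>v\<in>R `` {u}. if v = u then 1 else 0)"
    by (rule sum.cong[OF refl])
  also have "\<dots> = 1" using fin R_refl by (simp add: sum.delta)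
  finally show False using component_ends(1)[OF uV] by simp
qed

section \<open>The composite diagram and compatible labelings\<close>

definition d3 :: "diagram" where "d3 = diagram_comp k d1 d2"

lemma d3_eq: "d3 = {{u, v} | u v. u \<in> vertices k \<and> v \<in> vertices k \<and> u \<noteq> v \<and> (u, v) \<in> R}"
  by (simp add: d3_def diagram_comp_def R_def E_def)

lemma d3_I: "u \<in> vertices k \<Longrightarrow> v \<in> vertices k \<Longrightarrow> u \<noteq> v \<Longrightarrow> (u, v) \<in> R \<Longrightarrow> {u, v} \<in> d3"
  unfolding d3_eq by (rule CollectI, rule exI[of _ u], rule exI[of _ v]) simp

lemma d3_edge:
  assumes "e \<in> d3" "u \<in> e"
  shows "\<exists>v. e = {u, v} \<and> u \<in> vertices k \<and> v \<in> vertices k \<and> v \<noteq> u \<and> (u, v) \<in> R"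
proof -
  obtain a b where ab: "e = {a, b}" "a \<in> vertices k" "b \<in> vertices k" "a \<noteq> b" "(a, b) \<in> R"
    using assms(1) unfolding d3_eq by blast
  show ?thesis
  proof (cases "u = a")
    case True
    then show ?thesis using ab by blast
  next
    case False
    then have "u = b" using assms(2) ab(1) by blast
    then show ?thesis using ab R_sym[OF ab(5)] by (intro exI[of _ a]) auto
  qed
qed

text \<open>By \<open>two_outer\<close> a component contains at most two outer vertices, so two
  edges with a common vertex coincide.\<close>

lemma d3_matching: "d3 \<in> matchings (vertices k)"
proof -
  have "e \<subseteq> vertices k \<and> card e = 2" if "e \<in> d3" for e
    using that unfolding d3_eq by auto
  moreover have "e = e'" if e: "e \<in> d3" "e' \<in> d3" "x \<in> e" "x \<in> e'" for e e' x
  proof -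
    obtain v where v: "e = {x, v}" "x \<in> vertices k" "v \<in> vertices k" "v \<noteq> x" "(x, v) \<in> R"
      using d3_edge[OF e(1,3)] by blast
    obtain w where w: "e' = {x, w}" "w \<in> vertices k" "w \<noteq> x" "(x, w) \<in> R"
      using d3_edge[OF e(2,4)] by blast
    have "w = v" using two_outer(2)[OF v(2,3,4,5) w(4,2)] w(3) by blast
    then show ?thesis by (simp add: v(1) w(1))
  qed
  ultimately show ?thesis unfolding matchings_def by blast
qed

text \<open>The condition, on a labeling of all three rows, that both diagrams have weight
  1.\<close>

definition good :: "(vertex \<Rightarrow> nat) \<Rightarrow> bool" where
  "good l \<longleftrightarrow> (\<forall>e\<in>#E. \<forall>u\<in>e. \<forall>v\<in>e. l u = l v) \<and> (\<forall>v\<in>dead. l v = 0)"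

definition full_label :: "index \<Rightarrow> index \<Rightarrow> index \<Rightarrow> vertex \<Rightarrow> nat" where
  "full_label i j m v = (case fst v of Top \<Rightarrow> j | Middle \<Rightarrow> m | Bottom \<Rightarrow> i) (snd v)"

lemma dead_V: "dead \<subseteq> V"
  by (auto simp: dead_def vertices_def V_def)

lemma good_cong:
  assumes "\<And>v. v \<in> V \<Longrightarrow> l v = l' v"
  shows "good l \<longleftrightarrow> good l'"
proof -
  have "l u = l v \<longleftrightarrow> l' u = l' v" if "e \<in># E" "u \<in> e" "v \<in> e" for e u v
  proof -
    have "l u = l' u" "l v = l' v" using assms edge_E(1)[OF that(1)] that(2,3) by blast+
    then show ?thesis by simp
  qed
  moreover have "l v = 0 \<longleftrightarrow> l' v = 0" if "v \<in> dead" for v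
    using assms[of v] dead_V that by auto
  ultimately show ?thesis unfolding good_def by (intro conj_cong ball_cong refl) blast+
qed

lemma good_const:
  assumes l: "good l" and R: "(u, v) \<in> R"
  shows "l u = l v"
proof (rule R_induct[OF R, where P = "\<lambda>v. l u = l v"])
  fix x y e assume "e \<in># E" "x \<in> e" "y \<in> e" "l u = l x"
  moreover have "l x = l y" using l calculation(1-3) unfolding good_def by blast
  ultimately show "l u = l y" by (rule_tac trans)
qed (rule refl)

lemma vertex_label_full:
  assumes "v \<in> vertices k"
  shows "vertex_label m j v = full_label i j m (upper v)"
    "vertex_label i m v = full_label i j m (lower v)"
    "vertex_label i j v = full_label i j m v"
  using assms by (auto simp: vertices_def full_label_def)

text \<open>The middle row is the bottom row of \<open>d1\<close> and the top row of
  \<open>d2\<close>; hence \<open>m\<close> is the column index in the first factor and the row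
  index in the second.\<close>

lemma diagram_weights_good:
  "diagram_weight k d1 m j * diagram_weight k d2 i m = of_bool (good (full_label i j m))"
proof -
  let ?l = "full_label i j m"
  let ?A = "\<forall>e\<in>d1. \<forall>u\<in>e. \<forall>v\<in>e. vertex_label m j u = vertex_label m j v"
  let ?B = "\<forall>e\<in>d2. \<forall>u\<in>e. \<forall>v\<in>e. vertex_label i m u = vertex_label i m v"
  let ?A' = "\<forall>e\<in>d1. \<forall>u\<in>e. \<forall>v\<in>e. ?l (upper u) = ?l (upper v)"
  let ?B' = "\<forall>e\<in>d2. \<forall>u\<in>e. \<forall>v\<in>e. ?l (lower u) = ?l (lower v)"
  let ?C = "\<forall>v\<in>vertices k - \<Union> d1. vertex_label m j v = 0"
  let ?D = "\<forall>v\<in>vertices k - \<Union> d2. vertex_label i m v = 0"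
  have up: "vertex_label m j u = ?l (upper u)" if "e \<in> d1" "u \<in> e" for e u
    using vertex_label_full(1) matchingD(1)[OF d1 that(1)] that(2) by blast
  have lo: "vertex_label i m u = ?l (lower u)" if "e \<in> d2" "u \<in> e" for e u
    using vertex_label_full(2) matchingD(1)[OF d2 that(1)] that(2) by blast
  have A: "?A \<longleftrightarrow> ?A'" by (intro ball_cong refl) (simp add: up)
  have B: "?B \<longleftrightarrow> ?B'" by (intro ball_cong refl) (simp add: lo)
  have C: "?C \<longleftrightarrow> (\<forall>v\<in>vertices k - \<Union> d1. ?l (upper v) = 0)"
    using vertex_label_full(1)[of _ m j i] by (intro ball_cong refl) (metis DiffD1)
  have D: "?D \<longleftrightarrow> (\<forall>v\<in>vertices k - \<Union> d2. ?l (lower v) = 0)"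
    using vertex_label_full(2)[of _ i m j] by (intro ball_cong refl) (metis DiffD1)
  have "(\<forall>e\<in>#E. \<forall>u\<in>e. \<forall>v\<in>e. ?l u = ?l v) \<longleftrightarrow> ?A' \<and> ?B'"
  proof
    assume L: "\<forall>e\<in>#E. \<forall>u\<in>e. \<forall>v\<in>e. ?l u = ?l v"
    have "?l (upper u) = ?l (upper v)" if "e \<in> d1" "u \<in> e" "v \<in> e" for e u v
    proof -
      have "upper ` e \<in># E" using that(1) mem_E by blast
      from L[rule_format, OF this] show ?thesis using that(2,3) by blast
    qed
    moreover have "?l (lower u) = ?l (lower v)" if "e \<in> d2" "u \<in> e" "v \<in> e" for e u v
    proof -
      have "lower ` e \<in># E" using that(1) mem_E by blast
      from L[rule_format, OF this] show ?thesis using that(2,3) by blast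
    qed
    ultimately show "?A' \<and> ?B'" by blast
  next
    assume AB: "?A' \<and> ?B'"
    show "\<forall>e\<in>#E. \<forall>u\<in>e. \<forall>v\<in>e. ?l u = ?l v"
    proof (intro ballI)
      fix e u v assume e: "e \<in># E" "u \<in> e" "v \<in> e"
      from e(1) consider e' where "e' \<in> d1" "e = upper ` e'" | e' where "e' \<in> d2" "e = lower ` e'"
        unfolding mem_E by blast
      then show "?l u = ?l v"
      proof cases
        case 1
        then obtain a b where ab: "a \<in> e'" "b \<in> e'" "u = upper a" "v = upper b" using e(2,3) by blast
        show ?thesis unfolding ab(3,4) by (rule conjunct1[OF AB, rule_format, OF 1(1) ab(1,2)])
      next
        case 2
        then obtain a b where ab: "a \<in> e'" "b \<in> e'" "u = lower a" "v = lower b" using e(2,3) by blast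
        show ?thesis unfolding ab(3,4) by (rule conjunct2[OF AB, rule_format, OF 2(1) ab(1,2)])
      qed
    qed
  qed
  moreover have "(\<forall>v\<in>dead. ?l v = 0) \<longleftrightarrow> ?C \<and> ?D"
    unfolding C D dead_def by (simp only: ball_Un ball_simps)
  ultimately have "good ?l \<longleftrightarrow> (?A' \<and> ?B') \<and> (?C \<and> ?D)"
    unfolding good_def by (rule arg_cong2)
  then have good: "good ?l \<longleftrightarrow> (?A \<and> ?B) \<and> (?C \<and> ?D)"
    unfolding A[symmetric] B[symmetric] .
  \<comment> \<open>Only a regrouping: \<open>good\<close> collects the conditions by kind, the
    product of weights collects them by diagram.\<close>
  have "(g \<longleftrightarrow> (a \<and> b) \<and> (c \<and> d)) \<Longrightarrow> ((a \<and> c) \<and> (b \<and> d)) = g" for a b c d g :: bool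
    by blast
  from this[OF good] show ?thesis
    unfolding diagram_weight_eq matching_weight_eq[OF finite_vertices d1] matching_weight_eq[OF finite_vertices d2]
      of_bool_conj[symmetric] by (rule arg_cong)
qed

text \<open>Good labelings are constant on components. An outer vertex isolated in \<open>d3\<close>
  is the only outer vertex of its component, so by \<open>one_outer\<close> it is connected to a
  dead vertex and carries \<open>0\<close>.\<close>

lemma d3_weight_good:
  assumes l: "good (full_label i j m)"
  shows "diagram_weight k d3 i j = 1"
proof -
  let ?l = "full_label i j m"
  have "vertex_label i j u = vertex_label i j v" if e: "e \<in> d3" "u \<in> e" "v \<in> e" for e u v
  proof -
    obtain w where w: "e = {u, w}" "u \<in> vertices k" "w \<in> vertices k" "(u, w) \<in> R"
      using d3_edge[OF e(1,2)] by blast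
    have "v \<in> {u, w}" using e(3) w(1) by simp
    then have v: "v \<in> vertices k" "(u, v) \<in> R" using w R_refl[of u] by blast+
    show ?thesis
      using vertex_label_full(3)[OF w(2)] vertex_label_full(3)[OF v(1)] good_const[OF l v(2)] by simp
  qed
  moreover have "vertex_label i j v = 0" if v: "v \<in> vertices k - \<Union> d3" for v
  proof -
    have "w = v" if "w \<in> vertices k" "(v, w) \<in> R" for w
    proof (rule ccontr)
      assume "w \<noteq> v"
      then have "{v, w} \<in> d3" using v that by (intro d3_I) auto
      then show False using v by blast
    qed
    then obtain w where w: "w \<in> dead" "(v, w) \<in> R" using one_outer[of v] v by blast
    have "?l w = 0" using l w(1) unfolding good_def by blast
    then have "?l v = 0" using good_const[OF l w(2)] by simp
    then show ?thesis using vertex_label_full(3)[of v i j m] v by simp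
  qed
  ultimately have "(\<forall>e\<in>d3. \<forall>u\<in>e. \<forall>v\<in>e. vertex_label i j u = vertex_label i j v) \<and>
      (\<forall>v\<in>vertices k - \<Union> d3. vertex_label i j v = 0)" by blast
  then show ?thesis
    unfolding diagram_weight_eq matching_weight_eq[OF finite_vertices d3_matching] of_bool_eq_1_iff .
qed

section \<open>Closed loops and the count of middle labelings\<close>

definition loop_set :: "vertex set set" where
  "loop_set = {C \<in> components k (stack d1 d2).
     C \<subseteq> {Middle} \<times> {1..k} \<and> (\<forall>v\<in>C. vertex_degree (stack d1 d2) v = 2)}"

lemma loop_setD:
  assumes "C \<in> loop_set"
  shows "C \<subseteq> {Middle} \<times> {1..k}" "v \<in> C \<Longrightarrow> vdeg v = 2" "v \<in> C \<Longrightarrow> R `` {v} = C" "C \<noteq> {}"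
proof -
  show "C \<subseteq> {Middle} \<times> {1..k}" "v \<in> C \<Longrightarrow> vdeg v = 2"
    using assms by (auto simp: loop_set_def vdeg_def E_def)
  obtain u where u: "C = R `` {u}"
    using assms by (auto simp: loop_set_def components_def quotient_def R_def E_def)
  then show "v \<in> C \<Longrightarrow> R `` {v} = C" using R_class_eq[of u v] by blast
  show "C \<noteq> {}" using u R_refl by blast
qed

lemma loop_setI:
  assumes v: "v \<in> V" and C: "R `` {v} \<inter> vertices k = {}" "R `` {v} \<inter> dead = {}"
  shows "R `` {v} \<in> loop_set"
proof -
  have mid: "w \<in> {Middle} \<times> {1..k}" if "w \<in> R `` {v}" for w
    using V_cases[OF R_V[of v w]] that v C(1) by blast
  moreover have "vdeg w = 2" if "w \<in> R `` {v}" for w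
    using dead_middle[OF mid[OF that]] that C(2) by blast
  moreover have "R `` {v} \<in> components k (stack d1 d2)"
    using v by (auto simp: components_def quotient_def R_def E_def V_def)
  ultimately show ?thesis unfolding loop_set_def vdeg_def E_def by blast
qed

lemma loops_eq: "loops k d1 d2 = card loop_set"
  by (simp add: loops_def loop_set_def)

lemma finite_loop_set: "finite loop_set"
  by (rule finite_subset[of _ "Pow ({Middle} \<times> {1..k})"]) (use loop_setD(1) in blast, simp)

text \<open>The label each component must carry once the outer rows are fixed. A component with no
  outer vertex that is not a loop contains a dead vertex, whence the value \<open>0\<close>; on a
  loop nothing is imposed and \<open>c\<close> is free.\<close>

definition comp_label :: "index \<Rightarrow> index \<Rightarrow> (vertex set \<Rightarrow> nat) \<Rightarrow> vertex set \<Rightarrow> nat" where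
  "comp_label i j c C = (if C \<in> loop_set then c C
     else if C \<inter> vertices k \<noteq> {} then vertex_label i j (SOME u. u \<in> C \<inter> vertices k) else 0)"

lemma comp_label_simps:
  "C \<in> loop_set \<Longrightarrow> comp_label i j c C = c C"
  "C \<notin> loop_set \<Longrightarrow> C \<inter> vertices k \<noteq> {} \<Longrightarrow>
    comp_label i j c C = vertex_label i j (SOME u. u \<in> C \<inter> vertices k)"
  "C \<notin> loop_set \<Longrightarrow> C \<inter> vertices k = {} \<Longrightarrow> comp_label i j c C = 0"
  unfolding comp_label_def by (simp_all only: if_True if_False simp_thms)

lemma some_outer: "C \<inter> vertices k \<noteq> {} \<Longrightarrow> (SOME u. u \<in> C \<inter> vertices k) \<in> C \<inter> vertices k"
  by (rule someI_ex) blast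

lemma comp_label_outer:
  assumes w: "diagram_weight k d3 i j = 1" and v: "v \<in> vertices k"
  shows "comp_label i j c (R `` {v}) = vertex_label i j v"
proof -
  let ?C = "R `` {v}" and ?u = "SOME u. u \<in> R `` {v} \<inter> vertices k"
  have ne: "?C \<inter> vertices k \<noteq> {}" using v R_refl by blast
  have u: "(v, ?u) \<in> R" "?u \<in> vertices k" using some_outer[OF ne] by blast+
  have nl: "?C \<notin> loop_set"
  proof
    assume "?C \<in> loop_set"
    then have "v \<in> {Middle} \<times> {1..k}" using loop_setD(1) R_refl by blast
    then show False using v by (auto simp: vertices_def)
  qed
  have "vertex_label i j ?u = vertex_label i j v"
  proof (cases "?u = v")
    case False
    have edge: "{v, ?u} \<in> d3" by (rule d3_I[OF v u(2) _ u(1)]) (use False in simp)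
    have "\<forall>e\<in>d3. \<forall>u\<in>e. \<forall>v\<in>e. vertex_label i j u = vertex_label i j v"
      using w unfolding diagram_weight_eq matching_weight_eq[OF finite_vertices d3_matching]
        of_bool_eq_1_iff by (rule conjunct1)
    from this[rule_format, OF edge, of ?u v] show ?thesis by blast
  qed simp
  then show ?thesis unfolding comp_label_simps(2)[OF nl ne] .
qed

text \<open>If the component of a dead vertex contains an outer vertex, that vertex is isolated in
  \<open>d3\<close> by \<open>two_outer\<close>, and the weight of \<open>d3\<close> forces its
  label to be \<open>0\<close>.\<close>

lemma comp_label_dead:
  assumes w: "diagram_weight k d3 i j = 1" and v: "v \<in> dead"
  shows "comp_label i j c (R `` {v}) = 0"
proof -
  let ?C = "R `` {v}" and ?u = "SOME u. u \<in> R `` {v} \<inter> vertices k"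
  have nl: "?C \<notin> loop_set"
  proof
    assume C: "?C \<in> loop_set"
    then have "v \<in> {Middle} \<times> {1..k}" "vdeg v = 2" using loop_setD(1,2)[OF C] R_refl by blast+
    then show False using dead_middle v by blast
  qed
  show ?thesis
  proof (cases "?C \<inter> vertices k = {}")
    case False
    have u: "(v, ?u) \<in> R" "?u \<in> vertices k" using some_outer[OF False] by blast+
    have "?u \<notin> \<Union> d3"
    proof
      assume "?u \<in> \<Union> d3"
      then obtain e where "e \<in> d3" "?u \<in> e" by blast
      then obtain x where x: "x \<in> vertices k" "x \<noteq> ?u" "(?u, x) \<in> R" using d3_edge by blast
      show False using two_outer(1)[OF u(2) x R_sym[OF u(1)]] v by blast
    qed
    moreover have "\<forall>v\<in>vertices k - \<Union> d3. vertex_label i j v = 0"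
      using w unfolding diagram_weight_eq matching_weight_eq[OF finite_vertices d3_matching]
        of_bool_eq_1_iff by (rule conjunct2)
    ultimately have "vertex_label i j ?u = 0" using u(2) by blast
    then show ?thesis unfolding comp_label_simps(2)[OF nl False] .
  qed (rule comp_label_simps(3)[OF nl])
qed

text \<open>
  A good middle labeling is determined by the outer labels except on the closed loops, where it
  is an arbitrary constant.
\<close>

lemma card_good:
  assumes w: "diagram_weight k d3 i j = 1" and i: "i \<in> indices n k" and j: "j \<in> indices n k"
  shows "card {m \<in> indices n k. good (full_label i j m)} = (n + 1) ^ loops k d1 d2"
proof -
  define \<Phi> where "\<Phi> c = (\<lambda>p\<in>{1..k}. comp_label i j c (R `` {(Middle, p)}))" for c
  define \<Psi> where "\<Psi> m = (\<lambda>C\<in>loop_set. m (SOME p. (Middle, p) \<in> C))" for m :: index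
  let ?G = "{m \<in> indices n k. good (full_label i j m)}"
  have some_p: "(Middle, SOME p. (Middle, p) \<in> C) \<in> C" if C: "C \<in> loop_set" for C
  proof -
    obtain v where v: "v \<in> C" using loop_setD(4)[OF C] by blast
    then obtain p where "v = (Middle, p)" using loop_setD(1)[OF C] by blast
    then have "\<exists>p. (Middle, p) \<in> C" using v by blast
    then show ?thesis by (rule someI_ex)
  qed
  have some_p_range: "(SOME p. (Middle, p) \<in> C) \<in> {1..k}" if C: "C \<in> loop_set" for C
    using subsetD[OF loop_setD(1)[OF C] some_p[OF C]] by (rule SigmaD2)
  have label_range: "vertex_label i j v \<in> {0..n}" if "v \<in> vertices k" for v
  proof -
    obtain lv p where v: "v = (lv, p)" by (cases v)
    have "p \<in> {1..k}" using that v by (auto simp: vertices_def)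
    then have "i p \<in> {0..n}" "j p \<in> {0..n}"
      by (rule PiE_mem[OF i[unfolded indices_def]], rule PiE_mem[OF j[unfolded indices_def]])
    then show ?thesis by (simp add: v)
  qed
  have comp_range: "comp_label i j c C \<in> {0..n}" if c: "c \<in> loop_set \<rightarrow>\<^sub>E {0..n}" for c C
  proof -
    have "c C \<in> {0..n}" if "C \<in> loop_set" using PiE_mem[OF c that] .
    moreover have "vertex_label i j (SOME u. u \<in> C \<inter> vertices k) \<in> {0..n}" if "C \<inter> vertices k \<noteq> {}"
      using label_range some_outer[OF that] by blast
    ultimately show ?thesis
      using comp_label_simps[of C i j c]
      by (cases "C \<in> loop_set"; cases "C \<inter> vertices k = {}") (simp_all only:, simp_all)
  qed
  have full: "full_label i j (\<Phi> c) v = comp_label i j c (R `` {v})" if v: "v \<in> V" for c v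
  proof (cases "v \<in> vertices k")
    case True
    show ?thesis unfolding comp_label_outer[OF w True] by (rule vertex_label_full(3)[OF True, symmetric])
  next
    case False
    then obtain p where "v = (Middle, p)" "p \<in> {1..k}" using V_cases[OF v] by blast
    then show ?thesis by (simp add: full_label_def \<Phi>_def)
  qed
  have good_\<Phi>: "good (full_label i j (\<Phi> c))" for c
  proof -
    have "good (\<lambda>v. comp_label i j c (R `` {v}))"
      unfolding good_def
    proof (intro conjI ballI)
      fix e u v assume "e \<in># E" "u \<in> e" "v \<in> e"
      then have "R `` {u} = R `` {v}" using R_class_eq R_edge_mem by blast
      then show "comp_label i j c (R `` {u}) = comp_label i j c (R `` {v})" by (rule arg_cong)
    qed (rule comp_label_dead[OF w])
    then show ?thesis
      using good_cong[of "full_label i j (\<Phi> c)" "\<lambda>v. comp_label i j c (R `` {v})", OF full] by blast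
  qed
  have \<Phi>_in: "\<Phi> c \<in> indices n k" if c: "c \<in> loop_set \<rightarrow>\<^sub>E {0..n}" for c
    unfolding indices_def
  proof (rule PiE_I)
    fix p assume p: "p \<in> {1..k}"
    show "\<Phi> c p \<in> {0..n}"
      unfolding \<Phi>_def restrict_apply'[OF p] by (rule comp_range[OF c])
  next
    fix p assume p: "p \<notin> {1..k}"
    show "\<Phi> c p = undefined" unfolding \<Phi>_def restrict_def by (simp only: p if_False)
  qed
  have \<Psi>_in: "\<Psi> m \<in> loop_set \<rightarrow>\<^sub>E {0..n}" if m: "m \<in> indices n k" for m
  proof (rule PiE_I)
    fix C assume C: "C \<in> loop_set"
    show "\<Psi> m C \<in> {0..n}"
      unfolding \<Psi>_def restrict_apply'[OF C] by (rule PiE_mem[OF m[unfolded indices_def] some_p_range[OF C]])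
  next
    fix C assume C: "C \<notin> loop_set"
    show "\<Psi> m C = undefined" unfolding \<Psi>_def restrict_def by (simp only: C if_False)
  qed
  have "bij_betw \<Phi> (loop_set \<rightarrow>\<^sub>E {0..n}) ?G"
  proof (rule bij_betw_byWitness[where f' = \<Psi>])
    show "\<forall>c\<in>loop_set \<rightarrow>\<^sub>E {0..n}. \<Psi> (\<Phi> c) = c"
    proof (intro ballI ext)
      fix c C assume c: "c \<in> loop_set \<rightarrow>\<^sub>E {0..n}"
      show "\<Psi> (\<Phi> c) C = c C"
      proof (cases "C \<in> loop_set")
        case True
        let ?p = "SOME p. (Middle, p) \<in> C"
        have "\<Psi> (\<Phi> c) C = \<Phi> c ?p" using True by (simp add: \<Psi>_def)
        also have "\<dots> = comp_label i j c (R `` {(Middle, ?p)})"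
          using some_p_range[OF True] unfolding \<Phi>_def by (rule restrict_apply')
        also have "R `` {(Middle, ?p)} = C" by (rule loop_setD(3)[OF True some_p[OF True]])
        also have "comp_label i j c C = c C" by (rule comp_label_simps(1)[OF True])
        finally show ?thesis .
      next
        case False
        then show ?thesis using PiE_arb[OF c False] by (simp add: \<Psi>_def)
      qed
    qed
    show "\<forall>m\<in>?G. \<Phi> (\<Psi> m) = m"
    proof (intro ballI ext)
      fix m p assume "m \<in> ?G"
      then have m: "m \<in> {1..k} \<rightarrow>\<^sub>E {0..n}" and l: "good (full_label i j m)"
        unfolding indices_def by auto
      let ?l = "full_label i j m" and ?C = "R `` {(Middle, p)}"
      have mid: "?l (Middle, q) = m q" for q by (simp add: full_label_def)
      show "\<Phi> (\<Psi> m) p = m p"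
      proof (cases "p \<in> {1..k}")
        case True
        then have V: "(Middle, p) \<in> V" by (simp add: V_def)
        have "comp_label i j (\<Psi> m) ?C = m p"
        proof (cases "?C \<in> loop_set")
          case loop: True
          have "?l (Middle, p) = ?l (Middle, SOME q. (Middle, q) \<in> ?C)"
            by (rule good_const[OF l]) (use some_p[OF loop] in blast)
          then show ?thesis unfolding mid comp_label_simps(1)[OF loop] \<Psi>_def
            using loop by (simp only: restrict_apply')
        next
          case no_loop: False
          show ?thesis
          proof (cases "?C \<inter> vertices k = {}")
            case True
            then have "?C \<inter> dead \<noteq> {}" using loop_setI[OF V True] no_loop by blast
            then obtain v where v: "v \<in> dead" "((Middle, p), v) \<in> R" by blast
            have "?l v = 0" using l v(1) unfolding good_def by blast
            then have "m p = 0" using good_const[OF l v(2)] mid by simp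
            then show ?thesis unfolding comp_label_simps(3)[OF no_loop True] by (rule sym)
          next
            case False
            let ?u = "SOME u. u \<in> ?C \<inter> vertices k"
            have u: "((Middle, p), ?u) \<in> R" "?u \<in> vertices k" using some_outer[OF False] by blast+
            have "vertex_label i j ?u = ?l ?u" by (rule vertex_label_full(3)[OF u(2)])
            also have "\<dots> = m p" using good_const[OF l u(1)] mid by simp
            finally show ?thesis unfolding comp_label_simps(2)[OF no_loop False] .
          qed
        qed
        then show ?thesis unfolding \<Phi>_def using True by (simp only: restrict_apply')
      next
        case False
        show ?thesis unfolding \<Phi>_def restrict_def PiE_arb[OF m False] by (simp only: False if_False)
      qed
    qed
    show "\<Phi> ` (loop_set \<rightarrow>\<^sub>E {0..n}) \<subseteq> ?G"
      using \<Phi>_in good_\<Phi> by (intro image_subsetI CollectI conjI)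
    show "\<Psi> ` ?G \<subseteq> loop_set \<rightarrow>\<^sub>E {0..n}"
    proof (rule image_subsetI)
      fix m assume "m \<in> ?G"
      then have "m \<in> indices n k" by blast
      then show "\<Psi> m \<in> loop_set \<rightarrow>\<^sub>E {0..n}" by (rule \<Psi>_in)
    qed
  qed
  then have "card ?G = card (loop_set \<rightarrow>\<^sub>E {0..n})" by (rule bij_betw_same_card[symmetric])
  \<comment> \<open>The origin of the parameter \<open>n + 1\<close>: each closed loop may carry any
    of the labels \<open>0, ..., n\<close>.\<close>
  also have "\<dots> = (n + 1) ^ card loop_set" by (simp add: card_PiE finite_loop_set)
  finally show ?thesis unfolding loops_eq .
qed

text \<open>The sum counts good middle labelings. There are none if the weight of \<open>d3\<close>
  is not 1, by \<open>d3_weight_good\<close>; otherwise \<open>card_good\<close> gives the power of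
  \<open>n + 1\<close>.\<close>

lemma diagram_weight_comp:
  assumes i: "i \<in> indices n k" and j: "j \<in> indices n k"
  shows "(\<Sum>m\<in>indices n k. diagram_weight k d1 m j * diagram_weight k d2 i m) =
    of_nat (n + 1) ^ loops k d1 d2 * diagram_weight k (diagram_comp k d1 d2) i j"
proof -
  have fin: "finite (indices n k)" by (simp add: indices_def finite_PiE)
  have "(\<Sum>m\<in>indices n k. diagram_weight k d1 m j * diagram_weight k d2 i m) =
      of_nat (card {m \<in> indices n k. good (full_label i j m)})"
    unfolding diagram_weights_good using fin by (simp add: of_bool_def sum.If_cases Int_def)
  also have "\<dots> = of_nat (n + 1) ^ loops k d1 d2 * diagram_weight k d3 i j"
  proof (cases "diagram_weight k d3 i j = 1")
    case True
    show ?thesis unfolding card_good[OF True i j] True by simp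
  next
    case False
    then have "{m \<in> indices n k. good (full_label i j m)} = {}" using d3_weight_good by blast
    moreover have "\<exists>P. diagram_weight k d3 i j = of_bool P"
      unfolding diagram_weight_eq matching_weight_eq[OF finite_vertices d3_matching]
      by (rule exI, rule refl)
    then obtain P where P: "diagram_weight k d3 i j = of_bool P" ..
    then have "diagram_weight k d3 i j = 0" using False by (cases P) simp_all
    ultimately show ?thesis by (simp only: card.empty of_nat_0 mult_zero_right)
  qed
  finally show ?thesis by (simp only: d3_def)
qed

end

section \<open>Operators on tensor space and the group action\<close>

abbreviation index_pairs :: "nat \<Rightarrow> nat \<Rightarrow> (index \<times> index) set" where
  "index_pairs n k \<equiv> indices n k \<times> indices n k"

lemma finite_indices: "finite (indices n k)"
  by (simp add: indices_def finite_PiE)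

lemma index_mem: "i \<in> indices n k \<Longrightarrow> p \<in> {1..k} \<Longrightarrow> i p \<in> {0..n}"
  unfolding indices_def by (rule PiE_mem)

lemma index_arb: "i \<in> indices n k \<Longrightarrow> p \<notin> {1..k} \<Longrightarrow> i p = undefined"
  unfolding indices_def by (rule PiE_arb)

text \<open>Pairs are ordered as (row, column), that is (output, input), so that composition of
  operators becomes \<open>mat_prod\<close>.\<close>

definition op_of_mat :: "nat \<Rightarrow> nat \<Rightarrow> (index \<times> index \<Rightarrow> complex) \<Rightarrow> tensor \<Rightarrow> tensor" where
  "op_of_mat n k M = linear_extension n k (\<lambda>i j. if j \<in> indices n k then M (j, i) else 0)"

lemma op_of_mat_apply:
  "t \<in> tensor_space n k \<Longrightarrow>
   op_of_mat n k M t = (\<lambda>j. if j \<in> indices n k then \<Sum>i\<in>indices n k. t i * M (j, i) else 0)"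
  by (auto simp: op_of_mat_def linear_extension_def)

lemma op_of_mat_inject:
  assumes eq: "op_of_mat n k M = op_of_mat n k N" and j: "j \<in> indices n k" and i: "i \<in> indices n k"
  shows "M (j, i) = N (j, i)"
proof -
  define e where "e = (\<lambda>j. if j = i then 1 else 0 :: complex)"
  have e: "e \<in> tensor_space n k" using i by (auto simp: e_def tensor_space_def)
  have "op_of_mat n k A e j = A (j, i)" for A
  proof -
    have "op_of_mat n k A e j = (\<Sum>i'\<in>indices n k. if i' = i then A (j, i) else 0)"
      unfolding op_of_mat_apply[OF e] using j by (auto simp: e_def intro!: sum.cong)
    then show ?thesis using i finite_indices by (simp add: sum.delta)
  qed
  then show ?thesis using eq by metis
qed

lemma op_of_mat_inj:
  assumes "op_of_mat n k M = op_of_mat n k N"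
    and "supported_on (index_pairs n k) M" "supported_on (index_pairs n k) N"
  shows "M = N"
proof
  fix x :: "index \<times> index"
  obtain j i where x: "x = (j, i)" by (cases x)
  show "M x = N x"
  proof (cases "x \<in> index_pairs n k")
    case True
    then show ?thesis using op_of_mat_inject[OF assms(1)] x by simp
  next
    case False
    then show ?thesis using supported_onD[OF assms(2)] supported_onD[OF assms(3)] by metis
  qed
qed

lemma op_of_mat_closed: "t \<in> tensor_space n k \<Longrightarrow> op_of_mat n k M t \<in> tensor_space n k"
  by (simp add: op_of_mat_apply tensor_space_def)

lemma op_of_mat_outside: "t \<notin> tensor_space n k \<Longrightarrow> op_of_mat n k M t = undefined"
  by (simp add: op_of_mat_def linear_extension_def)

lemma op_of_mat_carrier: "op_of_mat n k M \<in> carrier (End_tensor n k)"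
proof -
  have sp: "(\<lambda>i. s i + t i) \<in> tensor_space n k" "(\<lambda>i. c * t i) \<in> tensor_space n k"
    if "s \<in> tensor_space n k" "t \<in> tensor_space n k" for s t c
    using that by (auto simp: tensor_space_def)
  have "op_of_mat n k M \<in> tensor_space n k \<rightarrow>\<^sub>E tensor_space n k"
    using op_of_mat_closed op_of_mat_outside by (intro PiE_I) auto
  moreover have "op_of_mat n k M (\<lambda>i. s i + t i) = (\<lambda>i. op_of_mat n k M s i + op_of_mat n k M t i)"
    if "s \<in> tensor_space n k" "t \<in> tensor_space n k" for s t
    using that by (auto simp: op_of_mat_apply sp distrib_right sum.distrib)
  moreover have "op_of_mat n k M (\<lambda>i. c * t i) = (\<lambda>i. c * op_of_mat n k M t i)"
    if "t \<in> tensor_space n k" for c t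
    using that by (auto simp: op_of_mat_apply sp sum_distrib_left mult.assoc)
  ultimately show ?thesis by (simp add: End_tensor_def)
qed

lemma End_tensor_is_op:
  assumes F: "F \<in> carrier (End_tensor n k)"
  shows "\<exists>M. supported_on (index_pairs n k) M \<and> F = op_of_mat n k M"
proof -
  let ?I = "indices n k" and ?T = "tensor_space n k"
  have FE: "F \<in> ?T \<rightarrow>\<^sub>E ?T"
    and Fadd: "\<And>s t. s \<in> ?T \<Longrightarrow> t \<in> ?T \<Longrightarrow> F (\<lambda>i. s i + t i) = (\<lambda>i. F s i + F t i)"
    and Fscale: "\<And>c t. t \<in> ?T \<Longrightarrow> F (\<lambda>i. c * t i) = (\<lambda>i. c * F t i)"
    using F by (auto simp: End_tensor_def)
  define e where "e i = (\<lambda>j. if j = i then 1 else 0 :: complex)" for i :: index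
  define M where "M = (\<lambda>(j, i). if j \<in> ?I \<and> i \<in> ?I then F (e i) j else 0)"
  have e: "e i \<in> ?T" if "i \<in> ?I" for i using that by (auto simp: e_def tensor_space_def)
  have zero: "(\<lambda>i. 0) \<in> ?T" by (simp add: tensor_space_def)
  have F0: "F (\<lambda>i. 0) = (\<lambda>i. 0)" using Fscale[OF zero, of 0] by simp
  have sumT: "(\<lambda>j. \<Sum>i\<in>K. t i * e i j) \<in> ?T" if "K \<subseteq> ?I" for K t
  proof -
    have "e i j = 0" if "i \<in> K" "j \<notin> ?I" for i j using that \<open>K \<subseteq> ?I\<close> by (auto simp: e_def)
    then show ?thesis by (simp add: tensor_space_def)
  qed
  have Fsum: "F (\<lambda>j. \<Sum>i\<in>K. t i * e i j) = (\<lambda>j. \<Sum>i\<in>K. t i * F (e i) j)"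
    if "finite K" "K \<subseteq> ?I" for K t
    using that
  proof (induction K rule: finite_induct)
    case empty
    then show ?case by (simp add: F0)
  next
    case (insert x K)
    have x: "e x \<in> ?T" using insert.prems e by simp
    then have tx: "(\<lambda>j. t x * e x j) \<in> ?T" by (simp add: tensor_space_def)
    have "F (\<lambda>j. \<Sum>i\<in>insert x K. t i * e i j) = F (\<lambda>j. t x * e x j + (\<Sum>i\<in>K. t i * e i j))"
      using insert.hyps by simp
    also have "\<dots> = (\<lambda>j. F (\<lambda>j. t x * e x j) j + F (\<lambda>j. \<Sum>i\<in>K. t i * e i j) j)"
      using insert.prems by (intro Fadd tx sumT) simp
    also have "\<dots> = (\<lambda>j. \<Sum>i\<in>insert x K. t i * F (e i) j)"
      using insert by (simp add: Fscale[OF x])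
    finally show ?case .
  qed
  have "F t = op_of_mat n k M t" for t
  proof (cases "t \<in> ?T")
    case True
    have "(\<Sum>i\<in>?I. t i * e i j) = t j" for j
    proof -
      have "(\<Sum>i\<in>?I. t i * e i j) = (\<Sum>i\<in>?I. if i = j then t j else 0)"
        by (intro sum.cong) (auto simp: e_def)
      then show ?thesis using finite_indices True by (simp add: sum.delta tensor_space_def)
    qed
    then have "(\<lambda>j. \<Sum>i\<in>?I. t i * e i j) = t" by (rule ext)
    then have "F t = F (\<lambda>j. \<Sum>i\<in>?I. t i * e i j)" by (rule arg_cong[OF sym])
    also have "\<dots> = (\<lambda>j. \<Sum>i\<in>?I. t i * F (e i) j)" by (rule Fsum[OF finite_indices subset_refl])
    also have "\<dots> = op_of_mat n k M t"
    proof
      fix j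
      show "(\<Sum>i\<in>?I. t i * F (e i) j) = op_of_mat n k M t j"
      proof (cases "j \<in> ?I")
        case jI: True
        then show ?thesis by (simp add: op_of_mat_apply[OF True] M_def)
      next
        case False
        have "F (e i) j = 0" if "i \<in> ?I" for i
          using PiE_mem[OF FE e[OF that]] False by (simp add: tensor_space_def)
        then show ?thesis using False by (simp add: op_of_mat_apply[OF True])
      qed
    qed
    finally show ?thesis .
  next
    case False
    show ?thesis unfolding PiE_arb[OF FE False] op_of_mat_outside[OF False] ..
  qed
  moreover have "supported_on (index_pairs n k) M" by (auto simp: supported_on_def M_def)
  ultimately show ?thesis by blast
qed

lemma mult_op:
  "op_of_mat n k M \<otimes>\<^bsub>End_tensor n k\<^esub> op_of_mat n k N = op_of_mat n k (mat_prod (indices n k) M N)"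
proof
  fix t
  let ?I = "indices n k"
  have "compose (tensor_space n k) (op_of_mat n k M) (op_of_mat n k N) t = op_of_mat n k (mat_prod ?I M N) t"
  proof (cases "t \<in> tensor_space n k")
    case True
    have "(\<Sum>l\<in>?I. (\<Sum>i\<in>?I. t i * N (l, i)) * M (j, l)) = (\<Sum>i\<in>?I. t i * (\<Sum>l\<in>?I. M (j, l) * N (l, i)))" for j
      unfolding sum_distrib_left sum_distrib_right by (subst sum.swap) (simp add: mult_ac)
    then have swap: "(\<Sum>l\<in>?I. op_of_mat n k N t l * M (j, l)) = (\<Sum>i\<in>?I. t i * mat_prod ?I M N (j, i))" for j
      by (simp add: op_of_mat_apply[OF True] mat_prod_def)
    show ?thesis
      unfolding compose_eq[OF True] op_of_mat_apply[OF op_of_mat_closed[OF True]] swap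
      by (rule op_of_mat_apply[OF True, symmetric])
  qed (simp add: compose_def op_of_mat_outside)
  then show "(op_of_mat n k M \<otimes>\<^bsub>End_tensor n k\<^esub> op_of_mat n k N) t = op_of_mat n k (mat_prod ?I M N) t"
    by (simp add: End_tensor_def)
qed

lemma add_op:
  "op_of_mat n k M \<oplus>\<^bsub>End_tensor n k\<^esub> op_of_mat n k N = op_of_mat n k (\<lambda>x. M x + N x)"
  by (auto simp: End_tensor_def fun_eq_iff op_of_mat_apply op_of_mat_outside restrict_def distrib_left sum.distrib)

lemma smult_op: "c \<odot>\<^bsub>End_tensor n k\<^esub> op_of_mat n k M = op_of_mat n k (\<lambda>x. c * M x)"
  by (auto simp: End_tensor_def fun_eq_iff op_of_mat_apply op_of_mat_outside restrict_def
      sum_distrib_left mult.left_commute)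

lemma zero_op: "\<zero>\<^bsub>End_tensor n k\<^esub> = op_of_mat n k (\<lambda>x. 0)"
  by (auto simp: End_tensor_def fun_eq_iff op_of_mat_apply op_of_mat_outside restrict_def)

lemma one_op: "\<one>\<^bsub>End_tensor n k\<^esub> = op_of_mat n k (mat_one (indices n k))"
proof
  fix t
  show "\<one>\<^bsub>End_tensor n k\<^esub> t = op_of_mat n k (mat_one (indices n k)) t"
  proof (cases "t \<in> tensor_space n k")
    case True
    have "(\<Sum>i\<in>indices n k. t i * mat_one (indices n k) (j, i)) = t j" if "j \<in> indices n k" for j
    proof -
      have "(\<Sum>i\<in>indices n k. t i * mat_one (indices n k) (j, i)) = (\<Sum>i\<in>indices n k. if i = j then t j else 0)"
        by (intro sum.cong) (auto simp: mat_one_def)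
      then show ?thesis using that finite_indices by (simp add: sum.delta)
    qed
    then show ?thesis
      using True by (auto simp: End_tensor_def op_of_mat_apply tensor_space_def fun_eq_iff)
  qed (simp add: End_tensor_def op_of_mat_outside)
qed

lemmas op_simps = mult_op add_op smult_op zero_op one_op

text \<open>Each axiom is an identity of matrices, since every endomorphism has the form
  \<open>op_of_mat\<close>. The result gives access to the general facts on rings and
  subrings.\<close>

lemma ring_End_tensor: "ring (End_tensor n k)"
proof -
  let ?E = "End_tensor n k" and ?I = "indices n k"
  have ex: "\<exists>M. F = op_of_mat n k M \<and> supported_on (index_pairs n k) M" if "F \<in> carrier ?E" for F
    using End_tensor_is_op[OF that] by blast
  show ?thesis
  proof (rule ringI)
    show "abelian_group ?E"
    proof (rule abelian_groupI)
      fix F assume "F \<in> carrier ?E"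
      then obtain M where M: "F = op_of_mat n k M" using ex by blast
      show "\<zero>\<^bsub>?E\<^esub> \<oplus>\<^bsub>?E\<^esub> F = F" by (simp add: M op_simps)
      have "op_of_mat n k (\<lambda>x. - M x) \<oplus>\<^bsub>?E\<^esub> F = \<zero>\<^bsub>?E\<^esub>" by (simp add: M op_simps)
      then show "\<exists>G\<in>carrier ?E. G \<oplus>\<^bsub>?E\<^esub> F = \<zero>\<^bsub>?E\<^esub>" using op_of_mat_carrier by blast
      fix G assume "G \<in> carrier ?E"
      then obtain N where N: "G = op_of_mat n k N" using ex by blast
      show "F \<oplus>\<^bsub>?E\<^esub> G \<in> carrier ?E" by (simp add: M N op_simps op_of_mat_carrier)
      show "F \<oplus>\<^bsub>?E\<^esub> G = G \<oplus>\<^bsub>?E\<^esub> F" by (simp add: M N op_simps add.commute)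
      fix H assume "H \<in> carrier ?E"
      then obtain L where L: "H = op_of_mat n k L" using ex by blast
      show "(F \<oplus>\<^bsub>?E\<^esub> G) \<oplus>\<^bsub>?E\<^esub> H = F \<oplus>\<^bsub>?E\<^esub> (G \<oplus>\<^bsub>?E\<^esub> H)" by (simp add: M N L op_simps add.assoc)
    qed (simp add: zero_op op_of_mat_carrier)
    show "monoid ?E"
    proof (rule monoidI)
      fix F assume "F \<in> carrier ?E"
      then obtain M where M: "F = op_of_mat n k M" "supported_on (index_pairs n k) M" using ex by blast
      show "\<one>\<^bsub>?E\<^esub> \<otimes>\<^bsub>?E\<^esub> F = F" by (simp add: M(1) op_simps mat_prod_one_left[OF finite_indices M(2)])
      show "F \<otimes>\<^bsub>?E\<^esub> \<one>\<^bsub>?E\<^esub> = F" by (simp add: M(1) op_simps mat_prod_one_right[OF finite_indices M(2)])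
      fix G assume "G \<in> carrier ?E"
      then obtain N where N: "G = op_of_mat n k N" using ex by blast
      show "F \<otimes>\<^bsub>?E\<^esub> G \<in> carrier ?E" by (simp add: M(1) N op_simps op_of_mat_carrier)
      fix H assume "H \<in> carrier ?E"
      then obtain L where L: "H = op_of_mat n k L" using ex by blast
      show "(F \<otimes>\<^bsub>?E\<^esub> G) \<otimes>\<^bsub>?E\<^esub> H = F \<otimes>\<^bsub>?E\<^esub> (G \<otimes>\<^bsub>?E\<^esub> H)"
        by (simp add: M(1) N L op_simps mat_prod_assoc)
    qed (simp add: one_op op_of_mat_carrier)
    fix F G H assume "F \<in> carrier ?E" "G \<in> carrier ?E" "H \<in> carrier ?E"
    then obtain M N L where FGH: "F = op_of_mat n k M" "G = op_of_mat n k N" "H = op_of_mat n k L"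
      using ex by metis
    have "mat_prod ?I (\<lambda>x. M x + N x) L = (\<lambda>x. mat_prod ?I M L x + mat_prod ?I N L x)"
      by (auto simp: mat_prod_def distrib_right sum.distrib)
    then show "(F \<oplus>\<^bsub>?E\<^esub> G) \<otimes>\<^bsub>?E\<^esub> H = F \<otimes>\<^bsub>?E\<^esub> H \<oplus>\<^bsub>?E\<^esub> G \<otimes>\<^bsub>?E\<^esub> H"
      by (simp add: FGH op_simps)
    show "H \<otimes>\<^bsub>?E\<^esub> (F \<oplus>\<^bsub>?E\<^esub> G) = H \<otimes>\<^bsub>?E\<^esub> F \<oplus>\<^bsub>?E\<^esub> H \<otimes>\<^bsub>?E\<^esub> G"
      by (simp add: FGH op_simps mat_prod_add_right)
  qed
qed

section \<open>Tensor powers of orthogonal matrices and the image of the group\<close>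

definition kron_power :: "nat \<Rightarrow> nat \<Rightarrow> (nat \<Rightarrow> nat \<Rightarrow> complex) \<Rightarrow> index \<times> index \<Rightarrow> complex" where
  "kron_power n k h = (\<lambda>(j, i). if (j, i) \<in> index_pairs n k then \<Prod>p\<in>{1..k}. h (j p) (i p) else 0)"

lemma kron_power_apply:
  "j \<in> indices n k \<Longrightarrow> i \<in> indices n k \<Longrightarrow> kron_power n k h (j, i) = (\<Prod>p\<in>{1..k}. h (j p) (i p))"
  by (simp add: kron_power_def)

lemma kron_power_supported: "supported_on (index_pairs n k) (kron_power n k h)"
  by (auto simp: supported_on_def kron_power_def)

lemma orth_fun_delta: "orth_fun n (\<lambda>a b. of_bool (a = b))"
proof -
  have "(\<Sum>c\<in>{0..n}. of_bool (a = c) * of_bool (b = c)) = (of_bool (a = b) :: complex)"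
    if "a \<in> {0..n}" for a b
  proof -
    have "(\<Sum>c\<in>{0..n}. of_bool (a = c) * of_bool (b = c)) = (\<Sum>c\<in>{0..n}. if c = a then of_bool (a = b) else (0::complex))"
      by (intro sum.cong) auto
    then show ?thesis using that by (simp add: sum.delta)
  qed
  then show ?thesis by (auto simp: orth_fun_def eq_commute[of _ "_ :: nat"])
qed

lemma orth_fun_transpose: "orth_fun n h \<Longrightarrow> orth_fun n (\<lambda>a b. h b a)"
  unfolding orth_fun_def by blast

text \<open>The equations defining \<open>orth_fun\<close> are polynomial with real coefficients, so
  complex conjugation preserves them.\<close>

lemma orth_fun_cnj:
  assumes "orth_fun n h"
  shows "orth_fun n (\<lambda>a b. cnj (h a b))"
proof -
  have cnj_of_bool: "cnj (of_bool P) = of_bool P" for P by (cases P) auto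
  have sums: "(\<Sum>c\<in>{0..n}. cnj (f c) * cnj (g c)) = of_bool P"
    if "(\<Sum>c\<in>{0..n}. f c * g c) = of_bool P" for f g P
  proof -
    have "(\<Sum>c\<in>{0..n}. cnj (f c) * cnj (g c)) = cnj (\<Sum>c\<in>{0..n}. f c * g c)" by simp
    then show ?thesis unfolding that cnj_of_bool .
  qed
  show ?thesis
    unfolding orth_fun_def
  proof (intro conjI ballI)
    fix a b assume a: "a \<in> {0..n}" and b: "b \<in> {0..n}"
    show "(\<Sum>c\<in>{0..n}. cnj (h a c) * cnj (h b c)) = of_bool (a = b)"
      by (rule sums) (use assms a b in \<open>unfold orth_fun_def, blast\<close>)
    show "(\<Sum>c\<in>{0..n}. cnj (h c a) * cnj (h c b)) = of_bool (a = b)"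
      by (rule sums) (use assms a b in \<open>unfold orth_fun_def, blast\<close>)
  next
    fix a assume a: "a \<in> {0..n}"
    have "h a 0 = of_bool (a = 0)" "h 0 a = of_bool (a = 0)"
      using assms a unfolding orth_fun_def by blast+
    then show "cnj (h a 0) = of_bool (a = 0)" "cnj (h 0 a) = of_bool (a = 0)"
      by (simp_all only: cnj_of_bool)
  qed
qed

text \<open>Stated for rows only: the columns of a product are the rows of the product of the
  transposes in reverse order.\<close>

lemma orth_rows_mult:
  assumes h1: "\<And>a b. a \<in> S \<Longrightarrow> b \<in> S \<Longrightarrow> (\<Sum>c\<in>S. h1 a c * h1 b c) = (of_bool (a = b) :: complex)"
    and h2: "\<And>a b. a \<in> S \<Longrightarrow> b \<in> S \<Longrightarrow> (\<Sum>c\<in>S. h2 a c * h2 b c) = of_bool (a = b)"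
    and ab: "a \<in> S" "b \<in> S" and fin: "finite S"
  shows "(\<Sum>c\<in>S. (\<Sum>d\<in>S. h1 a d * h2 d c) * (\<Sum>e\<in>S. h1 b e * h2 e c)) = of_bool (a = b)"
proof -
  have "(\<Sum>c\<in>S. (\<Sum>d\<in>S. h1 a d * h2 d c) * (\<Sum>e\<in>S. h1 b e * h2 e c)) =
      (\<Sum>c\<in>S. \<Sum>d\<in>S. \<Sum>e\<in>S. h1 a d * h1 b e * (h2 d c * h2 e c))"
    by (simp add: sum_product mult_ac)
  also have "\<dots> = (\<Sum>d\<in>S. \<Sum>c\<in>S. \<Sum>e\<in>S. h1 a d * h1 b e * (h2 d c * h2 e c))"
    by (rule sum.swap)
  also have "\<dots> = (\<Sum>d\<in>S. \<Sum>e\<in>S. \<Sum>c\<in>S. h1 a d * h1 b e * (h2 d c * h2 e c))"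
    by (intro sum.cong refl sum.swap)
  also have "\<dots> = (\<Sum>d\<in>S. \<Sum>e\<in>S. if e = d then h1 a d * h1 b d else 0)"
    by (intro sum.cong refl) (simp add: sum_distrib_left[symmetric] h2)
  also have "\<dots> = (\<Sum>d\<in>S. h1 a d * h1 b d)"
    using fin by (intro sum.cong refl) (simp add: sum.delta)
  finally show ?thesis using h1[OF ab] by simp
qed

lemma orth_fun_mult:
  assumes h1: "orth_fun n h1" and h2: "orth_fun n h2"
  shows "orth_fun n (\<lambda>a b. \<Sum>c\<in>{0..n}. h1 a c * h2 c b)"
proof -
  let ?S = "{0..n}"
  have z: "h a 0 = of_bool (a = 0)" "h 0 a = of_bool (a = 0)" if "orth_fun n h" "a \<in> ?S" for h a
    using that unfolding orth_fun_def by blast+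
  have zero: "(\<Sum>c\<in>?S. h1 a c * h2 c 0) = of_bool (a = 0)" "(\<Sum>c\<in>?S. h1 0 c * h2 c a) = of_bool (a = 0)"
    if a: "a \<in> ?S" for a
  proof -
    have "(\<Sum>c\<in>?S. h1 a c * h2 c 0) = (\<Sum>c\<in>?S. if c = 0 then h1 a 0 else 0)"
      by (intro sum.cong refl) (simp add: z[OF h2])
    then show "(\<Sum>c\<in>?S. h1 a c * h2 c 0) = of_bool (a = 0)" using z(1)[OF h1 a] by (simp add: sum.delta)
    have "(\<Sum>c\<in>?S. h1 0 c * h2 c a) = (\<Sum>c\<in>?S. if c = 0 then h2 0 a else 0)"
      by (intro sum.cong refl) (simp add: z[OF h1])
    then show "(\<Sum>c\<in>?S. h1 0 c * h2 c a) = of_bool (a = 0)" using z(2)[OF h2 a] by (simp add: sum.delta)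
  qed
  have row: "(\<Sum>c\<in>?S. h a c * h b c) = of_bool (a = b)" if "orth_fun n h" "a \<in> ?S" "b \<in> ?S" for h a b
    using that unfolding orth_fun_def by blast
  note rows = orth_rows_mult[of ?S h1 h2, OF row[OF h1] row[OF h2]]
  note cols = orth_rows_mult[of ?S "\<lambda>a b. h2 b a" "\<lambda>a b. h1 b a",
      OF row[OF orth_fun_transpose[OF h2]] row[OF orth_fun_transpose[OF h1]]]
  show ?thesis
    unfolding orth_fun_def using zero rows cols by (simp add: mult.commute)
qed

lemma kron_power_mult:
  "mat_prod (indices n k) (kron_power n k h1) (kron_power n k h2) =
   kron_power n k (\<lambda>a b. \<Sum>c\<in>{0..n}. h1 a c * h2 c b)"
proof (rule ext, clarify)
  fix j i
  let ?I = "indices n k"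
  show "mat_prod ?I (kron_power n k h1) (kron_power n k h2) (j, i) =
      kron_power n k (\<lambda>a b. \<Sum>c\<in>{0..n}. h1 a c * h2 c b) (j, i)"
  proof (cases "(j, i) \<in> index_pairs n k")
    case True
    then have ji: "j \<in> ?I" "i \<in> ?I" by auto
    have "(\<Sum>l\<in>?I. kron_power n k h1 (j, l) * kron_power n k h2 (l, i)) =
        (\<Sum>l\<in>?I. \<Prod>p\<in>{1..k}. h1 (j p) (l p) * h2 (l p) (i p))"
      using ji by (intro sum.cong refl) (simp add: kron_power_apply prod.distrib)
    also have "\<dots> = (\<Prod>p\<in>{1..k}. \<Sum>c\<in>{0..n}. h1 (j p) c * h2 c (i p))"
      unfolding indices_def by (rule prod_sum_PiE[symmetric]) auto
    finally show ?thesis using ji by (simp add: mat_prod_def kron_power_apply)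
  next
    case False
    then show ?thesis by (auto simp: mat_prod_def kron_power_def)
  qed
qed

lemma kron_power_cong:
  assumes "\<And>a b. a \<in> {0..n} \<Longrightarrow> b \<in> {0..n} \<Longrightarrow> h a b = h' a b"
  shows "kron_power n k h = kron_power n k h'"
proof (rule ext, clarify)
  fix j i
  show "kron_power n k h (j, i) = kron_power n k h' (j, i)"
  proof (cases "(j, i) \<in> index_pairs n k")
    case True
    then have ji: "j \<in> indices n k" "i \<in> indices n k" by auto
    show ?thesis unfolding kron_power_apply[OF ji]
      using index_mem[OF ji(1)] index_mem[OF ji(2)] by (intro prod.cong refl assms)
  next
    case False
    then show ?thesis using supported_onD[OF kron_power_supported] by metis
  qed
qed

lemma kron_power_delta: "kron_power n k (\<lambda>a b. of_bool (a = b)) = mat_one (indices n k)"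
proof (rule ext, clarify)
  fix j i
  show "kron_power n k (\<lambda>a b. of_bool (a = b)) (j, i) = mat_one (indices n k) (j, i)"
  proof (cases "(j, i) \<in> index_pairs n k")
    case True
    then have ji: "j \<in> indices n k" "i \<in> indices n k" by auto
    have "(\<forall>p\<in>{1..k}. j p = i p) \<longleftrightarrow> j = i"
      using ji unfolding indices_def by (metis PiE_ext)
    then show ?thesis using ji by (simp only: kron_power_apply prod_of_bool finite_atLeastAtMost)
        (simp add: mat_one_def)
  qed (auto simp: kron_power_def mat_one_def)
qed

lemma kron_power_adjoint: "mat_adjoint (kron_power n k h) = kron_power n k (\<lambda>a b. cnj (h b a))"
  by (auto simp: mat_adjoint_def kron_power_def fun_eq_iff)

lemma kron_power_transpose_inverse:
  assumes h: "orth_fun n h"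
  shows "mat_prod (indices n k) (kron_power n k h) (kron_power n k (\<lambda>a b. h b a)) = mat_one (indices n k)"
    "mat_prod (indices n k) (kron_power n k (\<lambda>a b. h b a)) (kron_power n k h) = mat_one (indices n k)"
  unfolding kron_power_mult kron_power_delta[symmetric]
  using h unfolding orth_fun_def by (intro kron_power_cong; blast)+

text \<open>The shift by 1 reconciles two numberings: entries of \<open>g\<close> start at
  \<open>0\<close>, while in \<open>V\<close> the index \<open>0\<close> belongs to the trivial
  summand and the defining module starts at \<open>1\<close>.\<close>

definition block_fun :: "complex mat \<Rightarrow> nat \<Rightarrow> nat \<Rightarrow> complex" where
  "block_fun g a b = (if a = 0 \<or> b = 0 then of_bool (a = b) else g $$ (a - 1, b - 1))"

lemma module_mat_index:
  assumes "g \<in> carrier_mat n n" "a \<in> {0..n}" "b \<in> {0..n}"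
  shows "module_mat n g $$ (a, b) = block_fun g a b"
proof -
  have "a < 1 + dim_row g" "b < 1 + dim_col g" using assms by auto
  then show ?thesis using assms(1) unfolding module_mat_def by (auto simp: block_fun_def)
qed

lemma group_action_eq:
  assumes g: "g \<in> carrier_mat n n"
  shows "group_action n k g = op_of_mat n k (kron_power n k (block_fun g))"
proof -
  let ?I = "indices n k"
  have entry: "(module_mat n g *\<^sub>v unit_vec (n + 1) c) $ r = block_fun g r c"
    if "r \<in> {0..n}" "c \<in> {0..n}" for r c
  proof -
    have car: "module_mat n g \<in> carrier_mat (1 + n) (1 + n)"
      unfolding module_mat_def using g by (intro four_block_carrier_mat) auto
    then have "(module_mat n g *\<^sub>v unit_vec (n + 1) c) $ r = row (module_mat n g) r \<bullet> unit_vec (n + 1) c"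
      using that by (intro index_mult_mat_vec) auto
    also have "\<dots> = row (module_mat n g) r $ c"
      using car that by (intro scalar_prod_right_unit) auto
    also have "\<dots> = module_mat n g $$ (r, c)" using car that by (intro index_row) auto
    finally show ?thesis using module_mat_index[OF g that] by simp
  qed
  have "pure_tensor n k (\<lambda>p. module_mat n g *\<^sub>v unit_vec (n + 1) (i p)) =
      (\<lambda>j. if j \<in> ?I then kron_power n k (block_fun g) (j, i) else 0)" if i: "i \<in> ?I" for i
  proof
    fix j
    show "pure_tensor n k (\<lambda>p. module_mat n g *\<^sub>v unit_vec (n + 1) (i p)) j =
      (if j \<in> ?I then kron_power n k (block_fun g) (j, i) else 0)"
    proof (cases "j \<in> ?I")
      case True
      have "(\<Prod>p = 1..k. (module_mat n g *\<^sub>v unit_vec (n + 1) (i p)) $ j p) = (\<Prod>p\<in>{1..k}. block_fun g (j p) (i p))"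
        using index_mem[OF True] index_mem[OF i] by (intro prod.cong refl entry)
      then show ?thesis using True i by (simp add: pure_tensor_def kron_power_apply)
    qed (simp add: pure_tensor_def)
  qed
  then show ?thesis
    unfolding group_action_def op_of_mat_def linear_extension_def
    by (intro restrict_ext ext sum.cong refl) simp
qed

lemma sum_shift: "(\<Sum>c\<in>{0..n}. f c) = f 0 + (\<Sum>c\<in>{0..<n}. f (Suc c))" for f :: "nat \<Rightarrow> complex"
  by (simp add: atLeast0AtMost atLeast0LessThan sum.atMost_shift)

lemma block_fun_orth_iff:
  assumes g: "g \<in> carrier_mat n n"
  shows "orth_fun n (block_fun g) \<longleftrightarrow> g * transpose_mat g = 1\<^sub>m n \<and> transpose_mat g * g = 1\<^sub>m n"
proof -
  have gt: "transpose_mat g \<in> carrier_mat n n" using g by simp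
  have row: "(\<Sum>c\<in>{0..n}. block_fun g (Suc a) c * block_fun g (Suc b) c) = (g * transpose_mat g) $$ (a, b)"
    and col: "(\<Sum>c\<in>{0..n}. block_fun g c (Suc a) * block_fun g c (Suc b)) = (transpose_mat g * g) $$ (a, b)"
    if "a < n" "b < n" for a b
    using g that unfolding sum_shift by (auto simp: block_fun_def scalar_prod_def intro!: sum.cong)
  have row0: "(\<Sum>c\<in>{0..n}. block_fun g 0 c * block_fun g b c) = of_bool (0 = b)"
    "(\<Sum>c\<in>{0..n}. block_fun g b c * block_fun g 0 c) = of_bool (b = 0)"
    "(\<Sum>c\<in>{0..n}. block_fun g c 0 * block_fun g c b) = of_bool (0 = b)"
    "(\<Sum>c\<in>{0..n}. block_fun g c b * block_fun g c 0) = of_bool (b = 0)" for b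
    unfolding sum_shift by (auto simp: block_fun_def)
  have one: "A = 1\<^sub>m n \<longleftrightarrow> (\<forall>a<n. \<forall>b<n. A $$ (a, b) = of_bool (a = b))" if "A \<in> carrier_mat n n" for A :: "complex mat"
    using that by (auto intro!: eq_matI)
  have split: "(\<forall>a\<in>{0..n}. \<forall>b\<in>{0..n}. Q a b) \<longleftrightarrow>
      (\<forall>a<n. \<forall>b<n. Q (Suc a) (Suc b)) \<and> (\<forall>b\<in>{0..n}. Q 0 b) \<and> (\<forall>a\<in>{0..n}. Q a 0)" for Q
  proof (intro iffI conjI allI impI ballI)
    fix a b assume q: "(\<forall>a<n. \<forall>b<n. Q (Suc a) (Suc b)) \<and> (\<forall>b\<in>{0..n}. Q 0 b) \<and> (\<forall>a\<in>{0..n}. Q a 0)"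
      and ab: "a \<in> {0..n}" "b \<in> {0..n}"
    show "Q a b"
    proof (cases a; cases b)
      fix a' b' assume "a = Suc a'" "b = Suc b'"
      then show ?thesis using q ab by simp
    qed (use q ab in simp_all)
  qed auto
  have "orth_fun n (block_fun g) \<longleftrightarrow>
    (\<forall>a\<in>{0..n}. \<forall>b\<in>{0..n}. (\<Sum>c\<in>{0..n}. block_fun g a c * block_fun g b c) = of_bool (a = b)) \<and>
    (\<forall>a\<in>{0..n}. \<forall>b\<in>{0..n}. (\<Sum>c\<in>{0..n}. block_fun g c a * block_fun g c b) = of_bool (a = b))"
    unfolding orth_fun_def by (auto simp: block_fun_def)
  also have "\<dots> \<longleftrightarrow> (\<forall>a<n. \<forall>b<n. (g * transpose_mat g) $$ (a, b) = of_bool (a = b)) \<and>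
      (\<forall>a<n. \<forall>b<n. (transpose_mat g * g) $$ (a, b) = of_bool (a = b))"
    unfolding split using row col row0 by simp
  also have "\<dots> \<longleftrightarrow> g * transpose_mat g = 1\<^sub>m n \<and> transpose_mat g * g = 1\<^sub>m n"
    using one[of "g * transpose_mat g"] one[of "transpose_mat g * g"] g gt by simp
  finally show ?thesis .
qed

lemma group_action_image:
  "group_action n k ` orthogonal_group n = op_of_mat n k ` kron_power n k ` {h. orth_fun n h}"
proof (intro equalityI subsetI)
  fix F assume "F \<in> group_action n k ` orthogonal_group n"
  then obtain g where g: "g \<in> carrier_mat n n" "g * transpose_mat g = 1\<^sub>m n" "F = group_action n k g"
    by (auto simp: orthogonal_group_def)
  \<comment> \<open>\<open>orthogonal_group\<close> records the row relations,
    \<open>orth_fun\<close> those of rows and columns. For a square matrix a one-sided inverse is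
    two-sided.\<close>
  have "transpose_mat g * g = 1\<^sub>m n"
    using g(1,2) by (intro mat_mult_left_right_inverse[of g]) auto
  then have "orth_fun n (block_fun g)" using block_fun_orth_iff[OF g(1)] g(2) by blast
  then show "F \<in> op_of_mat n k ` kron_power n k ` {h. orth_fun n h}"
    using group_action_eq[OF g(1)] g(3) by blast
next
  fix F assume "F \<in> op_of_mat n k ` kron_power n k ` {h. orth_fun n h}"
  then obtain h where h: "orth_fun n h" "F = op_of_mat n k (kron_power n k h)" by blast
  \<comment> \<open>Row and column \<open>0\<close> of \<open>h\<close> are those of the unit
    matrix, so this block recovers \<open>h\<close> on \<open>{0..n}\<close>.\<close>
  define g where "g = mat n n (\<lambda>(a, b). h (Suc a) (Suc b))"
  have g: "g \<in> carrier_mat n n" by (simp add: g_def)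
  have eq: "block_fun g a b = h a b" if "a \<in> {0..n}" "b \<in> {0..n}" for a b
  proof (cases "a = 0 \<or> b = 0")
    case True
    then show ?thesis using h(1) that by (auto simp: block_fun_def orth_fun_def)
  next
    case False
    then show ?thesis using that by (cases a; cases b) (auto simp: block_fun_def g_def)
  qed
  have "orth_fun n (block_fun g)"
    using h(1) unfolding orth_fun_def by (simp add: eq)
  then have gg: "g * transpose_mat g = 1\<^sub>m n" "transpose_mat g * g = 1\<^sub>m n"
    using block_fun_orth_iff[OF g] by auto
  have "invertible_mat g"
    unfolding invertible_mat_def inverts_mat_def square_mat.simps using g gg
    by (intro conjI exI[of _ "transpose_mat g"]) auto
  then have "g \<in> orthogonal_group n" using g gg(1) by (simp add: orthogonal_group_def)
  moreover have "group_action n k g = F"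
    unfolding group_action_eq[OF g] h(2) using kron_power_cong[of n "block_fun g" h, OF eq] by simp
  ultimately show "F \<in> group_action n k ` orthogonal_group n" by blast
qed

section \<open>The centralizer of the orthogonal group\<close>

text \<open>Top slots hold the row index and bottom slots the column index, as in
  \<open>diagram_weight\<close>. The restrictions produce extensional functions, as membership in
  \<open>indices n k\<close> demands.\<close>

definition tensor_of_mat :: "nat \<Rightarrow> (index \<times> index \<Rightarrow> complex) \<Rightarrow> (vertex \<Rightarrow> nat) \<Rightarrow> complex" where
  "tensor_of_mat k M l = M (\<lambda>p\<in>{1..k}. l (Top, p), \<lambda>p\<in>{1..k}. l (Bottom, p))"

definition pair_label :: "nat \<Rightarrow> index \<times> index \<Rightarrow> vertex \<Rightarrow> nat" where
  "pair_label k x = restrict (vertex_label (snd x) (fst x)) (vertices k)"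

lemma pair_label_simps:
  "p \<in> {1..k} \<Longrightarrow> pair_label k (j, i) (Top, p) = j p"
  "p \<in> {1..k} \<Longrightarrow> pair_label k (j, i) (Bottom, p) = i p"
  by (simp_all add: pair_label_def vertices_def)

lemma tensor_of_mat_pair_label:
  assumes j: "j \<in> indices n k" and i: "i \<in> indices n k"
  shows "tensor_of_mat k M (pair_label k (j, i)) = M (j, i)"
proof -
  have "(\<lambda>p\<in>{1..k}. pair_label k (j, i) (Top, p)) = j"
  proof
    fix p show "(\<lambda>p\<in>{1..k}. pair_label k (j, i) (Top, p)) p = j p"
    proof (cases "p \<in> {1..k}")
      case True
      show ?thesis unfolding restrict_apply'[OF True] by (rule pair_label_simps(1)[OF True])
    next
      case False
      show ?thesis unfolding restrict_def index_arb[OF j False] by (simp only: False if_False)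
    qed
  qed
  moreover have "(\<lambda>p\<in>{1..k}. pair_label k (j, i) (Bottom, p)) = i"
  proof
    fix p show "(\<lambda>p\<in>{1..k}. pair_label k (j, i) (Bottom, p)) p = i p"
    proof (cases "p \<in> {1..k}")
      case True
      show ?thesis unfolding restrict_apply'[OF True] by (rule pair_label_simps(2)[OF True])
    next
      case False
      show ?thesis unfolding restrict_def index_arb[OF i False] by (simp only: False if_False)
    qed
  qed
  ultimately show ?thesis by (simp only: tensor_of_mat_def)
qed

lemma bij_pair_label: "bij_betw (pair_label k) (index_pairs n k) (labelings n (vertices k))"
proof (rule bij_betw_byWitness[where f' = "\<lambda>l. (\<lambda>p\<in>{1..k}. l (Top, p), \<lambda>p\<in>{1..k}. l (Bottom, p))"])
  show "\<forall>x\<in>index_pairs n k. (\<lambda>p\<in>{1..k}. pair_label k x (Top, p), \<lambda>p\<in>{1..k}. pair_label k x (Bottom, p)) = x"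
  proof
    fix x assume "x \<in> index_pairs n k"
    then obtain j i where x: "x = (j, i)" "j \<in> indices n k" "i \<in> indices n k" by auto
    from tensor_of_mat_pair_label[OF x(2,3)]
    have "M (\<lambda>p\<in>{1..k}. pair_label k (j, i) (Top, p), \<lambda>p\<in>{1..k}. pair_label k (j, i) (Bottom, p)) = M (j, i)"
      for M :: "index \<times> index \<Rightarrow> complex"
      unfolding tensor_of_mat_def .
    \<comment> \<open>Testing with the indicator function of \<open>(j, i)\<close> turns equality of
      the values of every \<open>M\<close> into equality of the arguments.\<close>
    from this[of "\<lambda>x. of_bool (x = (j, i))"]
    show "(\<lambda>p\<in>{1..k}. pair_label k x (Top, p), \<lambda>p\<in>{1..k}. pair_label k x (Bottom, p)) = x"
      unfolding x(1) by (simp only: of_bool_eq_1_iff of_bool_eq(2) simp_thms)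
  qed
  show "\<forall>l\<in>labelings n (vertices k).
      pair_label k (\<lambda>p\<in>{1..k}. l (Top, p), \<lambda>p\<in>{1..k}. l (Bottom, p)) = l"
  proof (intro ballI ext)
    fix l v assume l: "l \<in> labelings n (vertices k)"
    show "pair_label k (\<lambda>p\<in>{1..k}. l (Top, p), \<lambda>p\<in>{1..k}. l (Bottom, p)) v = l v"
    proof (cases "v \<in> vertices k")
      case True
      then show ?thesis by (auto simp: pair_label_def vertices_def)
    next
      case False
      then show ?thesis using PiE_arb[OF l False] by (simp add: pair_label_def)
    qed
  qed
  show "pair_label k ` index_pairs n k \<subseteq> labelings n (vertices k)"
  proof (clarify)
    fix j i assume ji: "j \<in> indices n k" "i \<in> indices n k"
    show "pair_label k (j, i) \<in> labelings n (vertices k)"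
    proof (rule PiE_I)
      fix v assume v: "v \<in> vertices k"
      obtain lv p where lp: "v = (lv, p)" by (cases v)
      have p: "p \<in> {1..k}" "v = (Top, p) \<or> v = (Bottom, p)" using v unfolding lp vertices_def by blast+
      show "pair_label k (j, i) v \<in> {0..n}"
        using p(2)
      proof
        assume "v = (Top, p)"
        then show ?thesis using index_mem[OF ji(1) p(1)] by (simp only: pair_label_simps(1)[OF p(1)])
      next
        assume "v = (Bottom, p)"
        then show ?thesis using index_mem[OF ji(2) p(1)] by (simp only: pair_label_simps(2)[OF p(1)])
      qed
    qed (simp add: pair_label_def)
  qed
  show "(\<lambda>l. (\<lambda>p\<in>{1..k}. l (Top, p), \<lambda>p\<in>{1..k}. l (Bottom, p))) ` labelings n (vertices k) \<subseteq> index_pairs n k"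
  proof (rule image_subsetI)
    fix l assume l: "l \<in> labelings n (vertices k)"
    have "l (Top, p) \<in> {0..n}" "l (Bottom, p) \<in> {0..n}" if "p \<in> {1..k}" for p
      using that by (intro PiE_mem[OF l]; simp add: vertices_def)+
    then show "(\<lambda>p\<in>{1..k}. l (Top, p), \<lambda>p\<in>{1..k}. l (Bottom, p)) \<in> index_pairs n k"
      unfolding indices_def by (intro SigmaI restrict_PiE_iff[THEN iffD2] ballI)
  qed
qed

lemma prod_vertices: "(\<Prod>v\<in>vertices k. f v) = (\<Prod>p\<in>{1..k}. f (Top, p)) * (\<Prod>p\<in>{1..k}. f (Bottom, p))"
  for f :: "vertex \<Rightarrow> complex"
  unfolding vertices_def prod.cartesian_product' by simp

text \<open>The top slots multiply \<open>M\<close> on the left by the tensor power of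
  \<open>h\<close>; the bottom slots act on the column index, hence from the right and by the
  transpose.\<close>

lemma tensor_transform:
  assumes j: "j \<in> indices n k" and i: "i \<in> indices n k"
  shows "(\<Sum>l'\<in>labelings n (vertices k).
      (\<Prod>v\<in>vertices k. h (pair_label k (j, i) v) (l' v)) * tensor_of_mat k M l') =
    mat_prod (indices n k) (mat_prod (indices n k) (kron_power n k h) M) (kron_power n k (\<lambda>a b. h b a)) (j, i)"
proof -
  let ?I = "indices n k"
  have "(\<Sum>l'\<in>labelings n (vertices k). (\<Prod>v\<in>vertices k. h (pair_label k (j, i) v) (l' v)) * tensor_of_mat k M l') =
      (\<Sum>x\<in>index_pairs n k. (\<Prod>v\<in>vertices k. h (pair_label k (j, i) v) (pair_label k x v)) *
        tensor_of_mat k M (pair_label k x))"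
    by (rule sum.reindex_bij_betw[OF bij_pair_label, symmetric])
  also have "\<dots> = (\<Sum>x\<in>index_pairs n k. kron_power n k h (j, fst x) * kron_power n k (\<lambda>a b. h b a) (snd x, i) * M x)"
  proof (intro sum.cong refl)
    fix x assume "x \<in> index_pairs n k"
    then obtain j' i' where x: "x = (j', i')" "j' \<in> ?I" "i' \<in> ?I" by auto
    have "(\<Prod>v\<in>vertices k. h (pair_label k (j, i) v) (pair_label k x v)) =
        kron_power n k h (j, j') * kron_power n k (\<lambda>a b. h b a) (i', i)"
      unfolding prod_vertices x(1) kron_power_apply[OF j x(2)] kron_power_apply[OF x(3) i]
      by (intro arg_cong2[of _ _ _ _ "(*)"] prod.cong refl) (simp_all only: pair_label_simps)
    then show "(\<Prod>v\<in>vertices k. h (pair_label k (j, i) v) (pair_label k x v)) * tensor_of_mat k M (pair_label k x) =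
        kron_power n k h (j, fst x) * kron_power n k (\<lambda>a b. h b a) (snd x, i) * M x"
      by (simp only: x(1) tensor_of_mat_pair_label[OF x(2,3)] fst_conv snd_conv)
  qed
  also have "\<dots> = (\<Sum>j'\<in>?I. \<Sum>i'\<in>?I. kron_power n k h (j, j') * kron_power n k (\<lambda>a b. h b a) (i', i) * M (j', i'))"
    unfolding sum.cartesian_product' by simp
  also have "\<dots> = (\<Sum>i'\<in>?I. \<Sum>j'\<in>?I. kron_power n k h (j, j') * kron_power n k (\<lambda>a b. h b a) (i', i) * M (j', i'))"
    by (rule sum.swap)
  also have "\<dots> = mat_prod ?I (mat_prod ?I (kron_power n k h) M) (kron_power n k (\<lambda>a b. h b a)) (j, i)"
    unfolding mat_prod_def prod.case sum_distrib_right by (intro sum.cong refl) (simp only: mult_ac)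
  finally show ?thesis .
qed

lemma mat_prod_supported:
  assumes "supported_on (I \<times> I) M" "supported_on (I \<times> I) N"
  shows "supported_on (I \<times> I) (mat_prod I M N)"
  using assms by (auto simp: supported_on_def mat_prod_def)

text \<open>Writing \<open>K\<close> for the tensor power of \<open>h\<close>, invariance reads
  \<open>K M K^t = M\<close>. Orthogonality makes \<open>K^t\<close> the inverse of
  \<open>K\<close>, so this is \<open>K M = M K\<close>.\<close>

lemma invariant_iff_commutes:
  assumes M: "supported_on (index_pairs n k) M"
  shows "invariant_tensor n (vertices k) (tensor_of_mat k M) \<longleftrightarrow>
    (\<forall>h. orth_fun n h \<longrightarrow>
      mat_prod (indices n k) M (kron_power n k h) = mat_prod (indices n k) (kron_power n k h) M)"
proof -
  let ?I = "indices n k" and ?K = "kron_power n k" and ?t = "\<lambda>h a b. h b a"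
  have lab: "labelings n (vertices k) = pair_label k ` index_pairs n k"
    using bij_pair_label by (rule bij_betw_imp_surj_on[symmetric])
  have "invariant_tensor n (vertices k) (tensor_of_mat k M) \<longleftrightarrow>
    (\<forall>h. orth_fun n h \<longrightarrow> (\<forall>x\<in>index_pairs n k. mat_prod ?I (mat_prod ?I (?K h) M) (?K (?t h)) x = M x))"
    unfolding invariant_tensor_def
  proof (intro all_cong1 imp_cong refl)
    fix h
    have "(\<Sum>l'\<in>labelings n (vertices k). (\<Prod>v\<in>vertices k. h (pair_label k x v) (l' v)) * tensor_of_mat k M l')
        = tensor_of_mat k M (pair_label k x) \<longleftrightarrow> mat_prod ?I (mat_prod ?I (?K h) M) (?K (?t h)) x = M x"
      if x: "x \<in> index_pairs n k" for x
    proof -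
      obtain j i where ji: "x = (j, i)" "j \<in> ?I" "i \<in> ?I" using x by auto
      show ?thesis unfolding ji(1) tensor_transform[OF ji(2,3)] tensor_of_mat_pair_label[OF ji(2,3)] ..
    qed
    then show "(\<forall>l\<in>labelings n (vertices k). (\<Sum>l'\<in>labelings n (vertices k).
          (\<Prod>v\<in>vertices k. h (l v) (l' v)) * tensor_of_mat k M l') = tensor_of_mat k M l) \<longleftrightarrow>
        (\<forall>x\<in>index_pairs n k. mat_prod ?I (mat_prod ?I (?K h) M) (?K (?t h)) x = M x)"
      unfolding lab ball_simps by (intro ball_cong refl) (simp only: lab)
  qed
  also have "\<dots> \<longleftrightarrow> (\<forall>h. orth_fun n h \<longrightarrow> mat_prod ?I M (?K h) = mat_prod ?I (?K h) M)"
  proof (intro all_cong1 imp_cong refl)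
    fix h assume h: "orth_fun n h"
    let ?P = "mat_prod ?I"
    note K = kron_power_supported[of n k h] kron_power_supported[of n k "?t h"]
    note KM = mat_prod_supported[OF K(1) M]
    show "(\<forall>x\<in>index_pairs n k. ?P (?P (?K h) M) (?K (?t h)) x = M x) \<longleftrightarrow> ?P M (?K h) = ?P (?K h) M"
    proof
      assume eq: "\<forall>x\<in>index_pairs n k. ?P (?P (?K h) M) (?K (?t h)) x = M x"
      have M_eq: "?P (?P (?K h) M) (?K (?t h)) = M"
      proof
        fix x
        show "?P (?P (?K h) M) (?K (?t h)) x = M x"
        proof (cases "x \<in> index_pairs n k")
          case True
          then show ?thesis by (rule eq[rule_format])
        next
          case False
          show ?thesis
            unfolding supported_onD[OF mat_prod_supported[OF KM K(2)] False] supported_onD[OF M False] ..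
        qed
      qed
      have "?P M (?K h) = ?P (?P (?P (?K h) M) (?K (?t h))) (?K h)" by (simp only: M_eq)
      also have "\<dots> = ?P (?K h) M"
        by (simp only: mat_prod_assoc[of _ "?P (?K h) M"] kron_power_transpose_inverse(2)[OF h]
            mat_prod_one_right[OF finite_indices KM])
      finally show "?P M (?K h) = ?P (?K h) M" .
    next
      assume "?P M (?K h) = ?P (?K h) M"
      then have "?P (?P (?K h) M) (?K (?t h)) = ?P (?P M (?K h)) (?K (?t h))" by (simp only:)
      also have "\<dots> = M"
        by (simp only: mat_prod_assoc kron_power_transpose_inverse(1)[OF h] mat_prod_one_right[OF finite_indices M])
      finally show "\<forall>x\<in>index_pairs n k. ?P (?P (?K h) M) (?K (?t h)) x = M x" by simp
    qed
  qed
  finally show ?thesis .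
qed

section \<open>The representation in matrix form\<close>

definition rb_mat :: "nat \<Rightarrow> nat \<Rightarrow> (diagram \<Rightarrow> complex) \<Rightarrow> index \<times> index \<Rightarrow> complex" where
  "rb_mat n k a = (\<lambda>(j, i). if (j, i) \<in> index_pairs n k
     then \<Sum>d\<in>rook_brauer_diagrams k. a d * diagram_weight k d i j else 0)"

lemma rb_mat_apply:
  "j \<in> indices n k \<Longrightarrow> i \<in> indices n k \<Longrightarrow>
   rb_mat n k a (j, i) = (\<Sum>d\<in>rook_brauer_diagrams k. a d * diagram_weight k d i j)"
  by (simp add: rb_mat_def)

lemma rb_mat_supported: "supported_on (index_pairs n k) (rb_mat n k a)"
  by (auto simp: supported_on_def rb_mat_def)

lemma finite_rook_brauer_diagrams: "finite (rook_brauer_diagrams k)"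
  unfolding rook_brauer_diagrams_eq by (rule finite_matchings[OF finite_vertices])

lemma rb_representation_eq: "rb_representation n k a = op_of_mat n k (rb_mat n k a)"
proof
  fix t
  let ?D = "rook_brauer_diagrams k" and ?I = "indices n k"
  show "rb_representation n k a t = op_of_mat n k (rb_mat n k a) t"
  proof (cases "t \<in> tensor_space n k")
    case True
    have "(\<Sum>d\<in>?D. a d * diagram_action n k d t j) = (if j \<in> ?I then \<Sum>i\<in>?I. t i * rb_mat n k a (j, i) else 0)" for j
    proof (cases "j \<in> ?I")
      case j: True
      have "(\<Sum>d\<in>?D. a d * diagram_action n k d t j) = (\<Sum>d\<in>?D. \<Sum>i\<in>?I. t i * (a d * diagram_weight k d i j))"
        using True j by (simp add: diagram_action_def linear_extension_def sum_distrib_left mult_ac)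
      also have "\<dots> = (\<Sum>i\<in>?I. t i * (\<Sum>d\<in>?D. a d * diagram_weight k d i j))"
        unfolding sum_distrib_left by (rule sum.swap)
      also have "\<dots> = (\<Sum>i\<in>?I. t i * rb_mat n k a (j, i))"
        using j by (intro sum.cong refl) (simp add: rb_mat_apply)
      finally show ?thesis using j by simp
    next
      case False
      then show ?thesis using True by (simp add: diagram_action_def linear_extension_def)
    qed
    then show ?thesis
      unfolding op_of_mat_apply[OF True] rb_representation_def restrict_apply'[OF True] by (rule ext)
  next
    case False
    then show ?thesis by (simp add: rb_representation_def op_of_mat_outside)
  qed
qed

lemma matching_weight_cong:
  assumes d: "d \<in> matchings X" and eq: "\<And>x. x \<in> X \<Longrightarrow> l x = l' x"
  shows "matching_weight X d l = matching_weight X d l'"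
proof -
  have "(\<forall>u\<in>e. \<forall>v\<in>e. l u = l v) \<longleftrightarrow> (\<forall>u\<in>e. \<forall>v\<in>e. l' u = l' v)" if "e \<in> d" for e
  proof (intro ball_cong refl)
    fix u v assume "u \<in> e" "v \<in> e"
    then have "l u = l' u" "l v = l' v" using eq matchingD(1)[OF d that] by blast+
    then show "l u = l v \<longleftrightarrow> l' u = l' v" by simp
  qed
  then show ?thesis
    unfolding matching_weight_def using eq
    by (intro arg_cong2[of _ _ _ _ "(*)"] prod.cong refl arg_cong[of _ _ of_bool]) auto
qed

lemma tensor_of_rb_mat:
  assumes "l \<in> labelings n (vertices k)"
  shows "tensor_of_mat k (rb_mat n k a) l = (\<Sum>d\<in>matchings (vertices k). a d * matching_weight (vertices k) d l)"
proof -
  obtain x where "x \<in> index_pairs n k" "l = pair_label k x"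
    using assms bij_betw_imp_surj_on[OF bij_pair_label, of k n] by blast
  then obtain j i where ji: "j \<in> indices n k" "i \<in> indices n k" "l = pair_label k (j, i)" by auto
  have "matching_weight (vertices k) d (vertex_label i j) = matching_weight (vertices k) d l"
    if "d \<in> matchings (vertices k)" for d
    using that by (rule matching_weight_cong) (simp add: ji(3) pair_label_def)
  then show ?thesis
    unfolding ji(3) tensor_of_mat_pair_label[OF ji(1,2)] rb_mat_apply[OF ji(1,2)] rook_brauer_diagrams_eq diagram_weight_eq
    by (intro sum.cong refl) (simp add: ji(3))
qed

lemma rb_mat_invariant: "invariant_tensor n (vertices k) (tensor_of_mat k (rb_mat n k a))"
proof -
  let ?X = "vertices k"
  have fin: "finite ?X" by (rule finite_vertices)
  have zero: "invariant_tensor n ?X (\<lambda>l. 0)" by (simp add: invariant_tensor_def)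
  \<comment> \<open>Closure under linear combinations is the difference lemma with
    \<open>T = 0\<close> and negated coefficients.\<close>
  have "invariant_tensor n ?X (\<lambda>l. 0 - (\<Sum>d\<in>matchings ?X. (- a d) * matching_weight ?X d l))"
    by (rule invariant_tensor_diff_sum[OF zero]) (rule matching_weight_invariant[OF fin])
  then have inv: "invariant_tensor n ?X (\<lambda>l. \<Sum>d\<in>matchings ?X. a d * matching_weight ?X d l)"
    by (simp add: sum_negf)
  then show ?thesis
    unfolding invariant_tensor_def by (simp add: tensor_of_rb_mat cong: sum.cong)
qed

lemma card_vertices: "card (vertices k) = 2 * k"
  by (simp add: vertices_def card_cartesian_product)

lemma commuting_mat_is_rb_mat:
  assumes kn: "k \<le> n" and M: "supported_on (index_pairs n k) M"
    and comm: "\<And>h. orth_fun n h \<Longrightarrow>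
      mat_prod (indices n k) M (kron_power n k h) = mat_prod (indices n k) (kron_power n k h) M"
  shows "\<exists>a. (\<forall>d. d \<notin> rook_brauer_diagrams k \<longrightarrow> a d = 0) \<and> M = rb_mat n k a"
proof -
  let ?X = "vertices k"
  have inv: "invariant_tensor n ?X (tensor_of_mat k M)"
    unfolding invariant_iff_commutes[OF M] by (intro allI impI comm)
  have card: "card ?X \<le> 2 * n" using kn by (simp add: card_vertices)
  from invariant_tensor_spanned[OF finite_vertices card inv]
  obtain a where "\<forall>l\<in>labelings n ?X.
      tensor_of_mat k M l = (\<Sum>d\<in>matchings ?X. a d * matching_weight ?X d l)" ..
  note a = bspec[OF this]
  \<comment> \<open>Truncation to diagrams puts the coefficients into the carrier of the
    algebra.\<close>
  define b where "b d = (if d \<in> rook_brauer_diagrams k then a d else 0)" for d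
  have "M x = rb_mat n k b x" for x
  proof (cases "x \<in> index_pairs n k")
    case True
    then obtain j i where ji: "x = (j, i)" "j \<in> indices n k" "i \<in> indices n k" by auto
    have l: "pair_label k (j, i) \<in> labelings n ?X"
      using bij_betw_apply[OF bij_pair_label] True ji(1) by blast
    have "M x = (\<Sum>d\<in>matchings ?X. a d * matching_weight ?X d (pair_label k (j, i)))"
      using a[OF l] unfolding tensor_of_mat_pair_label[OF ji(2,3)] ji(1) .
    also have "\<dots> = (\<Sum>d\<in>matchings ?X. b d * matching_weight ?X d (pair_label k (j, i)))"
      by (intro sum.cong refl) (simp add: b_def rook_brauer_diagrams_eq)
    also have "\<dots> = rb_mat n k b x"
      using tensor_of_rb_mat[OF l] unfolding tensor_of_mat_pair_label[OF ji(2,3)] ji(1) by (rule sym)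
    finally show ?thesis .
  next
    case False
    show ?thesis unfolding supported_onD[OF M False] supported_onD[OF rb_mat_supported False] ..
  qed
  then have "M = rb_mat n k b" by (rule ext)
  then show ?thesis by (intro exI[of _ b]) (simp add: b_def)
qed

lemma rb_mat_inj:
  assumes kn: "k \<le> n" and eq: "rb_mat n k a = rb_mat n k b"
    and a: "\<And>d. d \<notin> rook_brauer_diagrams k \<Longrightarrow> a d = 0" and b: "\<And>d. d \<notin> rook_brauer_diagrams k \<Longrightarrow> b d = 0"
  shows "a = b"
proof
  fix d
  show "a d = b d"
  proof (cases "d \<in> rook_brauer_diagrams k")
    case True
    then have d: "d \<in> matchings (vertices k)" by (simp add: rook_brauer_diagrams_eq)
    have card: "card (vertices k) \<le> 2 * n" using kn by (simp add: card_vertices)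
    have "(\<Sum>d\<in>matchings (vertices k). (a d - b d) * matching_weight (vertices k) d l) = 0"
      if l: "l \<in> labelings n (vertices k)" for l
    proof -
      have "(\<Sum>d\<in>matchings (vertices k). (a d - b d) * matching_weight (vertices k) d l) =
          tensor_of_mat k (rb_mat n k a) l - tensor_of_mat k (rb_mat n k b) l"
        unfolding tensor_of_rb_mat[OF l] by (simp add: left_diff_distrib sum_subtractf)
      then show ?thesis by (simp add: eq)
    qed
    from matching_weights_independent[OF finite_vertices card this d] show ?thesis by simp
  qed (simp add: a b)
qed

lemma diagram_comp_mem:
  assumes "d1 \<in> rook_brauer_diagrams k" "d2 \<in> rook_brauer_diagrams k"
  shows "diagram_comp k d1 d2 \<in> rook_brauer_diagrams k"
proof -
  interpret stacked_diagrams k d1 d2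
    by unfold_locales (use assms in \<open>simp_all add: rook_brauer_diagrams_eq\<close>)
  show ?thesis using d3_matching by (simp add: d3_def rook_brauer_diagrams_eq)
qed

lemma diagram_weight_mult:
  assumes "d1 \<in> rook_brauer_diagrams k" "d2 \<in> rook_brauer_diagrams k"
    and "i \<in> indices n k" "j \<in> indices n k"
  shows "(\<Sum>m\<in>indices n k. diagram_weight k d1 m j * diagram_weight k d2 i m) =
    of_nat (n + 1) ^ loops k d1 d2 * diagram_weight k (diagram_comp k d1 d2) i j"
proof -
  interpret stacked_diagrams k d1 d2
    by unfold_locales (use assms in \<open>simp_all add: rook_brauer_diagrams_eq\<close>)
  show ?thesis using assms(3,4) by (rule diagram_weight_comp)
qed

lemma rb_mat_mult:
  "rb_mat n k (a \<otimes>\<^bsub>rook_brauer_algebra k (of_nat (n + 1))\<^esub> b) =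
   mat_prod (indices n k) (rb_mat n k a) (rb_mat n k b)"
proof (rule ext, clarify)
  fix j i
  let ?I = "indices n k" and ?D = "rook_brauer_diagrams k" and ?w = "diagram_weight k"
  \<comment> \<open>Naming the parameter shields \<open>of_nat (n + 1)\<close> from
    simplification.\<close>
  define x :: complex where "x = of_nat (n + 1)"
  have "rb_mat n k (a \<otimes>\<^bsub>rook_brauer_algebra k x\<^esub> b) (j, i) =
      mat_prod ?I (rb_mat n k a) (rb_mat n k b) (j, i)"
  proof (cases "(j, i) \<in> index_pairs n k")
    case True
    then have j: "j \<in> ?I" and i: "i \<in> ?I" by auto
    let ?t = "\<lambda>d1 d2 d. a d1 * b d2 * (if d = diagram_comp k d1 d2 then x ^ loops k d1 d2 else 0) * ?w d i j"
    have "mat_prod ?I (rb_mat n k a) (rb_mat n k b) (j, i) =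
        (\<Sum>m\<in>?I. (\<Sum>d1\<in>?D. a d1 * ?w d1 m j) * (\<Sum>d2\<in>?D. b d2 * ?w d2 i m))"
      unfolding mat_prod_def prod.case by (intro sum.cong refl) (simp add: rb_mat_apply i j)
    also have "\<dots> = (\<Sum>m\<in>?I. \<Sum>d1\<in>?D. \<Sum>d2\<in>?D. a d1 * b d2 * (?w d1 m j * ?w d2 i m))"
      by (simp add: sum_product mult_ac)
    also have "\<dots> = (\<Sum>d1\<in>?D. \<Sum>m\<in>?I. \<Sum>d2\<in>?D. a d1 * b d2 * (?w d1 m j * ?w d2 i m))"
      by (rule sum.swap)
    also have "\<dots> = (\<Sum>d1\<in>?D. \<Sum>d2\<in>?D. \<Sum>m\<in>?I. a d1 * b d2 * (?w d1 m j * ?w d2 i m))"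
      by (intro sum.cong refl sum.swap)
    also have "\<dots> = (\<Sum>d1\<in>?D. \<Sum>d2\<in>?D. \<Sum>d\<in>?D. ?t d1 d2 d)"
    proof (intro sum.cong refl)
      fix d1 d2 assume d: "d1 \<in> ?D" "d2 \<in> ?D"
      let ?c = "diagram_comp k d1 d2"
      have "(\<Sum>d\<in>?D. a d1 * b d2 * (if d = ?c then x ^ loops k d1 d2 else 0) * ?w d i j) =
          (\<Sum>d\<in>?D. if d = ?c then a d1 * b d2 * (x ^ loops k d1 d2 * ?w ?c i j) else 0)"
        by (intro sum.cong refl) simp
      also have "\<dots> = a d1 * b d2 * (x ^ loops k d1 d2 * ?w ?c i j)"
        using finite_rook_brauer_diagrams diagram_comp_mem[OF d] by (simp add: sum.delta)
      also have "\<dots> = (\<Sum>m\<in>?I. a d1 * b d2 * (?w d1 m j * ?w d2 i m))"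
        unfolding diagram_weight_mult[OF d i j, folded x_def, symmetric] by (rule sum_distrib_left)
      finally show "(\<Sum>m\<in>?I. a d1 * b d2 * (?w d1 m j * ?w d2 i m)) =
          (\<Sum>d\<in>?D. a d1 * b d2 * (if d = ?c then x ^ loops k d1 d2 else 0) * ?w d i j)" by (rule sym)
    qed
    also have "\<dots> = (\<Sum>d1\<in>?D. \<Sum>d\<in>?D. \<Sum>d2\<in>?D. ?t d1 d2 d)"
      by (intro sum.cong refl sum.swap)
    also have "\<dots> = (\<Sum>d\<in>?D. \<Sum>d1\<in>?D. \<Sum>d2\<in>?D. ?t d1 d2 d)"
      by (rule sum.swap)
    also have "\<dots> = rb_mat n k (a \<otimes>\<^bsub>rook_brauer_algebra k x\<^esub> b) (j, i)"
      unfolding rb_mat_apply[OF j i] by (simp add: rook_brauer_algebra_def sum_distrib_right)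
    finally show ?thesis by (rule sym)
  next
    case False
    show ?thesis
      unfolding supported_onD[OF rb_mat_supported False]
        supported_onD[OF mat_prod_supported[OF rb_mat_supported rb_mat_supported] False] ..
  qed
  then show "rb_mat n k (a \<otimes>\<^bsub>rook_brauer_algebra k (of_nat (n + 1))\<^esub> b) (j, i) =
      mat_prod ?I (rb_mat n k a) (rb_mat n k b) (j, i)" unfolding x_def .
qed

lemma identity_diagram_mem: "identity_diagram k \<in> matchings (vertices k)"
  unfolding matchings_def identity_diagram_def by (auto simp: vertices_def)

lemma rb_mat_one: "rb_mat n k (\<one>\<^bsub>rook_brauer_algebra k x\<^esub>) = mat_one (indices n k)"
proof (rule ext, clarify)
  fix j i
  let ?I = "indices n k" and ?D = "rook_brauer_diagrams k" and ?id = "identity_diagram k"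
  show "rb_mat n k (\<one>\<^bsub>rook_brauer_algebra k x\<^esub>) (j, i) = mat_one ?I (j, i)"
  proof (cases "(j, i) \<in> index_pairs n k")
    case True
    then have j: "j \<in> ?I" and i: "i \<in> ?I" by auto
    have id: "?id \<in> ?D" by (simp add: rook_brauer_diagrams_eq identity_diagram_mem)
    have "rb_mat n k (\<one>\<^bsub>rook_brauer_algebra k x\<^esub>) (j, i) = (\<Sum>d\<in>?D. if d = ?id then diagram_weight k ?id i j else 0)"
      unfolding rb_mat_apply[OF j i] by (intro sum.cong refl) (simp add: rook_brauer_algebra_def)
    also have "\<dots> = diagram_weight k ?id i j"
      using id finite_rook_brauer_diagrams by (simp add: sum.delta)
    also have "\<dots> = of_bool ((\<forall>e\<in>?id. \<forall>u\<in>e. \<forall>v\<in>e. vertex_label i j u = vertex_label i j v) \<and>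
        (\<forall>v\<in>vertices k - \<Union> ?id. vertex_label i j v = 0))"
      unfolding diagram_weight_eq by (rule matching_weight_eq[OF finite_vertices identity_diagram_mem])
    also have "((\<forall>e\<in>?id. \<forall>u\<in>e. \<forall>v\<in>e. vertex_label i j u = vertex_label i j v) \<and>
        (\<forall>v\<in>vertices k - \<Union> ?id. vertex_label i j v = 0)) \<longleftrightarrow> j = i" (is "?L \<longleftrightarrow> _")
    proof
      assume A: ?L
      have "j p = i p" if p: "p \<in> {1..k}" for p
      proof -
        have "{(Top, p), (Bottom, p)} \<in> ?id" unfolding identity_diagram_def using p by blast
        from conjunct1[OF A, rule_format, OF this, of "(Top, p)" "(Bottom, p)"] show ?thesis by simp
      qed
      then show "j = i" by (rule PiE_ext[OF j[unfolded indices_def] i[unfolded indices_def]])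
    next
      assume ji: "j = i"
      have "v \<in> \<Union> ?id" if v: "v \<in> vertices k" for v
      proof -
        obtain lv p where lp: "v = (lv, p)" by (cases v)
        have p: "p \<in> {1..k}" "v \<in> {(Top, p), (Bottom, p)}" using v unfolding lp vertices_def by blast+
        have "{(Top, p), (Bottom, p)} \<in> ?id" unfolding identity_diagram_def using p(1) by blast
        then show ?thesis using p(2) by blast
      qed
      then have "vertices k - \<Union> ?id = {}" by blast
      moreover have "vertex_label i i u = vertex_label i i v" if "e \<in> ?id" "u \<in> e" "v \<in> e" for e u v
        using that by (auto simp: identity_diagram_def)
      ultimately show ?L unfolding ji by blast
    qed
    also have "of_bool (j = i) = mat_one ?I (j, i)" using i by (simp add: mat_one_def)
    finally show ?thesis .
  next
    case False
    then show ?thesis by (auto simp: rb_mat_def mat_one_def)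
  qed
qed

lemma rb_mat_add: "rb_mat n k (\<lambda>d. a d + b d) = (\<lambda>x. rb_mat n k a x + rb_mat n k b x)"
  by (auto simp: rb_mat_def fun_eq_iff distrib_right sum.distrib)

lemma rb_mat_scale: "rb_mat n k (\<lambda>d. c * a d) = (\<lambda>x. c * rb_mat n k a x)"
  by (auto simp: rb_mat_def fun_eq_iff sum_distrib_left mult.assoc)

section \<open>Commutants and generated subalgebras\<close>

lemma commutant_carrier:
  "op_of_mat n k M \<in> carrier (commutant (End_tensor n k) (group_action n k ` orthogonal_group n)) \<longleftrightarrow>
    (\<forall>h. orth_fun n h \<longrightarrow>
      mat_prod (indices n k) M (kron_power n k h) = mat_prod (indices n k) (kron_power n k h) M)"
  if M: "supported_on (index_pairs n k) M"
proof -
  have "op_of_mat n k M \<in> carrier (commutant (End_tensor n k) (group_action n k ` orthogonal_group n)) \<longleftrightarrow>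
    (\<forall>h. orth_fun n h \<longrightarrow> op_of_mat n k (mat_prod (indices n k) M (kron_power n k h)) =
      op_of_mat n k (mat_prod (indices n k) (kron_power n k h) M))"
    by (simp add: commutant_def group_action_image op_of_mat_carrier mult_op)
  also have "\<dots> \<longleftrightarrow> (\<forall>h. orth_fun n h \<longrightarrow>
      mat_prod (indices n k) M (kron_power n k h) = mat_prod (indices n k) (kron_power n k h) M)"
    using op_of_mat_inj mat_prod_supported M kron_power_supported by metis
  finally show ?thesis .
qed

lemma commutantD:
  assumes "F \<in> carrier (commutant A S)"
  shows "F \<in> carrier A" "H \<in> S \<Longrightarrow> F \<otimes>\<^bsub>A\<^esub> H = H \<otimes>\<^bsub>A\<^esub> F"
  using assms by (simp_all add: commutant_def)

lemma subalgebra_commutant: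
  assumes S: "S \<subseteq> carrier (End_tensor n k)"
  shows "is_subalgebra (carrier (commutant (End_tensor n k) S)) (End_tensor n k)"
proof -
  let ?E = "End_tensor n k"
  interpret ring ?E by (rule ring_End_tensor)
  have "subring (carrier (commutant ?E S)) ?E"
  proof (rule subringI)
    show "carrier (commutant ?E S) \<subseteq> carrier ?E" by (auto simp: commutant_def)
    show "\<one>\<^bsub>?E\<^esub> \<in> carrier (commutant ?E S)" using S by (auto simp: commutant_def)
    show "\<ominus>\<^bsub>?E\<^esub> F \<in> carrier (commutant ?E S)" if "F \<in> carrier (commutant ?E S)" for F
      using that S by (auto simp: commutant_def l_minus r_minus subset_iff)
    show "F \<otimes>\<^bsub>?E\<^esub> G \<in> carrier (commutant ?E S)"
      if F: "F \<in> carrier (commutant ?E S)" and G: "G \<in> carrier (commutant ?E S)" for F G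
    proof -
      have "(F \<otimes>\<^bsub>?E\<^esub> G) \<otimes>\<^bsub>?E\<^esub> H = H \<otimes>\<^bsub>?E\<^esub> (F \<otimes>\<^bsub>?E\<^esub> G)" if "H \<in> S" for H
      proof -
        have H: "H \<in> carrier ?E" using S that by blast
        have FG: "F \<in> carrier ?E" "G \<in> carrier ?E" "F \<otimes>\<^bsub>?E\<^esub> H = H \<otimes>\<^bsub>?E\<^esub> F" "G \<otimes>\<^bsub>?E\<^esub> H = H \<otimes>\<^bsub>?E\<^esub> G"
          using F G that by (auto simp: commutant_def)
        have "(F \<otimes>\<^bsub>?E\<^esub> G) \<otimes>\<^bsub>?E\<^esub> H = F \<otimes>\<^bsub>?E\<^esub> (H \<otimes>\<^bsub>?E\<^esub> G)" using m_assoc FG H by simp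
        also have "\<dots> = (H \<otimes>\<^bsub>?E\<^esub> F) \<otimes>\<^bsub>?E\<^esub> G" using m_assoc[of F H G] FG H by simp
        also have "\<dots> = H \<otimes>\<^bsub>?E\<^esub> (F \<otimes>\<^bsub>?E\<^esub> G)" by (rule m_assoc[OF H FG(1,2)])
        finally show ?thesis .
      qed
      then show ?thesis using F G by (auto simp: commutant_def)
    qed
    show "F \<oplus>\<^bsub>?E\<^esub> G \<in> carrier (commutant ?E S)"
      if "F \<in> carrier (commutant ?E S)" "G \<in> carrier (commutant ?E S)" for F G
      using that S by (auto simp: commutant_def l_distr r_distr subset_iff)
  qed
  \<comment> \<open>The ring structure says nothing about scalars, so they are moved past products
    in matrix form.\<close>
  moreover have "c \<odot>\<^bsub>?E\<^esub> F \<in> carrier (commutant ?E S)" if F: "F \<in> carrier (commutant ?E S)" for c F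
  proof -
    have "F \<in> carrier ?E" using F by (simp add: commutant_def)
    then obtain M where M: "F = op_of_mat n k M" using End_tensor_is_op by blast
    have "(c \<odot>\<^bsub>?E\<^esub> F) \<otimes>\<^bsub>?E\<^esub> H = H \<otimes>\<^bsub>?E\<^esub> (c \<odot>\<^bsub>?E\<^esub> F)" if "H \<in> S" for H
    proof -
      have "H \<in> carrier ?E" using S that by blast
      then obtain N where N: "H = op_of_mat n k N" using End_tensor_is_op by blast
      have left: "mat_prod (indices n k) (\<lambda>x. c * M x) N = (\<lambda>x. c * mat_prod (indices n k) M N x)"
        by (auto simp: mat_prod_def fun_eq_iff sum_distrib_left mult.assoc)
      have "F \<otimes>\<^bsub>?E\<^esub> H = H \<otimes>\<^bsub>?E\<^esub> F" using F that by (simp add: commutant_def)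
      then have "c \<odot>\<^bsub>?E\<^esub> (F \<otimes>\<^bsub>?E\<^esub> H) = c \<odot>\<^bsub>?E\<^esub> (H \<otimes>\<^bsub>?E\<^esub> F)" by (rule arg_cong)
      then show ?thesis unfolding M N smult_op mult_op left mat_prod_scale_right .
    qed
    moreover have "c \<odot>\<^bsub>?E\<^esub> F \<in> carrier ?E" by (simp add: M smult_op op_of_mat_carrier)
    ultimately show ?thesis by (simp add: commutant_def)
  qed
  ultimately show ?thesis unfolding is_subalgebra_def by blast
qed

text \<open>Every subalgebra containing the operators of \<open>G\<close> contains those of the
  linear span. Since \<open>bicommutant\<close> ends in a span, this is the link to the generated
  subalgebra.\<close>

lemma op_lin_span_mem:
  assumes B: "is_subalgebra B (End_tensor n k)" and G: "op_of_mat n k ` G \<subseteq> B" and M: "M \<in> lin_span G"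
  shows "op_of_mat n k M \<in> B"
proof -
  have ring: "subring B (End_tensor n k)" and smult: "\<And>c b. b \<in> B \<Longrightarrow> c \<odot>\<^bsub>End_tensor n k\<^esub> b \<in> B"
    using B unfolding is_subalgebra_def by blast+
  show ?thesis
    using M
  proof induction
    case zero
    have "\<zero>\<^bsub>End_tensor n k\<^esub> \<in> B" by (rule subringE(2)[OF ring])
    then show ?case by (simp add: zero_op)
  next
    case (base a)
    then show ?case using G by blast
  next
    case (add u v)
    have "op_of_mat n k u \<oplus>\<^bsub>End_tensor n k\<^esub> op_of_mat n k v \<in> B"
      by (rule subringE(7)[OF ring add.IH])
    then show ?case by (simp add: add_op)
  next
    case (scale u c)
    have "c \<odot>\<^bsub>End_tensor n k\<^esub> op_of_mat n k u \<in> B" by (rule smult[OF scale.IH])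
    then show ?case by (simp add: smult_op)
  qed
qed

theorem rb_representation_iso:
  assumes kn: "k \<le> n"
  shows "rb_representation n k \<in> algebra_iso (rook_brauer_algebra k (of_nat (n + 1)))
    (commutant (End_tensor n k) (group_action n k ` orthogonal_group n))"
proof -
  let ?A = "rook_brauer_algebra k (of_nat (n + 1))"
  let ?C = "commutant (End_tensor n k) (group_action n k ` orthogonal_group n)"
  have carr: "carrier ?A = {a. \<forall>d. d \<notin> rook_brauer_diagrams k \<longrightarrow> a d = 0}"
    by (simp add: rook_brauer_algebra_def)
  have ops: "monoid.mult ?C = monoid.mult (End_tensor n k)" "\<one>\<^bsub>?C\<^esub> = \<one>\<^bsub>End_tensor n k\<^esub>"
    "ring.add ?C = ring.add (End_tensor n k)" "module.smult ?C = module.smult (End_tensor n k)"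
    by (simp_all add: commutant_def)
  have closed: "rb_representation n k a \<in> carrier ?C" for a
    unfolding rb_representation_eq commutant_carrier[OF rb_mat_supported]
    using invariant_iff_commutes[OF rb_mat_supported] rb_mat_invariant by blast
  have hom: "rb_representation n k \<in> Ring.ring_hom ?A ?C"
  proof (rule ring_hom_memI)
    show "rb_representation n k (a \<otimes>\<^bsub>?A\<^esub> b) = rb_representation n k a \<otimes>\<^bsub>?C\<^esub> rb_representation n k b" for a b
      unfolding rb_representation_eq ops mult_op rb_mat_mult ..
    show "rb_representation n k (a \<oplus>\<^bsub>?A\<^esub> b) = rb_representation n k a \<oplus>\<^bsub>?C\<^esub> rb_representation n k b" for a b
    proof -
      have "a \<oplus>\<^bsub>?A\<^esub> b = (\<lambda>d. a d + b d)" by (simp add: rook_brauer_algebra_def)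
      then show ?thesis unfolding rb_representation_eq ops add_op by (simp only: rb_mat_add)
    qed
    show "rb_representation n k \<one>\<^bsub>?A\<^esub> = \<one>\<^bsub>?C\<^esub>"
      unfolding rb_representation_eq ops one_op rb_mat_one ..
  qed (rule closed)
  have "inj_on (rb_representation n k) (carrier ?A)"
  proof (rule inj_onI)
    fix a b assume a: "a \<in> carrier ?A" and b: "b \<in> carrier ?A"
      and eq: "rb_representation n k a = rb_representation n k b"
    have "rb_mat n k a = rb_mat n k b"
      by (rule op_of_mat_inj[OF _ rb_mat_supported rb_mat_supported]) (use eq in \<open>simp only: rb_representation_eq\<close>)
    then show "a = b" using a b unfolding carr by (intro rb_mat_inj[OF kn]) auto
  qed
  moreover have "rb_representation n k ` carrier ?A = carrier ?C"
  proof (intro equalityI subsetI)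
    fix F assume F: "F \<in> carrier ?C"
    then have "F \<in> carrier (End_tensor n k)" by (simp add: commutant_def)
    then obtain M where M: "supported_on (index_pairs n k) M" "F = op_of_mat n k M"
      using End_tensor_is_op by blast
    then obtain a where "\<forall>d. d \<notin> rook_brauer_diagrams k \<longrightarrow> a d = 0" "M = rb_mat n k a"
      using commuting_mat_is_rb_mat[OF kn M(1)] F commutant_carrier[OF M(1)] by blast
    then show "F \<in> rb_representation n k ` carrier ?A" unfolding M(2) carr rb_representation_eq by blast
  qed (use closed in blast)
  ultimately have "rb_representation n k \<in> ring_iso ?A ?C"
    using hom unfolding ring_iso_def bij_betw_def by blast
  moreover have "rb_representation n k (c \<odot>\<^bsub>?A\<^esub> a) = c \<odot>\<^bsub>?C\<^esub> rb_representation n k a" for c a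
  proof -
    have "c \<odot>\<^bsub>?A\<^esub> a = (\<lambda>d. c * a d)" by (simp add: rook_brauer_algebra_def)
    then show ?thesis unfolding rb_representation_eq ops smult_op by (simp only: rb_mat_scale)
  qed
  ultimately show ?thesis unfolding algebra_iso_def by blast
qed

text \<open>By the isomorphism the diagram operators form the full commutant of the group, so the
  claim is a double commutant statement for the group. One inclusion is formal, the other is
  \<open>bicommutant\<close>.\<close>

theorem generated_subalgebra_eq:
  assumes kn: "k \<le> n"
  shows "generated_subalgebra (End_tensor n k) (group_action n k ` orthogonal_group n) =
    carrier (commutant (End_tensor n k)
      (rb_representation n k ` carrier (rook_brauer_algebra k (of_nat (n + 1)))))"
proof -
  let ?E = "End_tensor n k" and ?I = "indices n k"
  let ?A = "rook_brauer_algebra k (of_nat (n + 1))"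
  let ?S = "group_action n k ` orthogonal_group n"
  let ?R = "rb_representation n k ` carrier ?A"
  let ?G = "kron_power n k ` {h. orth_fun n h}"
  have S: "?S = op_of_mat n k ` ?G" by (rule group_action_image)
  have R: "?R = carrier (commutant ?E ?S)"
    using rb_representation_iso[OF kn] unfolding algebra_iso_def ring_iso_def bij_betw_def by blast
  have R_sub: "?R \<subseteq> carrier ?E" unfolding R by (auto simp: commutant_def)
  have S_sub: "?S \<subseteq> carrier ?E" unfolding S by (rule image_subsetI) (rule op_of_mat_carrier)
  show ?thesis
  proof (intro equalityI subsetI)
    fix F assume F: "F \<in> generated_subalgebra ?E ?S"
    have "?S \<subseteq> carrier (commutant ?E ?R)"
    proof
      fix H assume H: "H \<in> ?S"
      have "H \<otimes>\<^bsub>?E\<^esub> G = G \<otimes>\<^bsub>?E\<^esub> H" if "G \<in> ?R" for G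
        using commutantD(2)[OF that[unfolded R] H] by (rule sym)
      then show "H \<in> carrier (commutant ?E ?R)" using subsetD[OF S_sub H] by (simp add: commutant_def)
    qed
    with subalgebra_commutant[OF R_sub]
    have "carrier (commutant ?E ?R) \<in> {B. is_subalgebra B ?E \<and> ?S \<subseteq> B}" by (intro CollectI conjI)
    with F show "F \<in> carrier (commutant ?E ?R)" unfolding generated_subalgebra_def by (rule InterD)
  next
    fix F assume F: "F \<in> carrier (commutant ?E ?R)"
    then have "F \<in> carrier ?E" by (simp add: commutant_def)
    then obtain M where M: "supported_on (index_pairs n k) M" "F = op_of_mat n k M"
      using End_tensor_is_op by blast
    have "M \<in> lin_span ?G"
    proof (rule bicommutant[OF finite_indices])
      show "supported_on (index_pairs n k) a" if "a \<in> ?G" for a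
        using that kron_power_supported by blast
      show "mat_one ?I \<in> ?G" unfolding kron_power_delta[symmetric] using orth_fun_delta by blast
      show "mat_prod ?I a b \<in> ?G" if ab: "a \<in> ?G" "b \<in> ?G" for a b
      proof -
        obtain h1 where h1: "orth_fun n h1" "a = kron_power n k h1" using ab(1) by blast
        obtain h2 where h2: "orth_fun n h2" "b = kron_power n k h2" using ab(2) by blast
        show ?thesis
          unfolding h1(2) h2(2) kron_power_mult by (intro imageI CollectI orth_fun_mult h1(1) h2(1))
      qed
      show "mat_adjoint a \<in> ?G" if a: "a \<in> ?G" for a
      proof -
        obtain h where h: "orth_fun n h" "a = kron_power n k h" using a by blast
        show ?thesis
          unfolding h(2) kron_power_adjoint
          by (intro imageI CollectI orth_fun_cnj[OF orth_fun_transpose[OF h(1)]])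
      qed
      show "supported_on (index_pairs n k) M" by (rule M(1))
      fix N assume N: "supported_on (index_pairs n k) N" and comm: "\<forall>a\<in>?G. mat_prod ?I N a = mat_prod ?I a N"
      \<comment> \<open>Surjectivity of the representation enters here: an operator commuting with
        the group is a diagram operator, and \<open>F\<close> commutes with those by
        assumption.\<close>
      have "op_of_mat n k N \<in> ?R"
        unfolding R commutant_carrier[OF N] by (intro allI impI comm[rule_format] imageI CollectI)
      then have "F \<otimes>\<^bsub>?E\<^esub> op_of_mat n k N = op_of_mat n k N \<otimes>\<^bsub>?E\<^esub> F"
        by (rule commutantD(2)[OF F])
      then have "op_of_mat n k (mat_prod ?I N M) = op_of_mat n k (mat_prod ?I M N)"
        unfolding M(2) mult_op by (rule sym)
      then show "mat_prod ?I N M = mat_prod ?I M N"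
        by (rule op_of_mat_inj) (intro mat_prod_supported N M(1))+
    qed
    then have "F \<in> B" if "is_subalgebra B ?E" "?S \<subseteq> B" for B
      unfolding M(2) by (rule op_lin_span_mem[OF that(1) that(2)[unfolded S]])
    then show "F \<in> generated_subalgebra ?E ?S"
      unfolding generated_subalgebra_def by (intro InterI) (elim CollectE conjE)
  qed
qed

theorem mainTheorem4:
  fixes n k :: nat
  assumes "n \<ge> 1" and "n \<ge> k"
  shows "rb_representation n k \<in>
           algebra_iso (rook_brauer_algebra k (of_nat (n + 1)))
             (commutant (End_tensor n k) (group_action n k ` orthogonal_group n)) \<and>
         generated_subalgebra (End_tensor n k) (group_action n k ` orthogonal_group n) =
           carrier (commutant (End_tensor n k)
             (rb_representation n k ` carrier (rook_brauer_algebra k (of_nat (n + 1)))))"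
  using rb_representation_iso[OF assms(2)] generated_subalgebra_eq[OF assms(2)] by blast

end
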